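(* Let $M$ be a compact Kähler-Einstein manifold, let $K$ be a compact connected group of isometries of $M$ acting in a Hamiltonian fashion, and let $\widetilde{\mu}:M\to\mathfrak{k}^*$ be the canonical moment map. Then a Lagrangian $K$-orbit $\mathcal{O}$ is minimal if and only if $\widetilde{\mu}(\mathcal{O})=0$.
   Context: Let $(M,\omega,J)$ be a compact Kähler manifold of real dimension $2n$. A submanifold is Lagrangian if it has real dimension $n$ and $\omega$ vanishes on it; it is minimal if its mean curvature vector vanishes identically. A moment map for the $K$-action is a smooth map $\mu:M\to\mathfrak{k}^*$, $\mathfrak{k}=\mathrm{Lie}(K)$, equivariant for the coadjoint action, with $d\mu_p(v)(X)=\omega_p(v,\widehat{X}_p)$ for all $p\in M$, $v\in T_pM$, $X\in\mathfrak{k}$, where $\widehat{X}$ is the fundamental vector field of $X$; the action is Hamiltonian if a moment map exists. The canonical moment map $\widetilde{\mu}$ is the moment map characterized by $\int_M\widetilde{\mu}\,\omega^n=0$. *)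

theory Defs
  imports "HOL-Analysis.Analysis"
begin

section \<open>Smooth manifolds\<close>

text \<open>Only meant for open sets and finite-dimensional domains, where it is the usual notion of
  a \<open>C\<^sup>k\<close> function (all iterated directional derivatives exist and are continuous).\<close>

primrec Ck_on :: "nat \<Rightarrow> 'a::real_normed_vector set \<Rightarrow> ('a \<Rightarrow> 'b::real_normed_vector) \<Rightarrow> bool" where
  "Ck_on 0 S f = continuous_on S f"
| "Ck_on (Suc k) S f = ((\<forall>x\<in>S. f differentiable (at x)) \<and>
     (\<forall>v. Ck_on k S (\<lambda>x. frechet_derivative f (at x) v)))"

definition smooth_on :: "'a::real_normed_vector set \<Rightarrow> ('a \<Rightarrow> 'b::real_normed_vector) \<Rightarrow> bool" where
  "smooth_on S f \<longleftrightarrow> (\<forall>k. Ck_on k S f)"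

text \<open>A chart is a domain together with a coordinate map; the values of the coordinate map
  outside of the domain are irrelevant.\<close>

type_synonym ('a, 'e) chart = "'a set \<times> ('a \<Rightarrow> 'e)"

definition cdom :: "('a, 'e) chart \<Rightarrow> 'a set" where
  "cdom c = fst c"

definition coord :: "('a, 'e) chart \<Rightarrow> 'a \<Rightarrow> 'e" where
  "coord c = snd c"

definition cran :: "('a, 'e) chart \<Rightarrow> 'e set" where
  "cran c = coord c ` cdom c"

definition cinv :: "('a, 'e) chart \<Rightarrow> 'e \<Rightarrow> 'a" where
  "cinv c = inv_into (cdom c) (coord c)"

definition rep_dom :: "('a, 'e) chart \<Rightarrow> ('b, 'f) chart \<Rightarrow> ('a \<Rightarrow> 'b) \<Rightarrow> 'e set" where
  "rep_dom c d f = coord c ` (cdom c \<inter> f -` cdom d)"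

definition rep :: "('a, 'e) chart \<Rightarrow> ('b, 'f) chart \<Rightarrow> ('a \<Rightarrow> 'b) \<Rightarrow> 'e \<Rightarrow> 'f" where
  "rep c d f = coord d \<circ> f \<circ> cinv c"

definition smooth_map :: "('a::topological_space, 'e::real_normed_vector) chart set \<Rightarrow>
    ('b::topological_space, 'f::real_normed_vector) chart set \<Rightarrow> ('a \<Rightarrow> 'b) \<Rightarrow> bool" where
  "smooth_map A B f \<longleftrightarrow>
     f ` (\<Union>c\<in>A. cdom c) \<subseteq> (\<Union>d\<in>B. cdom d) \<and>
     continuous_on (\<Union>c\<in>A. cdom c) f \<and>
     (\<forall>c\<in>A. \<forall>d\<in>B. smooth_on (rep_dom c d f) (rep c d f))"

text \<open>A smooth atlas (not necessarily maximal) on the subspace \<open>S\<close>. The last conjunct says that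
  all transition maps are smooth.\<close>

definition smooth_atlas :: "'a::topological_space set \<Rightarrow> ('a, 'e::euclidean_space) chart set \<Rightarrow> bool" where
  "smooth_atlas S A \<longleftrightarrow>
     (\<Union>c\<in>A. cdom c) = S \<and>
     (\<forall>c\<in>A. openin (top_of_set S) (cdom c) \<and> open (cran c) \<and>
        homeomorphism (cdom c) (cran c) (coord c) (cinv c)) \<and>
     smooth_map A A (\<lambda>p. p)"

definition euclidean_atlas :: "'e::real_normed_vector set \<Rightarrow> ('e, 'e) chart set" where
  "euclidean_atlas U = {(U, \<lambda>x. x)}"

definition prod_atlas :: "('a, 'e) chart set \<Rightarrow> ('b, 'f) chart set \<Rightarrow> ('a \<times> 'b, 'e \<times> 'f) chart set" where
  "prod_atlas A B = {(cdom c \<times> cdom d, map_prod (coord c) (coord d)) | c d. c \<in> A \<and> d \<in> B}"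


section \<open>Riemannian metrics\<close>

text \<open>A field of bilinear forms is given by its components in the charts: \<open>g c x u v\<close> is the
  value at the point with coordinates \<open>x\<close> in the chart \<open>c\<close> on the tangent vectors with
  components \<open>u\<close> and \<open>v\<close> in that chart. The local expression \<open>g c\<close> is usually called \<open>h\<close>.\<close>

definition preserves_metric ::
    "('m, 'e::euclidean_space) chart set \<Rightarrow> (('m, 'e) chart \<Rightarrow> 'e \<Rightarrow> 'e \<Rightarrow> 'e \<Rightarrow> real) \<Rightarrow> ('m \<Rightarrow> 'm) \<Rightarrow> bool" where
  "preserves_metric A g f \<longleftrightarrow>
     (\<forall>c\<in>A. \<forall>d\<in>A. \<forall>x\<in>rep_dom c d f. \<forall>u v.
        g d (rep c d f x) (frechet_derivative (rep c d f) (at x) u)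
                          (frechet_derivative (rep c d f) (at x) v) = g c x u v)"

text \<open>For the identity map, preservation of the metric is the transformation law of its components
  under changes of coordinates.\<close>

definition riemannian_metric ::
    "('m, 'e::euclidean_space) chart set \<Rightarrow> (('m, 'e) chart \<Rightarrow> 'e \<Rightarrow> 'e \<Rightarrow> 'e \<Rightarrow> real) \<Rightarrow> bool" where
  "riemannian_metric A g \<longleftrightarrow>
     (\<forall>c\<in>A. \<forall>x\<in>cran c. bilinear (g c x) \<and> (\<forall>u v. g c x u v = g c x v u) \<and>
        (\<forall>u. u \<noteq> 0 \<longrightarrow> g c x u u > 0)) \<and>
     (\<forall>c\<in>A. \<forall>u v. smooth_on (cran c) (\<lambda>x. g c x u v)) \<and>
     preserves_metric A g (\<lambda>p. p)"

definition isometry :: "('m::topological_space, 'e::euclidean_space) chart set \<Rightarrow>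
    (('m, 'e) chart \<Rightarrow> 'e \<Rightarrow> 'e \<Rightarrow> 'e \<Rightarrow> real) \<Rightarrow> ('m \<Rightarrow> 'm) \<Rightarrow> bool" where
  "isometry A g f \<longleftrightarrow> bij f \<and> smooth_map A A f \<and> smooth_map A A (inv f) \<and> preserves_metric A g f"

text \<open>The Christoffel form of the Levi-Civita connection: \<open>christoffel h x u v\<close> is
  \<open>\<nabla>\<^sub>u v\<close> at \<open>x\<close> for the coordinate vector fields with constant components \<open>u\<close> and \<open>v\<close>,
  determined by the Koszul formula.\<close>

definition christoffel :: "('e::euclidean_space \<Rightarrow> 'e \<Rightarrow> 'e \<Rightarrow> real) \<Rightarrow> 'e \<Rightarrow> 'e \<Rightarrow> 'e \<Rightarrow> 'e" where
  "christoffel h x u v = (THE z. \<forall>w. 2 * h x z w =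
       frechet_derivative (\<lambda>y. h y v w) (at x) u
     + frechet_derivative (\<lambda>y. h y u w) (at x) v
     - frechet_derivative (\<lambda>y. h y u v) (at x) w)"

text \<open>\<open>curvature h x u v w\<close> is \<open>R(u,v)w = \<nabla>\<^sub>u \<nabla>\<^sub>v w - \<nabla>\<^sub>v \<nabla>\<^sub>u w\<close> for constant \<open>u\<close>, \<open>v\<close>, \<open>w\<close>
  (whose brackets vanish).\<close>

definition curvature :: "('e::euclidean_space \<Rightarrow> 'e \<Rightarrow> 'e \<Rightarrow> real) \<Rightarrow> 'e \<Rightarrow> 'e \<Rightarrow> 'e \<Rightarrow> 'e \<Rightarrow> 'e" where
  "curvature h x u v w =
       frechet_derivative (\<lambda>y. christoffel h y v w) (at x) u
     - frechet_derivative (\<lambda>y. christoffel h y u w) (at x) v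
     + christoffel h x u (christoffel h x v w)
     - christoffel h x v (christoffel h x u w)"

text \<open>The trace of \<open>b \<mapsto> R(b,u)v\<close>; traces may be computed in the standard basis, which need not
  be orthonormal for the metric.\<close>

definition ricci :: "('e::euclidean_space \<Rightarrow> 'e \<Rightarrow> 'e \<Rightarrow> real) \<Rightarrow> 'e \<Rightarrow> 'e \<Rightarrow> 'e \<Rightarrow> real" where
  "ricci h x u v = (\<Sum>b\<in>Basis. curvature h x b u v \<bullet> b)"

definition einstein ::
    "('m, 'e::euclidean_space) chart set \<Rightarrow> (('m, 'e) chart \<Rightarrow> 'e \<Rightarrow> 'e \<Rightarrow> 'e \<Rightarrow> real) \<Rightarrow> bool" where
  "einstein A g \<longleftrightarrow> (\<exists>l::real. \<forall>c\<in>A. \<forall>x\<in>cran c. \<forall>u v. ricci (g c) x u v = l * g c x u v)"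


section \<open>Kaehler manifolds\<close>

text \<open>The complex structure is given by a holomorphic atlas modelled on \<open>complex ^ 'n\<close>
  (real dimension \<open>2 * CARD('n)\<close>), so that in every chart \<open>J\<close> is multiplication by \<open>\<i>\<close>.\<close>

definition holomorphic_atlas :: "('m::topological_space, complex^'n) chart set \<Rightarrow> bool" where
  "holomorphic_atlas A \<longleftrightarrow> smooth_atlas UNIV A \<and>
     (\<forall>c\<in>A. \<forall>d\<in>A. \<forall>x\<in>rep_dom c d (\<lambda>p. p). \<forall>v.
        frechet_derivative (rep c d (\<lambda>p. p)) (at x) (\<i> *s v) =
        \<i> *s frechet_derivative (rep c d (\<lambda>p. p)) (at x) v)"

text \<open>\<open>\<omega>(u,v) = g(Ju,v)\<close>, equivalently \<open>g(u,v) = \<omega>(u,Jv)\<close>.\<close>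

definition kaehler_form :: "(complex^'n \<Rightarrow> complex^'n \<Rightarrow> complex^'n \<Rightarrow> real) \<Rightarrow>
    complex^'n \<Rightarrow> complex^'n \<Rightarrow> complex^'n \<Rightarrow> real" where
  "kaehler_form h x u v = h x (\<i> *s u) v"

definition closed_2form :: "('e::euclidean_space \<Rightarrow> 'e \<Rightarrow> 'e \<Rightarrow> real) \<Rightarrow> 'e set \<Rightarrow> bool" where
  "closed_2form w S \<longleftrightarrow> (\<forall>x\<in>S. \<forall>a b c.
       frechet_derivative (\<lambda>y. w y b c) (at x) a
     + frechet_derivative (\<lambda>y. w y c a) (at x) b
     + frechet_derivative (\<lambda>y. w y a b) (at x) c = 0)"

definition kaehler :: "('m::topological_space, complex^'n) chart set \<Rightarrow>
    (('m, complex^'n) chart \<Rightarrow> complex^'n \<Rightarrow> complex^'n \<Rightarrow> complex^'n \<Rightarrow> real) \<Rightarrow> bool" where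
  "kaehler A g \<longleftrightarrow> holomorphic_atlas A \<and> riemannian_metric A g \<and>
     (\<forall>c\<in>A. \<forall>x\<in>cran c. \<forall>u v. g c x (\<i> *s u) (\<i> *s v) = g c x u v) \<and>
     (\<forall>c\<in>A. closed_2form (kaehler_form (g c)) (cran c))"

text \<open>The component of the \<open>n\<close>-fold wedge power of \<open>\<omega>\<close> with respect to the real frame
  \<open>e\<^sub>j, \<i> e\<^sub>j\<close>, as a sum over the permutations of the \<open>2n\<close> indices. The order of the pairs
  \<open>(e\<^sub>j, \<i> e\<^sub>j)\<close> does not matter.\<close>

definition real_frame :: "'n \<times> bool \<Rightarrow> complex^'n" where
  "real_frame k = axis (fst k) (if snd k then \<i> else 1)"

definition omega_power :: "(complex^'n \<Rightarrow> complex^'n \<Rightarrow> complex^'n \<Rightarrow> real) \<Rightarrow> complex^'n \<Rightarrow> real" where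
  "omega_power h x = (1 / 2 ^ CARD('n)) *
     (\<Sum>s | s permutes (UNIV :: ('n \<times> bool) set). of_int (sign s) *
        (\<Prod>j\<in>(UNIV :: 'n set).
           kaehler_form h x (real_frame (s (j, False))) (real_frame (s (j, True)))))"

text \<open>Integration of a top-degree form on a compact manifold by means of a finite smooth
  partition of unity subordinate to the charts; the charts of a holomorphic atlas are compatibly
  oriented.\<close>

definition partition_of_unity :: "('m::topological_space, 'e::euclidean_space) chart set \<Rightarrow>
    ('m, 'e) chart set \<Rightarrow> (('m, 'e) chart \<Rightarrow> 'm \<Rightarrow> real) \<Rightarrow> bool" where
  "partition_of_unity A P \<rho> \<longleftrightarrow> finite P \<and> P \<subseteq> A \<and>
     (\<forall>c\<in>P. smooth_map A (euclidean_atlas UNIV) (\<rho> c) \<and> (\<forall>p. \<rho> c p \<ge> 0) \<and>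
        closure {p. \<rho> c p \<noteq> 0} \<subseteq> cdom c) \<and>
     (\<forall>p. (\<Sum>c\<in>P. \<rho> c p) = 1)"

text \<open>\<open>I\<close> is the integral over the manifold of \<open>f \<omega>\<^sup>n\<close>, for a vector-valued \<open>f\<close>.\<close>

definition has_omega_integral :: "('m::topological_space, complex^'n) chart set \<Rightarrow>
    (('m, complex^'n) chart \<Rightarrow> complex^'n \<Rightarrow> complex^'n \<Rightarrow> complex^'n \<Rightarrow> real) \<Rightarrow>
    ('m \<Rightarrow> 'b::banach) \<Rightarrow> 'b \<Rightarrow> bool" where
  "has_omega_integral A g f I \<longleftrightarrow> (\<exists>P \<rho>. partition_of_unity A P \<rho> \<and>
     I = (\<Sum>c\<in>P. integral (cran c)
            (\<lambda>x. (\<rho> c (cinv c x) * omega_power (g c) x) *\<^sub>R f (cinv c x))))"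


section \<open>Submanifolds and mean curvature\<close>

definition local_parametrization :: "('m::topological_space, 'e::euclidean_space) chart set \<Rightarrow> 'm set \<Rightarrow>
    (real^'l) set \<Rightarrow> (real^'l \<Rightarrow> 'm) \<Rightarrow> bool" where
  "local_parametrization A S U f \<longleftrightarrow> open U \<and> smooth_map (euclidean_atlas U) A f \<and>
     (\<forall>c\<in>A. \<forall>t\<in>U \<inter> f -` cdom c. inj (frechet_derivative (coord c \<circ> f) (at t))) \<and>
     openin (top_of_set S) (f ` U) \<and> (\<exists>f'. homeomorphism U (f ` U) f f')"

text \<open>Embedded submanifolds of dimension \<open>CARD('l)\<close>.\<close>

definition submanifold :: "'l::finite itself \<Rightarrow> ('m::topological_space, 'e::euclidean_space) chart set \<Rightarrow> 'm set \<Rightarrow> bool" where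
  "submanifold L A S \<longleftrightarrow>
     (\<forall>p\<in>S. \<exists>(U :: (real^'l) set) f. local_parametrization A S U f \<and> p \<in> f ` U)"

definition lagrangian :: "('m::topological_space, complex^'n) chart set \<Rightarrow>
    (('m, complex^'n) chart \<Rightarrow> complex^'n \<Rightarrow> complex^'n \<Rightarrow> complex^'n \<Rightarrow> real) \<Rightarrow> 'm set \<Rightarrow> bool" where
  "lagrangian A g S \<longleftrightarrow> submanifold TYPE('n) A S \<and>
     (\<forall>(U :: (real^'n) set) f. local_parametrization A S U f \<longrightarrow>
        (\<forall>c\<in>A. \<forall>t\<in>U \<inter> f -` cdom c. \<forall>a b.
           kaehler_form (g c) (coord c (f t)) (frechet_derivative (coord c \<circ> f) (at t) a)
                                              (frechet_derivative (coord c \<circ> f) (at t) b) = 0))"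

definition normal_part :: "('e::euclidean_space \<Rightarrow> 'e \<Rightarrow> real) \<Rightarrow> 'e set \<Rightarrow> 'e \<Rightarrow> 'e" where
  "normal_part b T w = (THE z. w - z \<in> T \<and> (\<forall>u\<in>T. b z u = 0))"

text \<open>In what follows \<open>F\<close> is the expression of a local parametrization in a chart with local
  metric \<open>h\<close>. The second fundamental form on the tangent vectors with parameter components
  \<open>a\<close> and \<open>b\<close> is the normal part of \<open>\<nabla>\<^sub>b (dF a)\<close>.\<close>

definition second_fundamental_form ::
    "('e::euclidean_space \<Rightarrow> 'e \<Rightarrow> 'e \<Rightarrow> real) \<Rightarrow> (real^'l \<Rightarrow> 'e) \<Rightarrow> real^'l \<Rightarrow> real^'l \<Rightarrow> real^'l \<Rightarrow> 'e" where
  "second_fundamental_form h F t a b =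
     normal_part (h (F t)) (range (frechet_derivative F (at t)))
       (frechet_derivative (\<lambda>s. frechet_derivative F (at s) a) (at t) b
        + christoffel h (F t) (frechet_derivative F (at t) b) (frechet_derivative F (at t) a))"

definition induced_metric ::
    "('e::euclidean_space \<Rightarrow> 'e \<Rightarrow> 'e \<Rightarrow> real) \<Rightarrow> (real^'l \<Rightarrow> 'e) \<Rightarrow> real^'l \<Rightarrow> real^'l^'l" where
  "induced_metric h F t = (\<chi> i j. h (F t) (frechet_derivative F (at t) (axis i 1))
                                          (frechet_derivative F (at t) (axis j 1)))"

definition mean_curvature ::
    "('e::euclidean_space \<Rightarrow> 'e \<Rightarrow> 'e \<Rightarrow> real) \<Rightarrow> (real^'l \<Rightarrow> 'e) \<Rightarrow> real^'l \<Rightarrow> 'e" where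
  "mean_curvature h F t = (1 / real CARD('l)) *\<^sub>R
     (\<Sum>i\<in>UNIV. \<Sum>j\<in>UNIV. (matrix_inv (induced_metric h F t) $ i $ j) *\<^sub>R
        second_fundamental_form h F t (axis i 1) (axis j 1))"

definition minimal_submanifold :: "'l::finite itself \<Rightarrow> ('m::topological_space, 'e::euclidean_space) chart set \<Rightarrow>
    (('m, 'e) chart \<Rightarrow> 'e \<Rightarrow> 'e \<Rightarrow> 'e \<Rightarrow> real) \<Rightarrow> 'm set \<Rightarrow> bool" where
  "minimal_submanifold L A g S \<longleftrightarrow> submanifold L A S \<and>
     (\<forall>(U :: (real^'l) set) f. local_parametrization A S U f \<longrightarrow>
        (\<forall>c\<in>A. \<forall>t\<in>U \<inter> f -` cdom c. mean_curvature (g c) (coord c \<circ> f) t = 0))"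


section \<open>Groups of isometries and moment maps\<close>

text \<open>A group \<open>K\<close> of isometries is a set of self-maps closed under composition and inverses. Its
  topology is the subspace topology of the product topology on \<open>'m \<Rightarrow> 'm\<close>, that is, pointwise
  convergence, which on isometries of a connected Riemannian manifold coincides with the
  compact-open topology. \<open>B\<close> is an atlas for the Lie group structure of \<open>K\<close>.\<close>

definition lie_group_of_isometries :: "('m::topological_space, 'e::euclidean_space) chart set \<Rightarrow>
    (('m, 'e) chart \<Rightarrow> 'e \<Rightarrow> 'e \<Rightarrow> 'e \<Rightarrow> real) \<Rightarrow> ('m \<Rightarrow> 'm) set \<Rightarrow>
    ('m \<Rightarrow> 'm, 'k::euclidean_space) chart set \<Rightarrow> bool" where
  "lie_group_of_isometries A g K B \<longleftrightarrow>
     (\<forall>k\<in>K. isometry A g k) \<and>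
     (\<lambda>p. p) \<in> K \<and> (\<forall>h\<in>K. \<forall>k\<in>K. h \<circ> k \<in> K) \<and> (\<forall>k\<in>K. inv k \<in> K) \<and>
     smooth_atlas K B \<and>
     smooth_map (prod_atlas B B) B (\<lambda>(h, k). h \<circ> k) \<and>
     smooth_map B B inv \<and>
     smooth_map (prod_atlas B A) A (\<lambda>(k, p). k p)"

definition orbit :: "('m \<Rightarrow> 'm) set \<Rightarrow> 'm \<Rightarrow> 'm set" where
  "orbit K p = (\<lambda>k. k p) ` K"

text \<open>The Lie algebra of \<open>K\<close> is its tangent space at the identity. It is identified with the model
  space \<open>'k\<close> by means of a chart \<open>e\<close> of \<open>K\<close> around the identity.\<close>

definition identity_chart :: "('m \<Rightarrow> 'm, 'k) chart set \<Rightarrow> ('m \<Rightarrow> 'm, 'k) chart \<Rightarrow> bool" where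
  "identity_chart B e \<longleftrightarrow> e \<in> B \<and> (\<lambda>p. p) \<in> cdom e"

text \<open>The components in the chart \<open>c\<close>, at the point with coordinates \<open>x\<close>, of the fundamental vector
  field of \<open>X\<close>: the derivative at the identity of \<open>k \<mapsto> k p\<close>, applied to \<open>X\<close>.\<close>

definition fundamental_field :: "('m \<Rightarrow> 'm, 'k::euclidean_space) chart \<Rightarrow> ('m, 'e::euclidean_space) chart \<Rightarrow>
    'e \<Rightarrow> 'k \<Rightarrow> 'e" where
  "fundamental_field e c x X =
     frechet_derivative (rep e c (\<lambda>k. k (cinv c x))) (at (coord e (\<lambda>p. p))) X"

definition Ad :: "('m \<Rightarrow> 'm, 'k::euclidean_space) chart \<Rightarrow> ('m \<Rightarrow> 'm) \<Rightarrow> 'k \<Rightarrow> 'k" where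
  "Ad e k X = frechet_derivative (rep e e (\<lambda>h. k \<circ> h \<circ> inv k)) (at (coord e (\<lambda>p. p))) X"

text \<open>The dual of the Lie algebra is \<open>'k \<Rightarrow>\<^sub>L real\<close> (all linear functionals, as \<open>'k\<close> is
  finite-dimensional); the coadjoint action of \<open>k\<close> on it is \<open>\<xi> \<mapsto> \<xi> \<circ> Ad (inv k)\<close>.\<close>

definition moment_map :: "('m::topological_space, complex^'n) chart set \<Rightarrow>
    (('m, complex^'n) chart \<Rightarrow> complex^'n \<Rightarrow> complex^'n \<Rightarrow> complex^'n \<Rightarrow> real) \<Rightarrow> ('m \<Rightarrow> 'm) set \<Rightarrow>
    ('m \<Rightarrow> 'm, 'k::euclidean_space) chart \<Rightarrow> ('m \<Rightarrow> 'k \<Rightarrow>\<^sub>L real) \<Rightarrow> bool" where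
  "moment_map A g K e \<mu> \<longleftrightarrow>
     smooth_map A (euclidean_atlas UNIV) \<mu> \<and>
     (\<forall>k\<in>K. \<forall>p X. blinfun_apply (\<mu> (k p)) X = blinfun_apply (\<mu> p) (Ad e (inv k) X)) \<and>
     (\<forall>c\<in>A. \<forall>x\<in>cran c. \<forall>v X.
        blinfun_apply (frechet_derivative (\<mu> \<circ> cinv c) (at x) v) X =
        kaehler_form (g c) x v (fundamental_field e c x X))"

definition hamiltonian_action :: "('m::topological_space, complex^'n) chart set \<Rightarrow>
    (('m, complex^'n) chart \<Rightarrow> complex^'n \<Rightarrow> complex^'n \<Rightarrow> complex^'n \<Rightarrow> real) \<Rightarrow> ('m \<Rightarrow> 'm) set \<Rightarrow>
    ('m \<Rightarrow> 'm, 'k::euclidean_space) chart \<Rightarrow> bool" where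
  "hamiltonian_action A g K e \<longleftrightarrow> (\<exists>\<mu>. moment_map A g K e \<mu>)"

definition canonical_moment_map :: "('m::topological_space, complex^'n) chart set \<Rightarrow>
    (('m, complex^'n) chart \<Rightarrow> complex^'n \<Rightarrow> complex^'n \<Rightarrow> complex^'n \<Rightarrow> real) \<Rightarrow> ('m \<Rightarrow> 'm) set \<Rightarrow>
    ('m \<Rightarrow> 'm, 'k::euclidean_space) chart \<Rightarrow> ('m \<Rightarrow> 'k \<Rightarrow>\<^sub>L real) \<Rightarrow> bool" where
  "canonical_moment_map A g K e \<mu> \<longleftrightarrow> moment_map A g K e \<mu> \<and> has_omega_integral A g \<mu> 0"

end

theory Submission
  imports Defs
begin

text \<open>
  Let \<open>f = \<mu>\<^sub>X\<close> be the Hamiltonian function of a fundamental field \<open>X\<close>, so that \<open>grad f = - J X\<close>. Since \<open>X\<close>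
  is Killing and \<open>J\<close> is parallel, \<open>X\<close> is holomorphic, and the derivative of \<open>div (J X)\<close> along \<open>v\<close> is
  \<open>- 2 Ric(v, J X)\<close>. If \<open>Ric = l g\<close>, then \<open>div (J X) = 2 l f + k\<close> for a constant \<open>k\<close>, and
  integration gives \<open>k = 0\<close> for the canonical moment map. On a Lagrangian orbit the normal space is
  spanned by the fields \<open>J X\<close>, and the component of the mean curvature vector along \<open>J X\<close> is a nonzero
  multiple of \<open>div (J X)\<close>. For \<open>l \<noteq> 0\<close> this proves the claim; for \<open>l = 0\<close> the function \<open>f\<close> is harmonic,
  hence constant, hence zero, so that both sides hold.
\<close>

section \<open>Calculus of smooth functions\<close>

text \<open>The normal space of the orbit is \<open>J\<close> of its tangent space, so testing the
  mean curvature against the fields \<open>J X\<close> is conclusive only if the fundamental fields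
  span the tangent space. As the orbit is merely an embedded submanifold, this is proved: otherwise
  the orbit map would have rank below \<open>CARD('n)\<close>, and compactness of \<open>K\<close>
  would cover an open piece of the orbit by finitely many null sets. Up to normalization the nonzero
  multiple is \<open>- 1 / 2\<close>: \<open>J \<nabla>X\<close> commutes with \<open>J\<close>, so
  the tangent space and its rotation contribute equally to its trace. All computations take place in
  charts. The divergence of \<open>J X\<close> becomes a function on the manifold because the
  \<open>J\<close>-invariant part of a coordinate Hessian is a tensor under holomorphic transitions.
  In the same spirit \<open>Ric(u,v) + Ric(Ju,Jv)\<close> contains only derivatives of the trace of
  the Christoffel form, which is the logarithmic derivative of the density of
  \<open>\<omega>\<^sup>n\<close>. That density also yields the divergence theorem, applied with the
  very partition of unity that witnesses the normalization of the moment map.\<close>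

abbreviation dd :: "('a::real_normed_vector \<Rightarrow> 'b::real_normed_vector) \<Rightarrow> 'a \<Rightarrow> 'a \<Rightarrow> 'b" where
  "dd f x v \<equiv> frechet_derivative f (at x) v"

lemma dd_eq: "(f has_derivative f') (at x) \<Longrightarrow> dd f x v = f' v"
  using frechet_derivative_at by metis

lemma differentiable_dd: "f differentiable (at x) \<Longrightarrow> (f has_derivative dd f x) (at x)"
  using frechet_derivative_works by blast

lemma linear_dd: "f differentiable (at x) \<Longrightarrow> linear (dd f x)"
  by (simp add: linear_frechet_derivative)

lemma dd_cong_open:
  assumes "open S" "x \<in> S" "\<And>y. y \<in> S \<Longrightarrow> f y = g y"
  shows "frechet_derivative f (at x) = frechet_derivative g (at x)"
proof -
  have "(f has_derivative f') (at x) \<longleftrightarrow> (g has_derivative f') (at x)" for f'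
    using assms by (metis has_derivative_transform_within_open)
  then show ?thesis by (simp add: frechet_derivative_def)
qed

lemma differentiable_cong_open:
  assumes "open S" "x \<in> S" "\<And>y. y \<in> S \<Longrightarrow> f y = g y" "f differentiable (at x)"
  shows "g differentiable (at x)"
  using assms by (metis differentiable_def has_derivative_transform_within_open)

section \<open>Closure properties of the classes \<open>Ck_on\<close>\<close>

lemma Ck_on_cong:
  assumes "open S" "\<And>x. x \<in> S \<Longrightarrow> f x = g x" "Ck_on k S f"
  shows "Ck_on k S g"
  using assms(2,3)
proof (induction k arbitrary: f g)
  case 0
  then show ?case by (simp cong: continuous_on_cong)
next
  case (Suc k)
  have "g differentiable (at x)" if "x \<in> S" for x
    using Suc.prems differentiable_cong_open[OF assms(1) that] that by auto
  moreover have "Ck_on k S (\<lambda>x. dd g x v)" for v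
  proof (rule Suc.IH)
    show "dd f x v = dd g x v" if "x \<in> S" for x
      by (rule fun_cong[OF dd_cong_open[OF assms(1) that]]) (rule Suc.prems)
    show "Ck_on k S (\<lambda>x. dd f x v)" using Suc.prems by simp
  qed
  ultimately show ?case by simp
qed

lemma Ck_on_subset: "Ck_on k S f \<Longrightarrow> T \<subseteq> S \<Longrightarrow> Ck_on k T f"
proof (induction k arbitrary: f)
  case 0 then show ?case by (simp add: continuous_on_subset)
next
  case (Suc k) then show ?case by (auto simp: subset_iff)
qed

lemma Ck_on_SucD: "Ck_on (Suc k) S f \<Longrightarrow> Ck_on k S f"
proof (induction k arbitrary: f)
  case 0
  then show ?case
    by (auto intro!: continuous_at_imp_continuous_on differentiable_imp_continuous_within)
next
  case (Suc k)
  then show ?case by (metis Ck_on.simps(2))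
qed

lemma Ck_on_const: "Ck_on k S (\<lambda>_. c)"
proof (induction k arbitrary: c)
  case (Suc k) then show ?case by simp
qed simp

lemma Ck_on_bounded_linear:
  assumes "open S" "bounded_linear L" "Ck_on k S f"
  shows "Ck_on k S (\<lambda>x. L (f x))"
  using assms(3)
proof (induction k arbitrary: f)
  case 0
  then show ?case using bounded_linear.continuous_on[OF assms(2)] by auto
next
  case (Suc k)
  have der: "((\<lambda>x. L (f x)) has_derivative (\<lambda>v. L (dd f x v))) (at x)" if "x \<in> S" for x
    using Suc.prems that by (intro bounded_linear.has_derivative[OF assms(2)] differentiable_dd) auto
  have "Ck_on k S (\<lambda>x. dd (\<lambda>x. L (f x)) x v)" for v
  proof (rule Ck_on_cong[OF assms(1)])
    show "Ck_on k S (\<lambda>x. L (dd f x v))" using Suc by auto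
  qed (simp add: dd_eq[OF der])
  then show ?case using der by (auto simp: differentiable_def)
qed

lemma Ck_on_add:
  assumes "open S" "Ck_on k S f" "Ck_on k S g"
  shows "Ck_on k S (\<lambda>x. f x + g x)"
  using assms(2,3)
proof (induction k arbitrary: f g)
  case 0
  then show ?case by (auto intro: continuous_intros)
next
  case (Suc k)
  have der: "((\<lambda>x. f x + g x) has_derivative (\<lambda>v. dd f x v + dd g x v)) (at x)" if "x \<in> S" for x
    using Suc.prems that by (intro has_derivative_add differentiable_dd) auto
  have "Ck_on k S (\<lambda>x. dd (\<lambda>x. f x + g x) x v)" for v
  proof (rule Ck_on_cong[OF assms(1)])
    show "Ck_on k S (\<lambda>x. dd f x v + dd g x v)" using Suc by auto
  qed (simp add: dd_eq[OF der])
  then show ?case using der by (auto simp: differentiable_def)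
qed

lemma Ck_on_sum:
  assumes "open S" "\<And>i. i \<in> I \<Longrightarrow> Ck_on k S (f i)"
  shows "Ck_on k S (\<lambda>x. \<Sum>i\<in>I. f i x)"
  using assms(2)
proof (induction I rule: infinite_finite_induct)
  case (insert i I)
  then show ?case using Ck_on_add[OF assms(1), of k "f i"] by (auto simp: insert.hyps)
qed (simp_all add: Ck_on_const)

lemma Ck_on_bilinear:
  assumes "open S" "bounded_bilinear B" "Ck_on k S f" "Ck_on k S g"
  shows "Ck_on k S (\<lambda>x. B (f x) (g x))"
  using assms(3,4)
proof (induction k arbitrary: f g)
  case 0
  then show ?case using bounded_bilinear.continuous_on[OF assms(2)] by auto
next
  case (Suc k)
  have der: "((\<lambda>x. B (f x) (g x)) has_derivative (\<lambda>v. B (f x) (dd g x v) + B (dd f x v) (g x))) (at x)"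
    if "x \<in> S" for x
    using Suc.prems that by (intro bounded_bilinear.FDERIV[OF assms(2)] differentiable_dd) auto
  have "Ck_on k S (\<lambda>x. dd (\<lambda>x. B (f x) (g x)) x v)" for v
  proof (rule Ck_on_cong[OF assms(1)])
    show "Ck_on k S (\<lambda>x. B (f x) (dd g x v) + B (dd f x v) (g x))"
      using Suc.prems Ck_on_SucD[OF Suc.prems(1)] Ck_on_SucD[OF Suc.prems(2)]
      by (intro Ck_on_add[OF assms(1)] Suc.IH) auto
  qed (simp add: dd_eq[OF der])
  then show ?case using der by (auto simp: differentiable_def)
qed

lemma Ck_on_prod:
  fixes f :: "'i \<Rightarrow> 'a::real_normed_vector \<Rightarrow> real"
  assumes "open S" "\<And>i. i \<in> I \<Longrightarrow> Ck_on k S (f i)"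
  shows "Ck_on k S (\<lambda>x. \<Prod>i\<in>I. f i x)"
  using assms(2)
proof (induction I rule: infinite_finite_induct)
  case (insert i I)
  then show ?case using Ck_on_bilinear[OF assms(1) bounded_bilinear_mult, of k "f i"] by (auto simp: insert.hyps)
qed (simp_all add: Ck_on_const)

text \<open>The derivative of the composite is a derivative of \<open>f\<close> composed with the
  same affine map, so the induction on the order closes. Affine substitution serves to freeze one
  variable of the coordinate expression of the group action.\<close>

lemma Ck_on_affine:
  assumes "open S" "bounded_linear L" "Ck_on k T f" "\<And>x. x \<in> S \<Longrightarrow> a + L x \<in> T"
  shows "Ck_on k S (\<lambda>x. f (a + L x))"
  using assms(3)
proof (induction k arbitrary: f)
  case 0
  have "continuous_on S (\<lambda>x. a + L x)"
    by (intro continuous_intros linear_continuous_on assms)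
  then show ?case using 0 continuous_on_compose2[of T f S "\<lambda>x. a + L x"] assms(4) by auto
next
  case (Suc k)
  have aff: "((\<lambda>x. a + L x) has_derivative L) (at x)" for x
    using bounded_linear_imp_has_derivative[OF assms(2)] by (auto intro!: derivative_eq_intros)
  have der: "((\<lambda>x. f (a + L x)) has_derivative (\<lambda>v. dd f (a + L x) (L v))) (at x)" if "x \<in> S" for x
    using Suc.prems assms(4)[OF that]
    by (intro has_derivative_compose[OF aff] differentiable_dd) auto
  have "Ck_on k S (\<lambda>x. dd (\<lambda>x. f (a + L x)) x v)" for v
  proof (rule Ck_on_cong[OF assms(1)])
    show "Ck_on k S (\<lambda>x. dd f (a + L x) (L v))"
      using Suc.IH[of "\<lambda>y. dd f y (L v)"] Suc.prems by auto
  qed (simp add: dd_eq[OF der])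
  then show ?case using der by (auto simp: differentiable_def)
qed

lemma smooth_onD:
  assumes "smooth_on S f" "x \<in> S"
  shows "f differentiable (at x)"
  using assms Ck_on.simps(2)[of 0 S f] by (simp add: smooth_on_def del: Ck_on.simps)

lemma smooth_on_dd: "smooth_on S f \<Longrightarrow> smooth_on S (\<lambda>x. dd f x v)"
  unfolding smooth_on_def by (metis Ck_on.simps(2))

lemma smooth_on_continuous: "smooth_on S f \<Longrightarrow> continuous_on S f"
  unfolding smooth_on_def by (metis Ck_on.simps(1))

lemma smooth_on_cong:
  "open S \<Longrightarrow> (\<And>x. x \<in> S \<Longrightarrow> f x = g x) \<Longrightarrow> smooth_on S f \<Longrightarrow> smooth_on S g"
  unfolding smooth_on_def using Ck_on_cong by blast

lemma smooth_on_bounded_linear: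
  "open S \<Longrightarrow> bounded_linear L \<Longrightarrow> smooth_on S f \<Longrightarrow> smooth_on S (\<lambda>x. L (f x))"
  unfolding smooth_on_def using Ck_on_bounded_linear by blast

lemma smooth_on_bilinear:
  "open S \<Longrightarrow> bounded_bilinear B \<Longrightarrow> smooth_on S f \<Longrightarrow> smooth_on S g \<Longrightarrow> smooth_on S (\<lambda>x. B (f x) (g x))"
  unfolding smooth_on_def using Ck_on_bilinear by blast

lemma smooth_on_affine:
  "open S \<Longrightarrow> bounded_linear L \<Longrightarrow> smooth_on T f \<Longrightarrow> (\<And>x. x \<in> S \<Longrightarrow> a + L x \<in> T) \<Longrightarrow>
   smooth_on S (\<lambda>x. f (a + L x))"
  unfolding smooth_on_def using Ck_on_affine by blast

lemma smooth_on_const: "smooth_on S (\<lambda>_. c)"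
  unfolding smooth_on_def using Ck_on_const by blast

lemma smooth_on_sum:
  "open S \<Longrightarrow> (\<And>i. i \<in> I \<Longrightarrow> smooth_on S (f i)) \<Longrightarrow> smooth_on S (\<lambda>x. \<Sum>i\<in>I. f i x)"
  unfolding smooth_on_def using Ck_on_sum[of S I _ f] by blast

lemma smooth_on_prod:
  fixes f :: "'i \<Rightarrow> 'a::real_normed_vector \<Rightarrow> real"
  shows "open S \<Longrightarrow> (\<And>i. i \<in> I \<Longrightarrow> smooth_on S (f i)) \<Longrightarrow> smooth_on S (\<lambda>x. \<Prod>i\<in>I. f i x)"
  unfolding smooth_on_def using Ck_on_prod[of S I _ f] by blast

text \<open>Both mixed derivatives are limits of the second difference quotient.\<close>

lemma second_difference_quotient:
  fixes f :: "'a::real_normed_vector \<Rightarrow> real"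
  assumes C2: "Ck_on (Suc (Suc 0)) (ball x r) f" and t: "t > 0" "t * (norm u + norm v) < r"
  shows "\<exists>y\<in>cball x (t * (norm u + norm v)).
    f (x + t *\<^sub>R u + t *\<^sub>R v) - f (x + t *\<^sub>R u) - f (x + t *\<^sub>R v) + f x =
    t * t * dd (\<lambda>y. dd f y u) y v"
proof -
  have inb: "x + a *\<^sub>R u + b *\<^sub>R v \<in> cball x (t * (norm u + norm v))"
    if "0 \<le> a" "a \<le> t" "0 \<le> b" "b \<le> t" for a b
  proof -
    have "norm (a *\<^sub>R u + b *\<^sub>R v) \<le> a * norm u + b * norm v"
      using that norm_triangle_ineq[of "a *\<^sub>R u" "b *\<^sub>R v"] by simp
    also have "\<dots> \<le> t * norm u + t * norm v"
      using that by (intro add_mono mult_right_mono) auto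
    finally have "norm (x - (x + a *\<^sub>R u + b *\<^sub>R v)) \<le> t * norm u + t * norm v"
      by (metis add.assoc add_diff_cancel_left' norm_minus_commute)
    then show ?thesis by (simp add: dist_norm distrib_left)
  qed
  have inS: "x + a *\<^sub>R u + b *\<^sub>R v \<in> ball x r"
    if "0 \<le> a" "a \<le> t" "0 \<le> b" "b \<le> t" for a b
    using inb[OF that] t by auto
  have d1: "f differentiable (at y)" and d2: "(\<lambda>y. dd f y u) differentiable (at y)" if "y \<in> ball x r" for y
    using C2 that by auto
  \<comment> \<open>The mean value theorem is applied twice: to the increment along \<open>v\<close>
    as a function of the step along \<open>u\<close>, then to the increment of the derivative that
    results.\<close>
  define g where "g s = f (x + s *\<^sub>R u + t *\<^sub>R v) - f (x + s *\<^sub>R u)" for s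
  have g': "(g has_real_derivative (dd f (x + s *\<^sub>R u + t *\<^sub>R v) u - dd f (x + s *\<^sub>R u) u)) (at s)"
    if "0 \<le> s" "s \<le> t" for s
  proof -
    have 1: "((\<lambda>s. f (x + s *\<^sub>R u + t *\<^sub>R v)) has_derivative (\<lambda>k. dd f (x + s *\<^sub>R u + t *\<^sub>R v) (k *\<^sub>R u))) (at s)"
      using inS[of s t] that t
      by (intro has_derivative_compose[of "\<lambda>s. x + s *\<^sub>R u + t *\<^sub>R v" _ _ _ f] differentiable_dd d1)
        (auto intro!: derivative_eq_intros)
    have 2: "((\<lambda>s. f (x + s *\<^sub>R u)) has_derivative (\<lambda>k. dd f (x + s *\<^sub>R u) (k *\<^sub>R u))) (at s)"
      using inS[of s 0] that t
      by (intro has_derivative_compose[of "\<lambda>s. x + s *\<^sub>R u" _ _ _ f] differentiable_dd d1)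
        (auto intro!: derivative_eq_intros)
    have "(g has_derivative (\<lambda>k. dd f (x + s *\<^sub>R u + t *\<^sub>R v) (k *\<^sub>R u) - dd f (x + s *\<^sub>R u) (k *\<^sub>R u))) (at s)"
      unfolding g_def[abs_def] by (intro has_derivative_diff 1 2)
    moreover have "(\<lambda>k. dd f (x + s *\<^sub>R u + t *\<^sub>R v) (k *\<^sub>R u) - dd f (x + s *\<^sub>R u) (k *\<^sub>R u)) =
        (*) (dd f (x + s *\<^sub>R u + t *\<^sub>R v) u - dd f (x + s *\<^sub>R u) u)"
      using inS[of s t] inS[of s 0] that t
      by (auto simp: fun_eq_iff linear_cmul[OF linear_dd] d1 algebra_simps simp del: mem_ball)
    ultimately show ?thesis by (simp add: has_field_derivative_def)
  qed
  obtain \<xi> where \<xi>: "0 < \<xi>" "\<xi> < t" and 1: "g t - g 0 = (t - 0) * (dd f (x + \<xi> *\<^sub>R u + t *\<^sub>R v) u - dd f (x + \<xi> *\<^sub>R u) u)"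
    using MVT2[OF t(1) g'] by auto
  have h': "((\<lambda>b. dd f (x + \<xi> *\<^sub>R u + b *\<^sub>R v) u) has_real_derivative
      dd (\<lambda>y. dd f y u) (x + \<xi> *\<^sub>R u + b *\<^sub>R v) v) (at b)" if "0 \<le> b" "b \<le> t" for b
  proof -
    have "((\<lambda>b. dd f (x + \<xi> *\<^sub>R u + b *\<^sub>R v) u) has_derivative
        (\<lambda>k. dd (\<lambda>y. dd f y u) (x + \<xi> *\<^sub>R u + b *\<^sub>R v) (k *\<^sub>R v))) (at b)"
      using inS[of \<xi> b] that \<xi>
      by (intro has_derivative_compose[of "\<lambda>s. x + \<xi> *\<^sub>R u + s *\<^sub>R v" _ _ _ "\<lambda>y. dd f y u"] differentiable_dd d2)
        (auto intro!: derivative_eq_intros)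
    moreover have "(\<lambda>k. dd (\<lambda>y. dd f y u) (x + \<xi> *\<^sub>R u + b *\<^sub>R v) (k *\<^sub>R v)) =
        (*) (dd (\<lambda>y. dd f y u) (x + \<xi> *\<^sub>R u + b *\<^sub>R v) v)"
      using inS[of \<xi> b] that \<xi>
      by (auto simp: fun_eq_iff linear_cmul[OF linear_dd] d2 algebra_simps simp del: mem_ball)
    ultimately show ?thesis by (simp add: has_field_derivative_def)
  qed
  obtain \<eta> where \<eta>: "0 < \<eta>" "\<eta> < t"
    and 2: "dd f (x + \<xi> *\<^sub>R u + t *\<^sub>R v) u - dd f (x + \<xi> *\<^sub>R u + 0 *\<^sub>R v) u =
      (t - 0) * dd (\<lambda>y. dd f y u) (x + \<xi> *\<^sub>R u + \<eta> *\<^sub>R v) v"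
    using MVT2[OF t(1) h'] by auto
  show ?thesis
    by (rule bexI[OF _ inb[of \<xi> \<eta>]]) (use \<xi> \<eta> 1 2 in \<open>auto simp: g_def\<close>)
qed

text \<open>The second difference is symmetric in \<open>u\<close> and \<open>v\<close>, so it
  yields points \<open>y\<close> and \<open>z\<close> near \<open>x\<close> at which the two mixed
  derivatives take equal values; if they differed at \<open>x\<close>, continuity would keep these
  values apart.\<close>

lemma dd_dd_symmetric_real:
  fixes f :: "'a::real_normed_vector \<Rightarrow> real"
  assumes S: "open S" "x \<in> S" and C2: "Ck_on (Suc (Suc 0)) S f"
  shows "dd (\<lambda>y. dd f y u) x v = dd (\<lambda>y. dd f y v) x u"
proof (rule ccontr)
  define a where "a y = dd (\<lambda>y. dd f y u) y v" for y
  define b where "b y = dd (\<lambda>y. dd f y v) y u" for y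
  assume "\<not> ?thesis"
  then have e: "\<bar>a x - b x\<bar> / 2 > 0" by (simp add: a_def b_def)
  have "isCont a x" "isCont b x"
    using C2 S by (auto simp: a_def[abs_def] b_def[abs_def] continuous_on_eq_continuous_at)
  then obtain r1 r2 where r: "r1 > 0" "\<And>y. dist y x < r1 \<Longrightarrow> dist (a y) (a x) < \<bar>a x - b x\<bar> / 2"
    "r2 > 0" "\<And>y. dist y x < r2 \<Longrightarrow> dist (b y) (b x) < \<bar>a x - b x\<bar> / 2"
    using e unfolding continuous_at by (metis (no_types, lifting) LIM_def dist_self)
  obtain r3 where r3: "r3 > 0" "ball x r3 \<subseteq> S" using S openE by blast
  define r where "r = min r1 (min r2 r3)"
  have rpos: "r > 0" using r r3 by (simp add: r_def)
  \<comment> \<open>The \<open>+ 1\<close> keeps the divisor positive when \<open>u\<close> and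
    \<open>v\<close> both vanish.\<close>
  define t where "t = r / 2 / (norm u + norm v + 1)"
  have tpos: "t > 0" using rpos by (simp add: t_def add_nonneg_pos)
  have nn: "norm u + norm v + 1 > 0" by (simp add: add_nonneg_pos)
  have "t * (norm u + norm v) < t * (norm u + norm v + 1)" using tpos by simp
  also have "\<dots> = r / 2" using nn t_def by (metis less_irrefl nonzero_eq_divide_eq)
  finally have tr: "t * (norm u + norm v) < r" using rpos by simp
  have C: "Ck_on (Suc (Suc 0)) (ball x r) f"
    by (rule Ck_on_subset[OF C2]) (use r3 in \<open>auto simp: r_def\<close>)
  obtain y where y: "dist x y \<le> t * (norm u + norm v)" and
    1: "f (x + t *\<^sub>R u + t *\<^sub>R v) - f (x + t *\<^sub>R u) - f (x + t *\<^sub>R v) + f x = t * t * a y"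
    using second_difference_quotient[OF C tpos tr] by (auto simp: a_def)
  obtain z where z: "dist x z \<le> t * (norm u + norm v)" and
    2: "f (x + t *\<^sub>R v + t *\<^sub>R u) - f (x + t *\<^sub>R v) - f (x + t *\<^sub>R u) + f x = t * t * b z"
    using second_difference_quotient[OF C tpos, of v u] tr by (auto simp: b_def add.commute)
  have "t * t * a y = t * t * b z"
    using 1 2 by (simp add: algebra_simps)
  then have "a y = b z" using tpos by simp
  moreover have "dist y x < r1" "dist z x < r2"
    using y z tr by (auto simp: r_def dist_commute)
  then have "dist (a y) (a x) < \<bar>a x - b x\<bar> / 2" "dist (b z) (b x) < \<bar>a x - b x\<bar> / 2"
    using r by blast+
  ultimately show False by (auto simp: dist_real_def abs_if split: if_splits)
qed

lemma dd_inner_left: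
  assumes "f differentiable (at x)"
  shows "dd (\<lambda>y. f y \<bullet> b) x v = dd f x v \<bullet> b"
  by (rule dd_eq, rule has_derivative_inner_left, rule differentiable_dd[OF assms])

lemma dd_dd_symmetric:
  fixes f :: "'a::real_normed_vector \<Rightarrow> 'b::euclidean_space"
  assumes S: "open S" "x \<in> S" and C2: "Ck_on (Suc (Suc 0)) S f"
  shows "dd (\<lambda>y. dd f y u) x v = dd (\<lambda>y. dd f y v) x u"
proof (rule euclidean_eqI)
  fix b :: 'b assume "b \<in> Basis"
  have d: "f differentiable (at y)" "(\<lambda>y. dd f y w) differentiable (at y)" if "y \<in> S" for y w
    using C2 that by auto
  have *: "dd (\<lambda>y. dd f y u) x v \<bullet> b = dd (\<lambda>y. dd (\<lambda>y. f y \<bullet> b) y u) x v" for u v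
  proof -
    have "dd (\<lambda>y. dd f y u) x v \<bullet> b = dd (\<lambda>y. dd f y u \<bullet> b) x v"
      using d S by (simp add: dd_inner_left)
    also have "\<dots> = dd (\<lambda>y. dd (\<lambda>y. f y \<bullet> b) y u) x v"
      by (rule fun_cong[OF dd_cong_open[OF S]]) (simp add: dd_inner_left d)
    finally show ?thesis .
  qed
  have "Ck_on (Suc (Suc 0)) S (\<lambda>y. f y \<bullet> b)"
    by (rule Ck_on_bounded_linear[OF S(1) bounded_linear_inner_left C2])
  from dd_dd_symmetric_real[OF S this]
  show "dd (\<lambda>y. dd f y u) x v \<bullet> b = dd (\<lambda>y. dd f y v) x u \<bullet> b"
    unfolding * .
qed

lemma smooth_on_dd_dd_symmetric:
  fixes f :: "'a::real_normed_vector \<Rightarrow> 'b::euclidean_space"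
  shows "open S \<Longrightarrow> x \<in> S \<Longrightarrow> smooth_on S f \<Longrightarrow> dd (\<lambda>y. dd f y u) x v = dd (\<lambda>y. dd f y v) x u"
  using dd_dd_symmetric unfolding smooth_on_def by blast

section \<open>Families of linear maps depending on a point\<close>

lemma linear_basis_sum:
  fixes w :: "'e::euclidean_space"
  assumes "linear L"
  shows "L w = (\<Sum>b\<in>Basis. (w \<bullet> b) *\<^sub>R L b)"
  by (subst euclidean_representation[symmetric, of w])
    (simp only: linear_sum[OF assms] linear_cmul[OF assms])

text \<open>A product rule for linear maps known only through their values: expanding
  \<open>w y\<close> in the basis leaves finitely many products, so differentiability of each
  \<open>L y b\<close> is enough. Metrics, differentials and \<open>div_form\<close> are
  differentiated along moving vectors this way.\<close>

lemma has_derivative_linear_family: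
  fixes w :: "'a::real_normed_vector \<Rightarrow> 'e::euclidean_space" and L :: "'a \<Rightarrow> 'e \<Rightarrow> 'f::real_normed_vector"
  assumes S: "open S" "x \<in> S" and lin: "\<And>y. y \<in> S \<Longrightarrow> linear (L y)"
    and L: "\<And>b. (\<lambda>y. L y b) differentiable (at x)" and w: "(w has_derivative w') (at x)"
  shows "((\<lambda>y. L y (w y)) has_derivative (\<lambda>v. dd (\<lambda>y. L y (w x)) x v + L x (w' v))) (at x)"
proof -
  have 1: "((\<lambda>y. \<Sum>b\<in>Basis. (w y \<bullet> b) *\<^sub>R L y b) has_derivative
      (\<lambda>v. \<Sum>b\<in>Basis. (w x \<bullet> b) *\<^sub>R dd (\<lambda>y. L y b) x v + (w' v \<bullet> b) *\<^sub>R L x b)) (at x)"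
    by (intro has_derivative_sum has_derivative_scaleR has_derivative_inner_left w differentiable_dd L)
  have 2: "((\<lambda>y. \<Sum>b\<in>Basis. (w x \<bullet> b) *\<^sub>R L y b) has_derivative
      (\<lambda>v. \<Sum>b\<in>Basis. (w x \<bullet> b) *\<^sub>R dd (\<lambda>y. L y b) x v)) (at x)"
    by (intro has_derivative_sum has_derivative_scaleR_right differentiable_dd L)
  have "((\<lambda>y. L y (w x)) has_derivative
      (\<lambda>v. \<Sum>b\<in>Basis. (w x \<bullet> b) *\<^sub>R dd (\<lambda>y. L y b) x v)) (at x)"
    by (rule has_derivative_transform_within_open[OF 2 S]) (rule linear_basis_sum[OF lin, symmetric])
  then have 3: "dd (\<lambda>y. L y (w x)) x v = (\<Sum>b\<in>Basis. (w x \<bullet> b) *\<^sub>R dd (\<lambda>y. L y b) x v)" for v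
    by (rule dd_eq)
  have "((\<lambda>y. L y (w y)) has_derivative
      (\<lambda>v. \<Sum>b\<in>Basis. (w x \<bullet> b) *\<^sub>R dd (\<lambda>y. L y b) x v + (w' v \<bullet> b) *\<^sub>R L x b)) (at x)"
    by (rule has_derivative_transform_within_open[OF 1 S]) (rule linear_basis_sum[OF lin, symmetric])
  moreover have "(\<Sum>b\<in>Basis. (w' v \<bullet> b) *\<^sub>R L x b) = L x (w' v)" for v
    by (rule linear_basis_sum[OF lin[OF S(2)], symmetric])
  ultimately show ?thesis by (simp add: sum.distrib 3)
qed

lemma linear_dd_param:
  fixes L :: "'a::real_normed_vector \<Rightarrow> 'e::real_normed_vector \<Rightarrow> 'f::real_normed_vector"
  assumes S: "open S" "x \<in> S" and lin: "\<And>y. y \<in> S \<Longrightarrow> linear (L y)"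
    and L: "\<And>b. (\<lambda>y. L y b) differentiable (at x)"
  shows "linear (\<lambda>w. dd (\<lambda>y. L y w) x v)"
proof (rule linearI)
  fix a b r
  have "dd (\<lambda>y. L y (a + b)) x v = dd (\<lambda>y. L y a + L y b) x v"
    by (rule fun_cong[OF dd_cong_open[OF S]]) (simp add: linear_add[OF lin])
  also have "\<dots> = dd (\<lambda>y. L y a) x v + dd (\<lambda>y. L y b) x v"
    by (rule dd_eq) (intro has_derivative_add differentiable_dd L)
  finally show "dd (\<lambda>y. L y (a + b)) x v = dd (\<lambda>y. L y a) x v + dd (\<lambda>y. L y b) x v" .
  have "dd (\<lambda>y. L y (r *\<^sub>R a)) x v = dd (\<lambda>y. r *\<^sub>R L y a) x v"
    by (rule fun_cong[OF dd_cong_open[OF S]]) (simp add: linear_cmul[OF lin])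
  also have "\<dots> = r *\<^sub>R dd (\<lambda>y. L y a) x v"
    by (rule dd_eq) (intro has_derivative_scaleR_right differentiable_dd L)
  finally show "dd (\<lambda>y. L y (r *\<^sub>R a)) x v = r *\<^sub>R dd (\<lambda>y. L y a) x v" .
qed

section \<open>The Levi-Civita connection in a chart\<close>

lemma linear_scaleR_const:
  fixes f :: "'a::real_vector \<Rightarrow> real"
  shows "linear f \<Longrightarrow> linear (\<lambda>z. f z *\<^sub>R w)"
  by (rule linearI) (simp_all add: linear_add linear_cmul scaleR_add_left)

lemma linear_const_mult:
  fixes f :: "'a::real_vector \<Rightarrow> real"
  shows "linear f \<Longrightarrow> linear (\<lambda>z. c * f z)"
  by (rule linearI) (simp_all add: linear_add linear_cmul distrib_left)

lemma inner_dual_vector: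
  fixes k :: "'e::euclidean_space \<Rightarrow> real"
  assumes "linear k"
  shows "(\<Sum>w\<in>Basis. k w *\<^sub>R w) \<bullet> v = k v"
  by (subst linear_basis_sum[OF assms, of v])
    (simp add: inner_sum_left inner_commute[of v] mult.commute)

text \<open>\<open>T\<close> is the matrix of \<open>b\<close>; positivity makes it injective, hence
  surjective. This gives the existence and uniqueness behind \<open>christoffel\<close>, and later
  an adjoint map between two tangent spaces.\<close>

lemma bilinear_form_representer:
  fixes b :: "'e::euclidean_space \<Rightarrow> 'e \<Rightarrow> real"
  assumes b: "bilinear b" and pos: "\<And>u. u \<noteq> 0 \<Longrightarrow> b u u > 0" and k: "linear \<kappa>"
  shows "\<exists>!z. \<forall>w. b z w = \<kappa> w"
proof -
  define T where "T z = (\<Sum>w\<in>Basis. b z w *\<^sub>R w)" for z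
  have bw: "linear (b z)" for z using b by (simp add: bilinear_def)
  have bz: "linear (\<lambda>z. b z w)" for w using b by (simp add: bilinear_def)
  have linT: "linear T"
    unfolding T_def by (intro linear_compose_sum ballI linear_scaleR_const bz)
  have Tb: "T z \<bullet> w = b z w" for z w
    unfolding T_def by (rule inner_dual_vector[OF bw])
  have "inj T"
    using pos Tb by (auto simp: linear_injective_0[OF linT]) (metis inner_zero_left less_irrefl)
  then have "surj T" by (rule linear_injective_imp_surjective[OF linT]) simp
  then obtain z where z: "T z = (\<Sum>w\<in>Basis. \<kappa> w *\<^sub>R w)" by (metis surjD)
  have "b z w = \<kappa> w" for w
    unfolding Tb[symmetric] z by (rule inner_dual_vector[OF k])
  moreover have "z' = z''" if "\<forall>w. b z' w = \<kappa> w" "\<forall>w. b z'' w = \<kappa> w" for z' z''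
    using that \<open>inj T\<close> Tb by (metis (no_types) euclidean_eqI injD)
  ultimately show ?thesis by blast
qed

definition tr :: "('e::euclidean_space \<Rightarrow> 'e) \<Rightarrow> real" where
  "tr A = (\<Sum>b\<in>Basis. A b \<bullet> b)"

lemma tr_comp_commute:
  fixes A B :: "'e::euclidean_space \<Rightarrow> 'e"
  assumes "linear A" "linear B"
  shows "tr (\<lambda>x. A (B x)) = tr (\<lambda>x. B (A x))"
proof -
  have *: "A (B b) \<bullet> b = (\<Sum>c\<in>Basis. (B b \<bullet> c) * (A c \<bullet> b))" if "linear A" for A B :: "'e \<Rightarrow> 'e" and b
    by (subst linear_basis_sum[OF that, of "B b"]) (simp add: inner_sum_left)
  have "tr (\<lambda>x. A (B x)) = (\<Sum>b\<in>Basis. \<Sum>c\<in>Basis. (B b \<bullet> c) * (A c \<bullet> b))"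
    unfolding tr_def by (intro sum.cong refl *[OF assms(1)])
  also have "\<dots> = (\<Sum>c\<in>Basis. \<Sum>b\<in>Basis. (B b \<bullet> c) * (A c \<bullet> b))"
    by (rule sum.swap)
  also have "\<dots> = (\<Sum>c\<in>Basis. \<Sum>b\<in>Basis. (A c \<bullet> b) * (B b \<bullet> c))"
    by (simp only: mult.commute)
  also have "\<dots> = tr (\<lambda>x. B (A x))"
    unfolding tr_def by (intro sum.cong refl *[OF assms(2), symmetric])
  finally show ?thesis .
qed

text \<open>For the matrix \<open>T\<close> of \<open>b\<close>, skewness reads
  \<open>T A = - A' T\<close> with the Euclidean adjoint \<open>A'\<close>. Conjugation by
  \<open>T\<close> gives \<open>tr A = - tr A'\<close>, and \<open>tr A' = tr A\<close>. Applied to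
  \<open>\<nabla>X\<close>, this makes Killing fields divergence-free.\<close>

lemma tr_skew:
  fixes b :: "'e::euclidean_space \<Rightarrow> 'e \<Rightarrow> real"
  assumes b: "bilinear b" and pos: "\<And>u. u \<noteq> 0 \<Longrightarrow> b u u > 0"
    and A: "linear A" "\<And>u v. b (A u) v = - b u (A v)"
  shows "tr A = 0"
proof -
  define T where "T z = (\<Sum>w\<in>Basis. b z w *\<^sub>R w)" for z
  have bw: "linear (b z)" for z using b by (simp add: bilinear_def)
  have bz: "linear (\<lambda>z. b z w)" for w using b by (simp add: bilinear_def)
  have linT: "linear T"
    unfolding T_def by (intro linear_compose_sum ballI linear_scaleR_const bz)
  have Tb: "T z \<bullet> w = b z w" for z w
    unfolding T_def by (rule inner_dual_vector[OF bw])
  have "inj T"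
    using pos Tb by (auto simp: linear_injective_0[OF linT]) (metis inner_zero_left less_irrefl)
  then obtain R where R: "linear R" "\<And>x. R (T x) = x" "\<And>x. T (R x) = x"
    using linear_injective_isomorphism[OF linT] by auto
  define A' where "A' = adjoint A"
  have A': "linear A'" "\<And>u v. A' u \<bullet> v = u \<bullet> A v"
    unfolding A'_def using A(1) by (simp_all add: adjoint_linear adjoint_clauses)
  have TA: "T (A u) = - A' (T u)" for u
    by (rule euclidean_eqI) (simp add: Tb A A')
  have "tr A = tr (\<lambda>x. R (T (A x)))" by (simp add: R)
  also have "\<dots> = - tr (\<lambda>x. R (A' (T x)))"
    by (simp add: TA linear_neg[OF R(1)] tr_def sum_negf)
  also have "tr (\<lambda>x. R (A' (T x))) = tr (\<lambda>x. A' (T (R x)))"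
    using tr_comp_commute[OF R(1) linear_compose[OF linT A'(1)]] by (simp add: o_def)
  also have "\<dots> = tr A"
    by (simp add: R tr_def A') (simp add: inner_commute)
  finally show ?thesis by simp
qed

text \<open>Where the second factor vanishes, the product rule asks only for continuity of the
  first: the quotient splits into \<open>a y\<close> times the remainder of \<open>c\<close>, and
  the change of \<open>a\<close> times a bounded term. In \<open>representer_differentiable\<close>
  the first factor is a component of the very function whose differentiability is at stake.\<close>

lemma has_derivative_mult_vanishing:
  fixes a :: "'a::real_normed_vector \<Rightarrow> real" and c :: "'a \<Rightarrow> 'b::real_normed_vector"
  assumes c: "(c has_derivative c') (at x)" "c x = 0" and a: "isCont a x"
  shows "((\<lambda>y. a y *\<^sub>R c y) has_derivative (\<lambda>v. a x *\<^sub>R c' v)) (at x)"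
proof -
  have bl: "bounded_linear c'" using c has_derivative_bounded_linear by blast
  obtain B where B: "\<And>v. norm (c' v) \<le> norm v * B"
    using bounded_linear.bounded[OF bl] by blast
  have q: "((\<lambda>y. (c y - c' (y - x)) /\<^sub>R norm (y - x)) \<longlongrightarrow> 0) (at x)"
    using c by (simp add: has_derivative_at_within)
  have a0: "((\<lambda>y. a y - a x) \<longlongrightarrow> 0) (at x)" "(a \<longlongrightarrow> a x) (at x)"
    using a by (simp_all add: isCont_def LIM_zero)
  have "((\<lambda>y. (a y - a x) *\<^sub>R (c' (y - x) /\<^sub>R norm (y - x))) \<longlongrightarrow> 0) (at x)"
  proof (rule tendsto_0_le[OF a0(1), where K = B])
    show "\<forall>\<^sub>F y in at x. norm ((a y - a x) *\<^sub>R (c' (y - x) /\<^sub>R norm (y - x))) \<le> norm (a y - a x) * B"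
    proof (rule eventually_at_topological[THEN iffD2], intro exI conjI ballI impI)
      show "open UNIV" "x \<in> UNIV" by auto
      fix y assume "y \<noteq> x"
      then have "norm (c' (y - x) /\<^sub>R norm (y - x)) \<le> B"
        using B[of "y - x"] by (simp add: field_simps)
      then show "norm ((a y - a x) *\<^sub>R (c' (y - x) /\<^sub>R norm (y - x))) \<le> norm (a y - a x) * B"
        by (simp only: norm_scaleR) (simp add: mult_left_mono)
    qed
  qed
  moreover have "((\<lambda>y. a y *\<^sub>R ((c y - c' (y - x)) /\<^sub>R norm (y - x))) \<longlongrightarrow> a x *\<^sub>R 0) (at x)"
    by (intro tendsto_scaleR a0 q)
  ultimately have "((\<lambda>y. a y *\<^sub>R ((c y - c' (y - x)) /\<^sub>R norm (y - x)) +
      (a y - a x) *\<^sub>R (c' (y - x) /\<^sub>R norm (y - x))) \<longlongrightarrow> a x *\<^sub>R 0 + 0) (at x)"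
    by (intro tendsto_add)
  then have "((\<lambda>y. (a y *\<^sub>R c y - a x *\<^sub>R c x - a x *\<^sub>R c' (y - x)) /\<^sub>R norm (y - x)) \<longlongrightarrow> 0) (at x)"
    by (simp add: c algebra_simps)
  then show ?thesis
    using bounded_linear_compose[OF bounded_linear_scaleR_right bl, of "a x"]
    by (simp add: has_derivative_at_within o_def)
qed

text \<open>With \<open>R\<close> inverting the form at \<open>x\<close>, the representer satisfies \<open>z = w - N z\<close> where \<open>N\<close>
  vanishes at \<open>x\<close>; this gives first continuity and then differentiability of \<open>z\<close>.\<close>

lemma representer_differentiable:
  fixes b :: "'a::real_normed_vector \<Rightarrow> 'e::euclidean_space \<Rightarrow> 'e \<Rightarrow> real"
  assumes S: "open S" "x \<in> S"
    and b: "\<And>y. y \<in> S \<Longrightarrow> bilinear (b y)" and pos: "\<And>u. u \<noteq> 0 \<Longrightarrow> b x u u > 0"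
    and diffb: "\<And>u v. (\<lambda>y. b y u v) differentiable (at x)"
    and diffk: "\<And>w. (\<lambda>y. \<kappa> y w) differentiable (at x)"
    and z: "\<And>y w. y \<in> S \<Longrightarrow> b y (z y) w = \<kappa> y w"
  shows "z differentiable (at x)"
proof -
  define T where "T y z = (\<Sum>w\<in>Basis. b y z w *\<^sub>R w)" for y z
  have bw: "linear (b y z)" if "y \<in> S" for y z using b[OF that] by (simp add: bilinear_def)
  have bz: "linear (\<lambda>z. b y z w)" if "y \<in> S" for y w using b[OF that] by (simp add: bilinear_def)
  have linT: "linear (T y)" if "y \<in> S" for y
    unfolding T_def by (intro linear_compose_sum ballI linear_scaleR_const bz that)
  have Tb: "T x z \<bullet> w = b x z w" for z w
    unfolding T_def by (rule inner_dual_vector[OF bw[OF S(2)]])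
  have "inj (T x)"
    using pos Tb by (auto simp: linear_injective_0[OF linT] S) (metis inner_zero_left less_irrefl)
  then obtain R where R: "linear R" "\<And>z. R (T x z) = z"
    using linear_injective_isomorphism[OF linT] S by blast
  have blR: "bounded_linear R" using R(1) linear_conv_bounded_linear by blast
  define w where "w y = R (\<Sum>e\<in>Basis. \<kappa> y e *\<^sub>R e)" for y
  define N where "N y e = R (T y e) - e" for y e
  have linN: "linear (N y)" if "y \<in> S" for y
    unfolding N_def
    using linear_compose_sub[OF linear_compose[OF linT[OF that] R(1)] linear_id] by (simp add: o_def)
  have Nx: "N x e = 0" for e by (simp add: N_def R)
  have dT: "(\<lambda>y. T y e) differentiable (at x)" for e
    unfolding T_def using diffb by (auto intro!: differentiable_sum differentiable_scaleR)
  have dN: "(\<lambda>y. N y e) differentiable (at x)" for e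
    unfolding N_def using dT[of e] bounded_linear.has_derivative[OF blR]
    by (intro differentiable_diff) (auto simp: differentiable_def)
  have dw: "w differentiable (at x)"
  proof -
    have "(\<lambda>y. \<Sum>e\<in>Basis. \<kappa> y e *\<^sub>R e) differentiable (at x)"
      using diffk by (auto intro!: differentiable_sum differentiable_scaleR)
    then show ?thesis
      unfolding w_def using bounded_linear.has_derivative[OF blR] by (auto simp: differentiable_def)
  qed
  have eq: "z y = w y - (\<Sum>e\<in>Basis. (z y \<bullet> e) *\<^sub>R N y e)" if "y \<in> S" for y
  proof -
    have "T y (z y) = (\<Sum>e\<in>Basis. \<kappa> y e *\<^sub>R e)" by (simp add: T_def z[OF that])
    then have "N y (z y) = w y - z y" by (simp add: N_def w_def)
    then show ?thesis using linear_basis_sum[OF linN[OF that], of "z y"] by simp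
  qed
  define n where "n y = (\<Sum>e\<in>Basis. norm (N y e))" for y
  have nN: "norm (\<Sum>e\<in>Basis. (z y \<bullet> e) *\<^sub>R N y e) \<le> norm (z y) * n y" for y
    unfolding n_def sum_distrib_left
    by (intro order_trans[OF norm_sum] sum_mono) (simp add: Basis_le_norm mult_right_mono)
  have contN: "((\<lambda>y. N y e) \<longlongrightarrow> 0) (at x)" for e
    using differentiable_imp_continuous_within[OF dN[of e]] Nx[of e] by (simp add: isCont_def)
  have n0: "(n \<longlongrightarrow> 0) (at x)"
  proof -
    have "((\<lambda>y. \<Sum>e\<in>Basis. norm (N y e)) \<longlongrightarrow> (\<Sum>e\<in>(Basis :: 'e set). 0)) (at x)"
      by (intro tendsto_sum tendsto_norm_zero contN)
    then show ?thesis by (simp add: n_def[abs_def])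
  qed
  have contw: "(w \<longlongrightarrow> w x) (at x)"
    using differentiable_imp_continuous_within[OF dw] by (simp add: isCont_def)
  \<comment> \<open>Once the perturbation is below one half in norm, the implicit equation bounds
    \<open>z y\<close> by twice \<open>w y\<close>, and therefore \<open>z y - w y\<close> by a null
    function.\<close>
  have "\<forall>\<^sub>F y in at x. norm (z y - w y) \<le> n y * (2 * norm (w y))"
  proof -
    have "\<forall>\<^sub>F y in at x. n y < 1/2" using n0 by (rule order_tendstoD) simp
    moreover have "\<forall>\<^sub>F y in at x. y \<in> S" using S eventually_at_topological by blast
    ultimately show ?thesis
    proof eventually_elim
      fix y assume n: "n y < 1/2" and y: "y \<in> S"
      have d: "norm (z y - w y) \<le> norm (z y) * n y"
        using eq[OF y] nN[of y] by (metis add_diff_cancel_left' diff_add_cancel norm_minus_commute)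
      have npos: "n y \<ge> 0" by (simp add: n_def sum_nonneg)
      have "norm (z y) * n y \<le> norm (z y) / 2"
        using n mult_left_mono[of "n y" "1/2" "norm (z y)"] by simp
      then have "norm (z y) \<le> 2 * norm (w y)"
        using d norm_triangle_sub[of "z y" "w y"] by linarith
      then show "norm (z y - w y) \<le> n y * (2 * norm (w y))"
        using d npos by (smt (verit) mult.commute mult_left_mono)
    qed
  qed
  then have "((\<lambda>y. z y - w y) \<longlongrightarrow> 0) (at x)"
  proof (rule Lim_null_comparison)
    have "((\<lambda>y. n y * (2 * norm (w y))) \<longlongrightarrow> 0 * (2 * norm (w x))) (at x)"
      by (intro tendsto_intros n0 contw)
    then show "((\<lambda>y. n y * (2 * norm (w y))) \<longlongrightarrow> 0) (at x)" by simp
  qed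
  from tendsto_add[OF this contw] have "(z \<longlongrightarrow> w x) (at x)" by simp
  moreover have "w x = z x" using eq[OF S(2)] by (simp add: Nx)
  ultimately have contz: "isCont z x" by (simp add: isCont_def)
  have "((\<lambda>y. w y - (\<Sum>e\<in>Basis. (z y \<bullet> e) *\<^sub>R N y e)) has_derivative
      (\<lambda>v. dd w x v - (\<Sum>e\<in>Basis. (z x \<bullet> e) *\<^sub>R dd (\<lambda>y. N y e) x v))) (at x)"
    by (intro has_derivative_diff differentiable_dd dw has_derivative_sum
        has_derivative_mult_vanishing dN Nx continuous_intros contz)
  then show ?thesis
    using S eq by (metis (no_types, lifting) has_derivative_transform_within_open differentiable_def)
qed

abbreviation J :: "complex^'n \<Rightarrow> complex^'n" where
  "J v \<equiv> \<i> *s v"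

lemma linear_J: "linear (J :: complex^'n \<Rightarrow> _)"
  by (rule linearI) (simp_all add: vec_eq_iff distrib_left)

lemma J_J [simp]: "J (J v) = - (v :: complex^'n)"
  by (simp add: vec_eq_iff)

lemma J_minus [simp]: "J (- v) = - J (v :: complex^'n)"
  by (simp add: vec_eq_iff)

lemma bounded_linear_J: "bounded_linear (J :: complex^'n \<Rightarrow> _)"
  using linear_J linear_conv_bounded_linear by blast

text \<open>One metric in one chart, detached from the manifold, so that the local calculus concerns
  functions on an open set only; each chart of the atlas is an instance.\<close>

locale metric_chart =
  fixes h :: "'e::euclidean_space \<Rightarrow> 'e \<Rightarrow> 'e \<Rightarrow> real" and S :: "'e set"
  assumes open_S: "open S"
    and bilinear_h: "x \<in> S \<Longrightarrow> bilinear (h x)"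
    and sym: "x \<in> S \<Longrightarrow> h x u v = h x v u"
    and pos: "x \<in> S \<Longrightarrow> u \<noteq> 0 \<Longrightarrow> h x u u > 0"
    and smooth_h: "smooth_on S (\<lambda>x. h x u v)"
begin

lemma lin1: "x \<in> S \<Longrightarrow> linear (\<lambda>u. h x u v)"
  and lin2: "x \<in> S \<Longrightarrow> linear (h x u)"
  using bilinear_h by (auto simp: bilinear_def)

lemma h_simps:
  assumes "x \<in> S"
  shows "h x (u + u') v = h x u v + h x u' v" "h x v (u + u') = h x v u + h x v u'"
    "h x (u - u') v = h x u v - h x u' v" "h x v (u - u') = h x v u - h x v u'"
    "h x (r *\<^sub>R u) v = r * h x u v" "h x v (r *\<^sub>R u) = r * h x v u"
    "h x (- u) v = - h x u v" "h x v (- u) = - h x v u"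
    "h x 0 v = 0" "h x v 0 = 0"
  using linear_add[OF lin1[OF assms]] linear_add[OF lin2[OF assms]]
    linear_diff[OF lin1[OF assms]] linear_diff[OF lin2[OF assms]]
    linear_cmul[OF lin1[OF assms]] linear_cmul[OF lin2[OF assms]]
    linear_neg[OF lin1[OF assms]] linear_neg[OF lin2[OF assms]]
    linear_0[OF lin1[OF assms]] linear_0[OF lin2[OF assms]]
  by auto

lemma h_sum:
  assumes "x \<in> S"
  shows "h x (\<Sum>i\<in>I. F i) v = (\<Sum>i\<in>I. h x (F i) v)" "h x v (\<Sum>i\<in>I. F i) = (\<Sum>i\<in>I. h x v (F i))"
  using linear_sum[OF lin1[OF assms], of F I] linear_sum[OF lin2[OF assms], of v F I] by auto

lemma nondegenerate:
  assumes "x \<in> S" "\<And>w. h x a w = h x b w"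
  shows "a = b"
  using pos[OF assms(1), of "a - b"] assms h_simps[OF assms(1)] by (metis cancel_comm_monoid_add_class.diff_cancel eq_iff_diff_eq_0 less_irrefl)

lemma diff_h: "x \<in> S \<Longrightarrow> (\<lambda>y. h y u v) differentiable (at x)"
  by (rule smooth_onD[OF smooth_h])

lemma linear_dh1: "x \<in> S \<Longrightarrow> linear (\<lambda>u. dd (\<lambda>y. h y v w) x u)"
  by (rule linear_dd[OF diff_h])

lemma linear_dh2: "x \<in> S \<Longrightarrow> linear (\<lambda>v. dd (\<lambda>y. h y v w) x u)"
  by (rule linear_dd_param[OF open_S _ lin1 diff_h])

lemma linear_dh3: "x \<in> S \<Longrightarrow> linear (\<lambda>w. dd (\<lambda>y. h y v w) x u)"
  by (rule linear_dd_param[OF open_S _ lin2 diff_h])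

lemma dh_sym: "x \<in> S \<Longrightarrow> dd (\<lambda>y. h y v w) x u = dd (\<lambda>y. h y w v) x u"
  by (rule fun_cong[OF dd_cong_open[OF open_S]]) (auto intro: sym)

lemma has_derivative_h:
  assumes "x \<in> S" "(a has_derivative a') (at x)" "(b has_derivative b') (at x)"
  shows "((\<lambda>y. h y (a y) (b y)) has_derivative
    (\<lambda>u. dd (\<lambda>y. h y (a x) (b x)) x u + h x (a' u) (b x) + h x (a x) (b' u))) (at x)"
proof -
  have 1: "((\<lambda>y. h y (a y) c) has_derivative (\<lambda>u. dd (\<lambda>y. h y (a x) c) x u + h x (a' u) c)) (at x)" for c
    by (rule has_derivative_linear_family[OF open_S assms(1) lin1 diff_h assms(2)]) (auto simp: assms)
  have "((\<lambda>y. h y (a y) (b y)) has_derivative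
    (\<lambda>u. dd (\<lambda>y. h y (a y) (b x)) x u + h x (a x) (b' u))) (at x)"
    by (rule has_derivative_linear_family[OF open_S assms(1) lin2 _ assms(3)])
      (use 1 in \<open>auto simp: differentiable_def\<close>)
  then show ?thesis by (simp add: dd_eq[OF 1])
qed

lemma koszul:
  assumes "x \<in> S"
  shows "2 * h x (christoffel h x u v) w = dd (\<lambda>y. h y v w) x u + dd (\<lambda>y. h y u w) x v - dd (\<lambda>y. h y u v) x w"
proof -
  have "\<exists>!z. \<forall>w. 2 * h x z w = dd (\<lambda>y. h y v w) x u + dd (\<lambda>y. h y u w) x v - dd (\<lambda>y. h y u v) x w"
  proof (rule bilinear_form_representer)
    show "bilinear (\<lambda>u v. 2 * h x u v)"
      using bilinear_h[OF assms] by (auto simp: bilinear_def intro: linear_const_mult)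
    show "linear (\<lambda>w. dd (\<lambda>y. h y v w) x u + dd (\<lambda>y. h y u w) x v - dd (\<lambda>y. h y u v) x w)"
      by (intro linear_compose_sub linear_compose_add linear_dh1 linear_dh3 assms)
  qed (use pos[OF assms] in auto)
  from theI'[OF this] show ?thesis by (simp add: christoffel_def)
qed

lemma christoffel_sym: "x \<in> S \<Longrightarrow> christoffel h x u v = christoffel h x v u"
proof (rule nondegenerate, assumption)
  fix w assume x: "x \<in> S"
  show "h x (christoffel h x u v) w = h x (christoffel h x v u) w"
    using koszul[OF x, of u v w] koszul[OF x, of v u w] dh_sym[OF x, of u v w] by simp
qed

lemma linear_christoffel2: "x \<in> S \<Longrightarrow> linear (christoffel h x u)"
proof (rule linearI)
  fix a b r assume x: "x \<in> S"
  note l = linear_add[OF linear_dh1[OF x]] linear_add[OF linear_dh2[OF x]] linear_add[OF linear_dh3[OF x]]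
    linear_cmul[OF linear_dh1[OF x]] linear_cmul[OF linear_dh2[OF x]] linear_cmul[OF linear_dh3[OF x]]
  show "christoffel h x u (a + b) = christoffel h x u a + christoffel h x u b"
  proof (rule nondegenerate[OF x])
    fix w show "h x (christoffel h x u (a + b)) w = h x (christoffel h x u a + christoffel h x u b) w"
      using koszul[OF x, of u "a + b" w] koszul[OF x, of u a w] koszul[OF x, of u b w]
      by (simp add: h_simps[OF x] l)
  qed
  show "christoffel h x u (r *\<^sub>R a) = r *\<^sub>R christoffel h x u a"
  proof (rule nondegenerate[OF x])
    fix w
    have "2 * h x (christoffel h x u (r *\<^sub>R a)) w = r * (2 * h x (christoffel h x u a) w)"
      unfolding koszul[OF x] by (simp add: l algebra_simps)
    then show "h x (christoffel h x u (r *\<^sub>R a)) w = h x (r *\<^sub>R christoffel h x u a) w"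
      by (simp add: h_simps[OF x])
  qed
qed

lemma linear_christoffel1: "x \<in> S \<Longrightarrow> linear (\<lambda>u. christoffel h x u v)"
  using linear_christoffel2[of x v] by (simp add: christoffel_sym[of x _ v])

text \<open>In the sum of the Koszul identities for \<open>(u, v, w)\<close> and
  \<open>(u, w, v)\<close> the derivatives in the directions \<open>v\<close> and \<open>w\<close>
  cancel.\<close>

lemma metric_compatible:
  assumes "x \<in> S"
  shows "dd (\<lambda>y. h y v w) x u = h x (christoffel h x u v) w + h x v (christoffel h x u w)"
proof -
  have "2 * h x v (christoffel h x u w) = 2 * h x (christoffel h x u w) v" using sym assms by simp
  then show ?thesis
    using koszul[OF assms, of u v w] koszul[OF assms, of u w v] dh_sym[OF assms] by simp
qed

text \<open>The Christoffel form is given implicitly by \<open>koszul\<close>, so its regularity is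
  that of the solution of a linear system with differentiable coefficients.\<close>

lemma diff_christoffel:
  assumes "x \<in> S"
  shows "(\<lambda>y. christoffel h y u v) differentiable (at x)"
proof (rule representer_differentiable[OF open_S assms])
  show "bilinear (\<lambda>u v. 2 * h y u v)" if "y \<in> S" for y
    using bilinear_h[OF that] by (auto simp: bilinear_def intro: linear_const_mult)
  show "2 * h x u u > 0" if "u \<noteq> 0" for u using pos[OF assms that] by simp
  show "(\<lambda>y. 2 * h y u v) differentiable (at x)" for u v
    using diff_h[OF assms] by (intro differentiable_mult) auto
  show "(\<lambda>y. dd (\<lambda>y. h y v w) y u + dd (\<lambda>y. h y u w) y v - dd (\<lambda>y. h y u v) y w) differentiable (at x)" for w
    by (intro differentiable_diff differentiable_add smooth_onD[OF smooth_on_dd[OF smooth_h] assms])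
qed (rule koszul)

end

section \<open>Killing fields on Kaehler charts\<close>

text \<open>The coordinate Hessian, without Christoffel correction. Only its
  \<open>J\<close>-invariant part is compared between charts, and that part is a tensor.\<close>

definition hess :: "('e::real_normed_vector \<Rightarrow> real) \<Rightarrow> 'e \<Rightarrow> 'e \<Rightarrow> 'e \<Rightarrow> real" where
  "hess f x u v = dd (\<lambda>y. dd f y v) x u"

lemma tr_add: "tr (\<lambda>b. A b + B b) = tr A + tr B"
  by (simp add: tr_def inner_add_left sum.distrib)

lemma tr_minus: "tr (\<lambda>b. - A b) = - tr A"
  by (simp add: tr_def sum_negf)

lemma tr_scaleR: "tr (\<lambda>b. r *\<^sub>R A b) = r * tr A"
  by (simp add: tr_def sum_distrib_left)

lemma has_derivative_tr:
  assumes "\<And>b. ((\<lambda>y. A y b) has_derivative (\<lambda>v. A' v b)) (at x)"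
  shows "((\<lambda>y. tr (A y)) has_derivative (\<lambda>v. tr (A' v))) (at x)"
  unfolding tr_def by (intro has_derivative_sum has_derivative_inner_left assms)

context metric_chart
begin

text \<open>The logarithmic derivative of the volume density along \<open>v\<close>. The divergence
  of a field \<open>Z\<close> is \<open>tr (dd Z x) + div_form x (Z x)\<close>.\<close>

definition div_form :: "'e \<Rightarrow> 'e \<Rightarrow> real" where
  "div_form x v = tr (christoffel h x v)"

lemma linear_div_form: "x \<in> S \<Longrightarrow> linear (div_form x)"
proof (rule linearI)
  fix a b r assume x: "x \<in> S"
  show "div_form x (a + b) = div_form x a + div_form x b"
    unfolding div_form_def tr_add[symmetric]
    by (rule arg_cong[of _ _ tr]) (auto simp: linear_add[OF linear_christoffel1[OF x]])
  show "div_form x (r *\<^sub>R a) = r *\<^sub>R div_form x a"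
    unfolding div_form_def real_scaleR_def tr_scaleR[symmetric]
    by (rule arg_cong[of _ _ tr]) (auto simp: linear_cmul[OF linear_christoffel1[OF x]])
qed

lemma has_derivative_div_form:
  assumes "x \<in> S"
  shows "((\<lambda>y. div_form y v) has_derivative (\<lambda>u. tr (\<lambda>b. dd (\<lambda>y. christoffel h y v b) x u))) (at x)"
  unfolding div_form_def by (rule has_derivative_tr) (rule differentiable_dd[OF diff_christoffel[OF assms]])

lemma diff_div_form: "x \<in> S \<Longrightarrow> (\<lambda>y. div_form y v) differentiable (at x)"
  using has_derivative_div_form differentiable_def by blast

end


section \<open>Kaehler metrics in one chart\<close>

locale kaehler_chart = metric_chart h S
  for h :: "complex^'n \<Rightarrow> complex^'n \<Rightarrow> complex^'n \<Rightarrow> real" and S +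
  assumes J_invariant: "x \<in> S \<Longrightarrow> h x (J u) (J v) = h x u v"
    and closed: "closed_2form (kaehler_form h) S"
begin

lemma J_skew: "x \<in> S \<Longrightarrow> h x (J u) v = - h x u (J v)"
  using J_invariant[of x u "J v"] h_simps by simp

lemma closed': 
  assumes "x \<in> S"
  shows "dd (\<lambda>y. h y (J b) c) x a + dd (\<lambda>y. h y (J c) a) x b + dd (\<lambda>y. h y (J a) b) x c = 0"
  using closed assms by (simp add: closed_2form_def kaehler_form_def)

lemma dd_J_invariant:
  assumes "x \<in> S"
  shows "dd (\<lambda>y. h y (J u) (J v)) x a = dd (\<lambda>y. h y u v) x a"
  by (rule fun_cong[OF dd_cong_open[OF open_S assms]]) (rule J_invariant)

lemma dd_J_skew:
  assumes "x \<in> S"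
  shows "dd (\<lambda>y. h y (J u) v) x a = - dd (\<lambda>y. h y u (J v)) x a"
proof -
  have "dd (\<lambda>y. h y (J u) v) x a = dd (\<lambda>y. - h y u (J v)) x a"
    by (rule fun_cong[OF dd_cong_open[OF open_S assms]]) (rule J_skew)
  also have "\<dots> = - dd (\<lambda>y. h y u (J v)) x a"
    by (rule dd_eq) (intro has_derivative_minus differentiable_dd diff_h[OF assms])
  finally show ?thesis .
qed

lemma dd_h_minus:
  assumes "x \<in> S"
  shows "dd (\<lambda>y. h y (- u) v) x a = - dd (\<lambda>y. h y u v) x a"
    "dd (\<lambda>y. h y u (- v)) x a = - dd (\<lambda>y. h y u v) x a"
    "dd (\<lambda>y. h y u v) x (- a) = - dd (\<lambda>y. h y u v) x a"
  using linear_neg[OF linear_dh1[OF assms]] linear_neg[OF linear_dh2[OF assms]]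
    linear_neg[OF linear_dh3[OF assms]] by auto

text \<open>The difference of the closedness relations for \<open>(u, v, w)\<close> and \<open>(u, J v, J w)\<close>.\<close>

lemma christoffel_J:
  assumes x: "x \<in> S"
  shows "christoffel h x u (J v) = J (christoffel h x u v)"
proof (rule nondegenerate[OF x])
  fix w
  note s = dd_J_skew[OF x] dd_J_invariant[OF x] dd_h_minus[OF x] J_J
  have 1: "dd (\<lambda>y. h y (J v) w) x u + dd (\<lambda>y. h y (J w) u) x v + dd (\<lambda>y. h y (J u) v) x w = 0"
    by (rule closed'[OF x])
  have 2: "dd (\<lambda>y. h y (J (J v)) (J w)) x u + dd (\<lambda>y. h y (J (J w)) u) x (J v) + dd (\<lambda>y. h y (J u) (J v)) x (J w) = 0"
    by (rule closed'[OF x])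
  have "2 * h x (J (christoffel h x u v)) w = - (2 * h x (christoffel h x u v) (J w))"
    using J_skew[OF x] by simp
  also have "\<dots> = 2 * h x (christoffel h x u (J v)) w"
    unfolding koszul[OF x]
    using 1 2 dh_sym[OF x, of u w "J v"] dh_sym[OF x, of u "J w" v]  by (simp add: s)
  finally show "h x (christoffel h x u (J v)) w = h x (J (christoffel h x u v)) w" by simp
qed

lemma christoffel_J1: "x \<in> S \<Longrightarrow> christoffel h x (J u) v = J (christoffel h x u v)"
  using christoffel_J[of x v u] by (simp add: christoffel_sym)

text \<open>In the sum all terms but the derivatives of \<open>div_form\<close> cancel.\<close>

lemma ricci_J_sum:
  assumes x: "x \<in> S"
  shows "ricci h x u v + ricci h x (J u) (J v) =
    - dd (\<lambda>y. div_form y v) x u - dd (\<lambda>y. div_form y (J v)) x (J u)"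
proof -
  have r: "ricci h x u v = tr (\<lambda>b. curvature h x b u v)" for u v
    by (simp add: ricci_def tr_def)
  have div: "dd (\<lambda>y. div_form y v) x u = tr (\<lambda>b. dd (\<lambda>y. christoffel h y b v) x u)" for u v
  proof -
    have "dd (\<lambda>y. div_form y v) x u = tr (\<lambda>b. dd (\<lambda>y. christoffel h y v b) x u)"
      by (rule dd_eq[OF has_derivative_div_form[OF x]])
    moreover have "dd (\<lambda>y. christoffel h y v b) x u = dd (\<lambda>y. christoffel h y b v) x u" for b
      by (rule fun_cong[OF dd_cong_open[OF open_S x]]) (rule christoffel_sym)
    ultimately show ?thesis by simp
  qed
  \<comment> \<open>The Christoffel form is complex bilinear, hence changes sign when both arguments
    are rotated. This cancels the derivatives along \<open>b\<close> and, likewise, the quadratic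
    terms of the curvature.\<close>
  have J1: "dd (\<lambda>y. christoffel h y (J u) (J v)) x b = - dd (\<lambda>y. christoffel h y u v) x b" for b
  proof -
    have "dd (\<lambda>y. christoffel h y (J u) (J v)) x b = dd (\<lambda>y. - christoffel h y u v) x b"
      by (rule fun_cong[OF dd_cong_open[OF open_S x]]) (simp add: christoffel_J christoffel_J1)
    also have "\<dots> = - dd (\<lambda>y. christoffel h y u v) x b"
      by (rule dd_eq) (intro has_derivative_minus differentiable_dd diff_christoffel x)
    finally show ?thesis .
  qed
  have "curvature h x b u v + curvature h x b (J u) (J v) =
    - (dd (\<lambda>y. christoffel h y b v) x u + dd (\<lambda>y. christoffel h y b (J v)) x (J u))" for b
    unfolding curvature_def J1
    by (simp add: christoffel_J[OF x] christoffel_J1[OF x] linear_neg[OF linear_christoffel2[OF x]])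
  then have "tr (\<lambda>b. curvature h x b u v) + tr (\<lambda>b. curvature h x b (J u) (J v)) =
    tr (\<lambda>b. - (dd (\<lambda>y. christoffel h y b v) x u + dd (\<lambda>y. christoffel h y b (J v)) x (J u)))"
    by (simp only: tr_add[symmetric])
  then show ?thesis
    unfolding r div by (simp only: tr_minus tr_add)
qed

text \<open>Both Ricci terms equal \<open>l * h x u v\<close> by \<open>J\<close>-invariance of the
  metric, which is the origin of the factor 2.\<close>

lemma einstein_div_form:
  assumes x: "x \<in> S" and ric: "\<And>u v. ricci h x u v = l * h x u v"
  shows "dd (\<lambda>y. div_form y v) x u + dd (\<lambda>y. div_form y (J v)) x (J u) = - 2 * l * h x u v"
  using ricci_J_sum[OF x, of u v] unfolding ric J_invariant[OF x] by simp

end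

text \<open>A Killing field and its Hamiltonian function in one chart. \<open>killing\<close> is the
  vanishing of the Lie derivative of the metric, tested on constant fields; \<open>moment\<close> is
  the moment map equation for one element of the Lie algebra.\<close>

locale killing_chart = kaehler_chart h S
  for h :: "complex^'n \<Rightarrow> complex^'n \<Rightarrow> complex^'n \<Rightarrow> real" and S +
  fixes X :: "complex^'n \<Rightarrow> complex^'n" and f :: "complex^'n \<Rightarrow> real"
  assumes smooth_X: "smooth_on S X" and smooth_f: "smooth_on S f"
    and killing: "x \<in> S \<Longrightarrow>
      dd (\<lambda>y. h y u v) x (X x) + h x (dd X x u) v + h x u (dd X x v) = 0"
    and moment: "x \<in> S \<Longrightarrow> dd f x v = h x (J v) (X x)"
begin

text \<open>The endomorphism \<open>\<nabla>X\<close> of the tangent space at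
  \<open>x\<close>.\<close>

definition nab :: "complex^'n \<Rightarrow> complex^'n \<Rightarrow> complex^'n" where
  "nab x u = dd X x u + christoffel h x u (X x)"

lemma diff_X: "x \<in> S \<Longrightarrow> X differentiable (at x)"
  by (rule smooth_onD[OF smooth_X])

lemma diff_f: "x \<in> S \<Longrightarrow> f differentiable (at x)"
  by (rule smooth_onD[OF smooth_f])

lemma linear_nab: "x \<in> S \<Longrightarrow> linear (nab x)"
  unfolding nab_def by (intro linear_compose_add linear_dd diff_X linear_christoffel1)

lemma nab_skew:
  assumes x: "x \<in> S"
  shows "h x (nab x u) v = - h x u (nab x v)"
  using killing[OF x, of u v] unfolding metric_compatible[OF x] nab_def
  by (simp add: h_simps[OF x] christoffel_sym[OF x, of "X x"])

text \<open>Differentiate \<open>moment\<close> and use that \<open>J\<close> is parallel. The first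
  term is the covariant Hessian of \<open>f\<close>, the second the Christoffel correction that
  separates it from the coordinate one.\<close>

lemma hess_eq:
  assumes x: "x \<in> S"
  shows "hess f x u v = h x (J v) (nab x u) + dd f x (christoffel h x u v)"
proof -
  have "hess f x u v = dd (\<lambda>y. h y (J v) (X y)) x u"
    unfolding hess_def by (rule fun_cong[OF dd_cong_open[OF open_S x]]) (rule moment)
  also have "\<dots> = dd (\<lambda>y. h y (J v) (X x)) x u + h x 0 (X x) + h x (J v) (dd X x u)"
    by (rule dd_eq[OF has_derivative_h[OF x has_derivative_const differentiable_dd[OF diff_X[OF x]]]])
  also have "\<dots> = h x (J v) (nab x u) + dd f x (christoffel h x u v)"
    by (simp add: metric_compatible[OF x] moment[OF x] nab_def h_simps[OF x] christoffel_J[OF x])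
  finally show ?thesis .
qed

lemma hess_sym: "x \<in> S \<Longrightarrow> hess f x u v = hess f x v u"
  unfolding hess_def by (rule smooth_on_dd_dd_symmetric[OF open_S _ smooth_f])

text \<open>Symmetry of the Hessian, combined with skewness of \<open>nab x\<close> and of
  \<open>J\<close>, makes the two commute: a Killing field that has a Hamiltonian function is
  holomorphic.\<close>

lemma nab_J:
  assumes x: "x \<in> S"
  shows "nab x (J u) = J (nab x u)"
proof (rule nondegenerate[OF x])
  fix v
  have "h x (J v) (nab x u) = h x (J u) (nab x v)"
    using hess_sym[OF x, of u v] by (simp add: hess_eq[OF x] christoffel_sym[OF x, of u v])
  then show "h x (nab x (J u)) v = h x (J (nab x u)) v"
    using nab_skew[OF x, of "J u" v] J_skew[OF x] sym[OF x] by metis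
qed

lemma dd_X_J:
  assumes x: "x \<in> S"
  shows "dd X x (J u) = J (dd X x u)"
  using nab_J[OF x, of u] linear_add[OF linear_J] by (simp add: nab_def christoffel_J1[OF x])

text \<open>Adding the rotated term removes the Christoffel correction, since the Christoffel form
  is complex bilinear. The endomorphism \<open>J \<nabla>X\<close> is thereby expressed through
  quantities that transform without connection terms.\<close>

lemma complex_hess:
  assumes x: "x \<in> S"
  shows "hess f x u v + hess f x (J u) (J v) = - 2 * h x (J (nab x u)) v"
  using linear_neg[OF linear_dd[OF diff_f[OF x]]] J_skew[OF x, of v "nab x u"] sym[OF x, of v]
  by (simp add: hess_eq[OF x] christoffel_J[OF x] christoffel_J1[OF x] nab_J[OF x] h_simps[OF x])

text \<open>The divergence of \<open>J X\<close>, written as a trace of \<open>J \<nabla>X\<close>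
  because \<open>J\<close> is parallel; \<open>div_J_eq\<close> gives the coordinate form to which
  the divergence theorem applies.\<close>

definition div_J :: "complex^'n \<Rightarrow> real" where
  "div_J x = tr (\<lambda>u. J (nab x u))"

lemma div_J_eq:
  assumes x: "x \<in> S"
  shows "div_J x = tr (\<lambda>b. J (dd X x b)) + div_form x (J (X x))"
proof -
  have "J (nab x b) = J (dd X x b) + christoffel h x (J (X x)) b" for b
    using linear_add[OF linear_J] christoffel_J[OF x] christoffel_sym[OF x, of "J (X x)" b] by (simp add: nab_def)
  then show ?thesis by (simp add: div_J_def div_form_def tr_add)
qed

text \<open>The endomorphism \<open>nab x\<close> is skew for the metric, so its trace
  vanishes.\<close>

lemma div_eq_0:
  assumes x: "x \<in> S"
  shows "tr (dd X x) + div_form x (X x) = 0"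
proof -
  have "tr (nab x) = 0"
    by (rule tr_skew[where b = "h x"]) (fact bilinear_h[OF x] pos[OF x] linear_nab[OF x] nab_skew[OF x])+
  moreover have "nab x = (\<lambda>b. dd X x b + christoffel h x (X x) b)"
    using christoffel_sym[OF x] by (auto simp: nab_def)
  ultimately show ?thesis by (simp add: div_form_def tr_add)
qed

lemma diff_dd_X: "x \<in> S \<Longrightarrow> (\<lambda>y. dd X y b) differentiable (at x)"
  by (rule smooth_onD[OF smooth_on_dd[OF smooth_X]])

lemma has_derivative_div_form_comp:
  assumes "x \<in> S" "(w has_derivative w') (at x)"
  shows "((\<lambda>y. div_form y (w y)) has_derivative
    (\<lambda>v. dd (\<lambda>y. div_form y (w x)) x v + div_form x (w' v))) (at x)"
  by (rule has_derivative_linear_family[OF open_S assms(1) linear_div_form diff_div_form assms(2)])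
    (auto simp: assms)

lemma has_derivative_J:
  "(w has_derivative w') F \<Longrightarrow> ((\<lambda>y. J (w y)) has_derivative (\<lambda>v. J (w' v))) F"
  by (rule bounded_linear.has_derivative[OF bounded_linear_J])

text \<open>\<open>X\<close> is holomorphic, so the derivative of the divergence of \<open>J X\<close> along \<open>v\<close> is that of the
  vanishing divergence of \<open>X\<close> along \<open>J v\<close>, up to derivatives of \<open>div_form\<close>.\<close>

lemma has_derivative_div_J:
  assumes x: "x \<in> S" and ric: "\<And>u v. ricci h x u v = l * h x u v"
  shows "(div_J has_derivative (\<lambda>v. 2 * l * dd f x v)) (at x)"
proof -
  define D2 where "D2 v b = dd (\<lambda>y. dd X y b) x v" for v b
  have d2: "((\<lambda>y. dd X y b) has_derivative (\<lambda>v. D2 v b)) (at x)" for b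
    unfolding D2_def by (rule differentiable_dd[OF diff_dd_X[OF x]])
  have D2_sym: "D2 v b = D2 b v" for v b
    unfolding D2_def by (rule smooth_on_dd_dd_symmetric[OF open_S x smooth_X])
  \<comment> \<open>\<open>dd_X_J\<close> gives complex linearity in the slot \<open>b\<close>;
    symmetry of second derivatives moves it to the slot \<open>v\<close>.\<close>
  have D2_J: "D2 (J v) b = J (D2 v b)" for v b
  proof -
    have "D2 (J v) b = dd (\<lambda>y. dd X y (J v)) x b" using D2_sym by (simp add: D2_def)
    also have "\<dots> = dd (\<lambda>y. J (dd X y v)) x b"
      by (rule fun_cong[OF dd_cong_open[OF open_S x]]) (rule dd_X_J)
    also have "\<dots> = J (D2 b v)" by (rule dd_eq[OF has_derivative_J[OF d2]])
    finally show ?thesis by (simp add: D2_sym)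
  qed
  have dX: "(X has_derivative dd X x) (at x)" by (rule differentiable_dd[OF diff_X[OF x]])
  have "((\<lambda>y. tr (dd X y) + div_form y (X y)) has_derivative
      (\<lambda>v. tr (D2 v) + (dd (\<lambda>y. div_form y (X x)) x v + div_form x (dd X x v)))) (at x)"
    by (intro has_derivative_add has_derivative_tr d2 has_derivative_div_form_comp x dX)
  moreover have "((\<lambda>y. tr (dd X y) + div_form y (X y)) has_derivative (\<lambda>v. 0)) (at x)"
    by (rule has_derivative_transform_within_open[OF has_derivative_const open_S x]) (simp add: div_eq_0)
  ultimately have 0: "tr (D2 v) + (dd (\<lambda>y. div_form y (X x)) x v + div_form x (dd X x v)) = 0" for v
    by (rule fun_cong[OF has_derivative_unique])
  have "((\<lambda>y. tr (\<lambda>b. J (dd X y b)) + div_form y (J (X y))) has_derivative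
      (\<lambda>v. tr (\<lambda>b. J (D2 v b)) + (dd (\<lambda>y. div_form y (J (X x))) x v + div_form x (J (dd X x v))))) (at x)"
    by (intro has_derivative_add has_derivative_tr has_derivative_J d2 has_derivative_div_form_comp x dX)
  then have "(div_J has_derivative
      (\<lambda>v. tr (\<lambda>b. J (D2 v b)) + (dd (\<lambda>y. div_form y (J (X x))) x v + div_form x (J (dd X x v))))) (at x)"
    by (rule has_derivative_transform_within_open[OF _ open_S x]) (simp add: div_J_eq)
  moreover have "tr (\<lambda>b. J (D2 v b)) + (dd (\<lambda>y. div_form y (J (X x))) x v + div_form x (J (dd X x v))) =
      2 * l * dd f x v" for v
  proof -
    have "tr (\<lambda>b. J (D2 v b)) = - (dd (\<lambda>y. div_form y (X x)) x (J v) + div_form x (J (dd X x v)))"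
    proof -
      have "tr (D2 (J v)) = tr (\<lambda>b. J (D2 v b))"
        by (rule arg_cong[of _ _ tr]) (auto simp: D2_J)
      then show ?thesis using 0[of "J v"] by (simp add: dd_X_J[OF x])
    qed
    \<comment> \<open>With \<open>J (X x)\<close> as second argument, the rotated term of
      \<open>einstein_div_form\<close> involves \<open>J (J X) = - X\<close>, which is the term left
      over from the divergence of \<open>X\<close> along \<open>J v\<close>.\<close>
    moreover have "dd (\<lambda>y. div_form y (J (X x))) x v + dd (\<lambda>y. div_form y (- X x)) x (J v) =
        - 2 * l * h x v (J (X x))"
      using einstein_div_form[OF x ric, of "J (X x)" v] by simp
    moreover have "dd (\<lambda>y. div_form y (- X x)) x (J v) = - dd (\<lambda>y. div_form y (X x)) x (J v)"
      by (rule linear_neg[OF linear_dd_param[OF open_S x linear_div_form diff_div_form[OF x]]])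
    moreover have "h x v (J (X x)) = - dd f x v"
      using moment[OF x, of v] J_skew[OF x, of v] by simp
    ultimately show ?thesis by simp
  qed
  ultimately show ?thesis by simp
qed

end

section \<open>The volume density\<close>

text \<open>For alternating \<open>w\<close> this is a multiple of the Pfaffian of the matrix of
  \<open>w\<close> on the vectors \<open>v\<close>, that is, the top wedge power of \<open>w\<close>
  evaluated on them; the factor \<open>1 / 2 ^ CARD('n)\<close> of \<open>omega_power\<close> is
  left out.\<close>

definition pf_sum :: "('a \<Rightarrow> 'a \<Rightarrow> real) \<Rightarrow> ('n::finite \<times> bool \<Rightarrow> 'a) \<Rightarrow> real" where
  "pf_sum w v = (\<Sum>s | s permutes (UNIV :: ('n \<times> bool) set). of_int (sign s) *
     (\<Prod>j\<in>UNIV. w (v (s (j, False))) (v (s (j, True)))))"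

lemma prod_prod_bool:
  fixes F :: "'n::finite \<times> bool \<Rightarrow> 'b::comm_monoid_mult"
  shows "(\<Prod>i\<in>UNIV. F i) = (\<Prod>j\<in>UNIV. F (j, False) * F (j, True))"
proof -
  have "(\<Prod>i\<in>UNIV. F i) = (\<Prod>j\<in>UNIV. \<Prod>b\<in>UNIV. F (j, b))"
    by (subst prod.cartesian_product) (simp add: UNIV_Times_UNIV case_prod_unfold)
  then show ?thesis by (simp add: UNIV_bool)
qed

text \<open>A selection that is not a permutation repeats a row.\<close>

lemma det_selected_rows:
  fixes B :: "real^'i^'i" and f :: "'i::finite \<Rightarrow> 'i"
  shows "det (\<chi> i. B $ f i) = (if f permutes UNIV then of_int (sign f) * det B else 0)"
proof (cases "f permutes UNIV")
  case True
  then show ?thesis by (simp add: det_permute_rows)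
next
  case False
  then have "\<not> inj f"
    using finite_UNIV_inj_surj permutes_def by (metis UNIV_I bij_def bij_imp_permutes finite)
  then obtain i j where "i \<noteq> j" "f i = f j" by (auto simp: inj_def)
  then have "det (\<chi> i. B $ f i) = 0"
    by (intro det_identical_rows[of i j]) (simp_all add: row_def vec_eq_iff)
  then show ?thesis using False by simp
qed

text \<open>A form of top degree scales by the determinant. Expanding every argument gives a sum
  over all selections \<open>f\<close> of frame vectors; summing over the permutations
  \<open>s\<close> first produces a determinant of selected rows, which leaves only those
  \<open>f\<close> that permute the indices.\<close>

lemma pf_sum_linear_combination:
  fixes w :: "'a::real_vector \<Rightarrow> 'a \<Rightarrow> real" and u :: "'n::finite \<times> bool \<Rightarrow> 'a"
  assumes w: "bilinear w"
  shows "pf_sum w (\<lambda>i. \<Sum>k\<in>UNIV. A i k *\<^sub>R u k) = det (\<chi> i k. A i k) * pf_sum w u"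
proof -
  define v where "v i = (\<Sum>k\<in>UNIV. A i k *\<^sub>R u k)" for i
  have wv: "w (v a) (v b) = (\<Sum>p\<in>UNIV. A a (fst p) * A b (snd p) * w (u (fst p)) (u (snd p)))" for a b
    using w unfolding v_def bilinear_sum[OF w]
    by (simp add: bilinear_lmul[OF w] bilinear_rmul[OF w] case_prod_unfold mult_ac UNIV_Times_UNIV)
  have one: "(\<Prod>j\<in>UNIV. w (v (s (j, False))) (v (s (j, True)))) =
      (\<Sum>f\<in>UNIV. (\<Prod>i\<in>UNIV. A (s i) (f i)) * (\<Prod>j\<in>UNIV. w (u (f (j, False))) (u (f (j, True)))))"
    for s :: "'n \<times> bool \<Rightarrow> 'n \<times> bool"
  proof -
    have "(\<Prod>j\<in>UNIV. w (v (s (j, False))) (v (s (j, True)))) =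
        (\<Sum>q\<in>PiE UNIV (\<lambda>_. UNIV). \<Prod>j\<in>UNIV. A (s (j, False)) (fst (q j)) * A (s (j, True)) (snd (q j)) *
          w (u (fst (q j))) (u (snd (q j))))"
      unfolding wv by (rule prod_sum_PiE) (rule finite)+
    also have "\<dots> = (\<Sum>q\<in>UNIV. \<Prod>j\<in>UNIV. A (s (j, False)) (fst (q j)) * A (s (j, True)) (snd (q j)) *
          w (u (fst (q j))) (u (snd (q j))))"
      by (rule sum.cong) (auto simp: PiE_def extensional_def)
    \<comment> \<open>A family of pairs indexed by \<open>'n\<close> is the same as a single
      selection on \<open>'n \<times> bool\<close>.\<close>
    also have "\<dots> = (\<Sum>f\<in>UNIV. \<Prod>j\<in>UNIV. A (s (j, False)) (f (j, False)) * A (s (j, True)) (f (j, True)) *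
          w (u (f (j, False))) (u (f (j, True))))"
      by (rule sum.reindex_bij_witness[of _ "\<lambda>f j. (f (j, False), f (j, True))"
            "\<lambda>q i. if snd i then snd (q (fst i)) else fst (q (fst i))"]) (auto simp: fun_eq_iff)
    finally show ?thesis by (simp add: prod_prod_bool prod.distrib)
  qed
  \<comment> \<open>The Leibniz sum runs over \<open>A (s i) (f i)\<close>, with the permutation in
    the row index, so the selected rows are those of the transpose.\<close>
  define B where "B = transpose (\<chi> i k. A i k)"
  have Bdet: "(\<Sum>s | s permutes UNIV. of_int (sign s) * (\<Prod>i\<in>UNIV. A (s i) (f i))) =
      (if f permutes UNIV then of_int (sign f) * det B else 0)" for f
  proof -
    have "(\<Sum>s | s permutes UNIV. of_int (sign s) * (\<Prod>i\<in>UNIV. A (s i) (f i))) = det (\<chi> i. B $ f i)"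
      by (simp add: det_def B_def transpose_def)
    then show ?thesis by (simp add: det_selected_rows)
  qed
  have "pf_sum w v = (\<Sum>s | s permutes UNIV. \<Sum>f\<in>UNIV. of_int (sign s) * (\<Prod>i\<in>UNIV. A (s i) (f i)) *
      (\<Prod>j\<in>UNIV. w (u (f (j, False))) (u (f (j, True)))))"
    unfolding pf_sum_def one by (simp add: sum_distrib_left mult.assoc)
  also have "\<dots> = (\<Sum>f\<in>UNIV. (\<Sum>s | s permutes UNIV. of_int (sign s) * (\<Prod>i\<in>UNIV. A (s i) (f i))) *
      (\<Prod>j\<in>UNIV. w (u (f (j, False))) (u (f (j, True)))))"
    by (subst sum.swap) (simp add: sum_distrib_right)
  also have "\<dots> = (\<Sum>f\<in>UNIV. if f permutes UNIV then of_int (sign f) * det B *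
      (\<Prod>j\<in>UNIV. w (u (f (j, False))) (u (f (j, True)))) else 0)"
    unfolding Bdet by (rule sum.cong) auto
  also have "\<dots> = det B * pf_sum w u"
    by (simp add: sum.If_cases pf_sum_def sum_distrib_left algebra_simps)
  finally show ?thesis by (simp add: v_def[abs_def] B_def)
qed

section \<open>The real frame and the derivative of the top power\<close>

lemma real_frame_range: "inj (real_frame :: 'n::finite \<times> bool \<Rightarrow> complex^'n)"
    "range (real_frame :: 'n \<times> bool \<Rightarrow> complex^'n) = Basis"
proof -
  show inj: "inj (real_frame :: 'n \<times> bool \<Rightarrow> _)"
    by (auto simp: inj_def real_frame_def axis_eq_axis split: if_splits)
  show "range (real_frame :: 'n \<times> bool \<Rightarrow> _) = Basis"
    by (auto simp: Basis_vec_def real_frame_def Basis_complex_def image_iff) (metis+)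
qed

lemma real_frame_inner: "real_frame i \<bullet> real_frame k = (if i = k then 1 else 0)"
  by (auto simp: real_frame_def inner_axis prod_eq_iff) (simp_all add: axis_def)

lemma sum_real_frame: "(\<Sum>b\<in>Basis. g b) = (\<Sum>k\<in>UNIV. g (real_frame k))"
  for g :: "complex^'n \<Rightarrow> 'b::comm_monoid_add"
  unfolding real_frame_range(2)[symmetric] by (subst sum.reindex[OF real_frame_range(1)]) simp

lemma real_frame_expansion: "v = (\<Sum>k\<in>UNIV. (v \<bullet> real_frame k) *\<^sub>R real_frame k)"
  for v :: "complex^'n"
  using euclidean_representation[of v] by (simp add: sum_real_frame)

lemma pf_sum_image:
  fixes w :: "complex^'n \<Rightarrow> complex^'n \<Rightarrow> real"
  assumes "bilinear w"
  shows "pf_sum w v = det (\<chi> i k. v i \<bullet> real_frame k) * pf_sum w real_frame"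
  using pf_sum_linear_combination[OF assms, of "\<lambda>i k. v i \<bullet> real_frame k" real_frame]
  by (simp flip: real_frame_expansion)

lemma has_derivative_pf_sum:
  fixes w :: "'a::real_normed_vector \<Rightarrow> 'b \<Rightarrow> 'b \<Rightarrow> real" and v :: "'a \<Rightarrow> 'n::finite \<times> bool \<Rightarrow> 'b"
  assumes "\<And>i k. ((\<lambda>y. w y (v y i) (v y k)) has_derivative (\<lambda>a. W a i k)) (at x)"
  shows "((\<lambda>y. pf_sum (w y) (v y)) has_derivative
    (\<lambda>a. \<Sum>s | s permutes (UNIV :: ('n \<times> bool) set). of_int (sign s) *
      (\<Sum>j\<in>UNIV. W a (s (j, False)) (s (j, True)) *
        (\<Prod>k\<in>UNIV - {j}. w x (v x (s (k, False))) (v x (s (k, True))))))) (at x)"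
  unfolding pf_sum_def
  by (intro has_derivative_sum has_derivative_mult_right has_derivative_prod assms)

text \<open>Only the identity permutation contributes to first order.\<close>

lemma has_derivative_det_id:
  fixes G :: "'i::finite \<Rightarrow> 'i \<Rightarrow> real"
  shows "((\<lambda>t. det (\<chi> i k. (if i = k then 1 else 0) + t * G i k)) has_derivative
    (\<lambda>t. t * (\<Sum>i\<in>UNIV. G i i))) (at 0)"
proof -
  have "((\<lambda>t. det (\<chi> i k. (if i = k then 1 else 0) + t * G i k)) has_derivative
    (\<lambda>t. \<Sum>p | p permutes UNIV. of_int (sign p) * (\<Sum>i\<in>UNIV. (t * G i (p i)) *
      (\<Prod>j\<in>UNIV - {i}. (if j = p j then 1 else 0) + 0 * G j (p j))))) (at 0)"
    unfolding det_def
    by (simp, intro has_derivative_sum has_derivative_mult_right has_derivative_prod)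
      (auto intro!: derivative_eq_intros)
  moreover have "(\<Sum>p | p permutes UNIV. of_int (sign p) * (\<Sum>i\<in>UNIV. (t * G i (p i)) *
      (\<Prod>j\<in>UNIV - {i}. (if j = p j then 1 else 0) + 0 * G j (p j)))) = t * (\<Sum>i\<in>UNIV. G i i)" for t
  proof -
    \<comment> \<open>A permutation other than the identity moves at least two points, so after one
      index is omitted a factor remains that vanishes at \<open>t = 0\<close>.\<close>
    have 0: "(\<Prod>j\<in>UNIV - {i}. (if j = p j then 1 else 0) + 0 * G j (p j)) = 0"
      if p: "p permutes UNIV" "p \<noteq> id" for p i
    proof -
      obtain a where a: "p a \<noteq> a" using p(2) by (auto simp: fun_eq_iff)
      have "p (p a) \<noteq> p a" using a permutes_inj[OF p(1)] by (auto simp: inj_def)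
      then have "\<exists>j. j \<noteq> i \<and> j \<noteq> p j" using a by metis
      then show ?thesis by (auto intro!: prod_zero)
    qed
    have "(\<Sum>p | p permutes UNIV. of_int (sign p) * (\<Sum>i\<in>UNIV. (t * G i (p i)) *
      (\<Prod>j\<in>UNIV - {i}. (if j = p j then 1 else 0) + 0 * G j (p j)))) =
      (\<Sum>p | p permutes (UNIV :: 'i set). if p = id then t * (\<Sum>i\<in>UNIV. G i i) else 0)"
    proof (rule sum.cong[OF refl])
      fix p :: "'i \<Rightarrow> 'i" assume "p \<in> {p. p permutes UNIV}"
      then have "of_int (sign p) * (\<Sum>i\<in>UNIV. (t * G i (p i)) *
          (\<Prod>j\<in>UNIV - {i}. (if j = p j then 1 else 0) + 0 * G j (p j))) = 0" if "p \<noteq> id"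
        using that by (subst sum.neutral) (simp_all only: 0 mem_Collect_eq mult_zero_right ball_simps simp_thms)
      then show "of_int (sign p) * (\<Sum>i\<in>UNIV. (t * G i (p i)) *
          (\<Prod>j\<in>UNIV - {i}. (if j = p j then 1 else 0) + 0 * G j (p j))) =
          (if p = id then t * (\<Sum>i\<in>UNIV. G i i) else 0)"
        by (auto simp: sum_distrib_left)
    qed
    also have "\<dots> = t * (\<Sum>i\<in>UNIV. G i i)"
      by (subst sum.delta) (auto simp: permutes_id)
    finally show ?thesis .
  qed
  ultimately show ?thesis by simp
qed

text \<open>Both sides are the derivative at \<open>t = 0\<close> of \<open>pf_sum\<close> on the
  frame moved by \<open>id + t A\<close>: the left one by the product rule, the right one by the
  scaling with the determinant.\<close>

lemma pf_sum_derivation: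
  fixes w :: "complex^'n \<Rightarrow> complex^'n \<Rightarrow> real"
  assumes w: "bilinear w"
  shows "(\<Sum>s | s permutes (UNIV :: ('n \<times> bool) set). of_int (sign s) *
      (\<Sum>j\<in>UNIV. (w (A (real_frame (s (j, False)))) (real_frame (s (j, True))) +
          w (real_frame (s (j, False))) (A (real_frame (s (j, True))))) *
        (\<Prod>k\<in>UNIV - {j}. w (real_frame (s (k, False))) (real_frame (s (k, True)))))) =
    tr A * pf_sum w real_frame"
proof -
  let ?e = "real_frame :: 'n \<times> bool \<Rightarrow> _"
  let ?v = "\<lambda>t i. ?e i + t *\<^sub>R A (?e i)"
  let ?W = "\<lambda>t i k. t * (w (A (?e i)) (?e k) + w (?e i) (A (?e k)))"
  have "((\<lambda>t. w (?v t i) (?v t k)) has_derivative (\<lambda>t. ?W t i k)) (at (0::real))" for i k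
  proof -
    have "w (?v t i) (?v t k) = w (?e i) (?e k) + t * (w (A (?e i)) (?e k) + w (?e i) (A (?e k))) +
        t * t * w (A (?e i)) (A (?e k))" for t
      by (simp add: bilinear_ladd[OF w] bilinear_radd[OF w] bilinear_lmul[OF w] bilinear_rmul[OF w] algebra_simps)
    then show ?thesis by (auto intro!: derivative_eq_intros)
  qed
  from has_derivative_pf_sum[of "\<lambda>_. w" ?v ?W 0, OF this]
  have 1: "((\<lambda>t. pf_sum w (?v t)) has_derivative
    (\<lambda>t. \<Sum>s | s permutes UNIV. of_int (sign s) *
      (\<Sum>j\<in>UNIV. ?W t (s (j, False)) (s (j, True)) *
        (\<Prod>k\<in>UNIV - {j}. w (?e (s (k, False))) (?e (s (k, True))))))) (at 0)"
    by simp
  have 2: "pf_sum w (?v t) = det (\<chi> i k. (if i = k then 1 else 0) + t * (A (?e i) \<bullet> ?e k)) * pf_sum w ?e" for t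
    by (subst pf_sum_image[OF w]) (simp add: inner_add_left real_frame_inner)
  have "((\<lambda>t. pf_sum w (?v t)) has_derivative (\<lambda>t. (t * (\<Sum>i\<in>UNIV. A (?e i) \<bullet> ?e i)) * pf_sum w ?e)) (at 0)"
    unfolding 2 by (rule has_derivative_mult_left[OF has_derivative_det_id])
  from fun_cong[OF has_derivative_unique[OF 1 this], of 1] show ?thesis
    by (simp add: tr_def sum_real_frame)
qed

lemma bilinear_kaehler_form: "bilinear (h x) \<Longrightarrow> bilinear (kaehler_form h x)"
  for h :: "complex^'n \<Rightarrow> complex^'n \<Rightarrow> complex^'n \<Rightarrow> real"
  unfolding kaehler_form_def bilinear_def using linear_compose[OF linear_J] by (auto simp: o_def)

lemma omega_power_pf_sum: "omega_power h x = pf_sum (kaehler_form h x) real_frame / 2 ^ CARD('n)"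
  for h :: "complex^'n \<Rightarrow> complex^'n \<Rightarrow> complex^'n \<Rightarrow> real"
  by (simp add: omega_power_def pf_sum_def)

text \<open>Since \<open>\<omega>\<close> is parallel, the derivative of its components along
  \<open>v\<close> lets the endomorphism \<open>christoffel h x v\<close> act on each argument in
  turn; on the top power such an action is multiplication by the trace.\<close>

lemma (in kaehler_chart) has_derivative_omega_power:
  assumes x: "x \<in> S"
  shows "(omega_power h has_derivative (\<lambda>v. div_form x v * omega_power h x)) (at x)"
proof -
  have "((\<lambda>y. kaehler_form h y a b) has_derivative
      (\<lambda>v. kaehler_form h x (christoffel h x v a) b + kaehler_form h x a (christoffel h x v b))) (at x)" for a b
    using differentiable_dd[OF diff_h[OF x], of "J a" b]
    by (simp add: kaehler_form_def metric_compatible[OF x] christoffel_J[OF x])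
  from has_derivative_pf_sum[of "kaehler_form h" "\<lambda>_. real_frame", OF this]
  have "((\<lambda>y. pf_sum (kaehler_form h y) real_frame) has_derivative
      (\<lambda>v. tr (christoffel h x v) * pf_sum (kaehler_form h x) real_frame)) (at x)"
    by (simp add: pf_sum_derivation[OF bilinear_kaehler_form[of h, OF bilinear_h[OF x]]])
  from bounded_linear.has_derivative[OF bounded_linear_mult_left this, of "1 / 2 ^ CARD('n)"]
  show ?thesis by (simp add: omega_power_pf_sum[abs_def] div_form_def)
qed

section \<open>Positivity of the volume density\<close>

lemma J_real_frame: "J (real_frame (a, b)) = (if b then - real_frame (a, False) else real_frame (a, True))"
  by (auto simp: real_frame_def vec_eq_iff axis_def)

text \<open>Each transposition of indices lifts to two transpositions of
  \<open>'n \<times> bool\<close>, so the signs cancel.\<close>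

lemma sign_map_prod_id:
  assumes "p permutes (UNIV :: 'n::finite set)"
  shows "sign (map_prod p (id :: bool \<Rightarrow> bool)) = 1"
  using assms finite[of "UNIV :: 'n set"]
proof (induction p rule: permutes_induct)
  case id
  then show ?case by (simp only: prod.map_id0 sign_id)
next
  case (swap a b p)
  have "map_prod (Transposition.transpose a b \<circ> p) id = Transposition.transpose (a, False) (b, False) \<circ>
      (Transposition.transpose (a, True) (b, True) \<circ> map_prod p (id :: bool \<Rightarrow> bool))"
    by (rule ext) (auto simp: Transposition.transpose_def map_prod_def split: prod.split)
  moreover have "permutation (map_prod p (id :: bool \<Rightarrow> bool))"
    by (rule permutes_imp_permutation[of UNIV])
      (use swap in \<open>auto simp: map_prod_inj_on permutes_inj permutes_surj bij_def map_prod_surj intro!: bij_imp_permutes prod.inj_map\<close>)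
  ultimately have "sign (map_prod (Transposition.transpose a b \<circ> p) (id :: bool \<Rightarrow> bool)) =
      - 1 * (- 1 * sign (map_prod p (id :: bool \<Rightarrow> bool)))"
    using swap.hyps by (simp only: sign_compose permutation_compose permutation_swap_id sign_swap_id prod.inject if_False simp_thms)
  then show ?case using swap.IH by linarith
qed

text \<open>For a permutation that maps pairs \<open>(j, False)\<close>, \<open>(j, True)\<close> to
  pairs, every flipped pair accounts for one transposition. Without flips it acts alike on both
  halves and has sign 1, which starts the induction on the number of flips.\<close>

lemma sign_pair_permutation:
  fixes s :: "'n::finite \<times> bool \<Rightarrow> 'n \<times> bool"
  assumes "s permutes UNIV" "\<And>j. s (j, True) = (fst (s (j, False)), \<not> snd (s (j, False)))"
  shows "sign s = (\<Prod>j\<in>UNIV. if snd (s (j, False)) then - 1 else 1)"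
  using assms
proof (induction "card {j. snd (s (j, False))}" arbitrary: s)
  case 0
  then have F: "\<not> snd (s (j, False))" for j by simp
  define p where "p j = fst (s (j, False))" for j
  have s: "s = map_prod p id"
  proof
    fix x :: "'n \<times> bool"
    obtain j b where x: "x = (j, b)" by (cases x)
    show "s x = map_prod p id x"
      unfolding x using F[of j] 0(3)[of j] by (cases b) (auto simp: p_def prod_eq_iff)
  qed
  have "inj p" using permutes_inj[OF 0(2)] unfolding s by (auto simp: inj_def)
  then have "p permutes UNIV"
    by (intro bij_imp_permutes) (simp_all add: bij_def finite_UNIV_inj_surj)
  then show ?case using F by (simp add: s sign_map_prod_id)
next
  case (Suc d)
  then obtain i where i: "snd (s (i, False))"
    by (metis (no_types, lifting) Collect_empty_eq card.empty nat.distinct(1))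
  define s' where "s' = s \<circ> Transposition.transpose (i, False) (i, True)"
  have s'F: "s' (j, False) = (if j = i then s (i, True) else s (j, False))"
    and s'T: "s' (j, True) = (if j = i then s (i, False) else s (j, True))" for j
    by (auto simp: s'_def)
  have perm: "s' permutes UNIV"
    unfolding s'_def by (intro permutes_compose Suc.prems permutes_swap_id) auto
  have pair: "s' (j, True) = (fst (s' (j, False)), \<not> snd (s' (j, False)))" for j
    using Suc.prems(2)[of j] Suc.prems(2)[of i] by (auto simp: s'F s'T)
  have "{j. snd (s' (j, False))} = {j. snd (s (j, False))} - {i}"
    using i Suc.prems(2)[of i] by (auto simp: s'F)
  then have "d = card {j. snd (s' (j, False))}"
    using Suc.hyps(2) i by (simp add: card_Diff_singleton)
  from Suc.hyps(1)[OF this perm pair]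
  have IH: "sign s' = (\<Prod>j\<in>UNIV. if snd (s' (j, False)) then - 1 else 1)" .
  have "sign s' = - sign s"
    unfolding s'_def using permutes_imp_permutation[OF _ Suc.prems(1)]
    by (simp add: sign_compose permutation_swap_id sign_swap_id)
  moreover have "(\<Prod>j\<in>UNIV. if snd (s' (j, False)) then - 1 else 1) =
      - (\<Prod>j\<in>UNIV. if snd (s (j, False)) then - 1 else (1::int))"
  proof -
    have "(\<Prod>j\<in>UNIV - {i}. if snd (s' (j, False)) then - 1 else (1::int)) =
        (\<Prod>j\<in>UNIV - {i}. if snd (s (j, False)) then - 1 else 1)"
      by (rule prod.cong) (auto simp: s'F)
    then show ?thesis
      using i Suc.prems(2)[of i]
        prod.remove[of UNIV i "\<lambda>j. if snd (s' (j, False)) then - 1 else (1::int)"]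
        prod.remove[of UNIV i "\<lambda>j. if snd (s (j, False)) then - 1 else (1::int)"] by (simp add: s'F)
  qed
  ultimately show ?case using IH by simp
qed

text \<open>Every summand is 0 or 1: the product vanishes unless pairs go to pairs, and then it
  equals the sign of the permutation. The identity contributes 1.\<close>

lemma pf_sum_standard_pos:
  "pf_sum (\<lambda>u v. J u \<bullet> v) (real_frame :: 'n::finite \<times> bool \<Rightarrow> complex^'n) > 0"
proof -
  let ?w = "\<lambda>k l. J (real_frame k :: complex^'n) \<bullet> real_frame l"
  have w: "?w k l = (if l = (fst k, \<not> snd k) then if snd k then - 1 else 1 else 0)" for k l
    by (cases k) (auto simp: J_real_frame real_frame_inner)
  let ?t = "\<lambda>s. real_of_int (sign s) * (\<Prod>j\<in>UNIV. ?w (s (j, False)) (s (j, True)))"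
  have t: "?t s = (if \<forall>j. s (j, True) = (fst (s (j, False)), \<not> snd (s (j, False))) then 1 else 0)"
    if perm: "s permutes UNIV" for s :: "'n \<times> bool \<Rightarrow> 'n \<times> bool"
  proof (cases "\<forall>j. s (j, True) = (fst (s (j, False)), \<not> snd (s (j, False)))")
    case True
    have "(\<Prod>j\<in>UNIV. ?w (s (j, False)) (s (j, True))) =
        real_of_int (\<Prod>j\<in>UNIV. if snd (s (j, False)) then - 1 else 1)"
      unfolding of_int_prod by (rule prod.cong) (use True in \<open>auto simp: w\<close>)
    also have "\<dots> = real_of_int (sign s)"
      using sign_pair_permutation[OF perm] True by simp
    finally show ?thesis using True by (simp flip: of_int_mult)
  next
    case False
    then obtain j where "?w (s (j, False)) (s (j, True)) = 0" by (auto simp: w)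
    then have 0: "(\<Prod>j\<in>UNIV. ?w (s (j, False)) (s (j, True))) = 0" by (intro prod_zero) auto
    show ?thesis unfolding if_not_P[OF False] 0 by simp
  qed
  have "0 < (\<Sum>s | s permutes (UNIV :: ('n \<times> bool) set). ?t s)"
  proof (rule sum_pos2[of _ id])
    have "?t id = 1" by (subst t) (simp_all add: permutes_id)
    then show "?t id > 0" by linarith
    show "?t s \<ge> 0" if "s \<in> {s. s permutes UNIV}" for s :: "'n \<times> bool \<Rightarrow> 'n \<times> bool"
      by (subst t) (use that in auto)
  qed (auto simp: permutes_id)
  then show ?thesis by (simp add: pf_sum_def)
qed

text \<open>Gram-Schmidt, one vector at a time. Fewer than \<open>CARD('n)\<close> vectors together
  with their rotations span less than the real dimension \<open>2 * CARD('n)\<close>, so some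
  nonzero vector is orthogonal to all of them; \<open>T\<close> converts
  \<open>b\<close>-orthogonality into Euclidean orthogonality.\<close>

lemma unitary_frame:
  fixes b :: "complex^'n \<Rightarrow> complex^'n \<Rightarrow> real"
  assumes b: "bilinear b" and sym: "\<And>u v. b u v = b v u" and pos: "\<And>u. u \<noteq> 0 \<Longrightarrow> b u u > 0"
    and inv: "\<And>u v. b (J u) (J v) = b u v"
  shows "\<exists>u :: 'n \<Rightarrow> complex^'n. \<forall>j\<in>I. \<forall>k\<in>I. b (u j) (u k) = (if j = k then 1 else 0) \<and> b (J (u j)) (u k) = 0"
proof -
  have "finite I" by simp
  then show ?thesis
  proof induction
    case (insert i I)
    then obtain u :: "'n \<Rightarrow> complex^'n" where
      u: "\<forall>j\<in>I. \<forall>k\<in>I. b (u j) (u k) = (if j = k then 1 else 0) \<and> b (J (u j)) (u k) = 0" by auto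
    have lin: "linear (b z)" for z using b by (simp add: bilinear_def)
    define T where "T z = (\<Sum>e\<in>Basis. b z e *\<^sub>R e)" for z
    have T: "T z \<bullet> v = b z v" for z v unfolding T_def by (rule inner_dual_vector[OF lin])
    let ?V = "(\<lambda>j. T (u j)) ` I \<union> (\<lambda>j. T (J (u j))) ` I"
    have "dim ?V \<le> card ?V" by (rule dim_le_card') (use insert in auto)
    also have "\<dots> \<le> card ((\<lambda>j. T (u j)) ` I) + card ((\<lambda>j. T (J (u j))) ` I)" by (rule card_Un_le)
    also have "\<dots> \<le> card I + card I" by (intro add_mono card_image_le insert)
    also have "\<dots> < DIM(complex^'n)"
    proof -
      have "card I < CARD('n)" using insert by (intro psubset_card_mono) auto
      then show ?thesis by simp
    qed
    finally have "dim ?V < DIM(complex^'n)" .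
    then obtain z where z: "z \<noteq> 0" "\<And>y. y \<in> span ?V \<Longrightarrow> orthogonal z y"
      using orthogonal_to_subspace_exists by blast
    have z0: "b (u j) z = 0" "b (J (u j)) z = 0" if "j \<in> I" for j
    proof -
      have "orthogonal z (T (u j))" "orthogonal z (T (J (u j)))" using that by (auto intro!: z(2) span_base)
      then show "b (u j) z = 0" "b (J (u j)) z = 0" by (simp_all add: orthogonal_def T inner_commute[of z])
    qed
    define y where "y = (1 / sqrt (b z z)) *\<^sub>R z"
    have y0: "b (u j) y = 0" "b (J (u j)) y = 0" "b y (u j) = 0" "b (J y) (u j) = 0" if "j \<in> I" for j
    proof -
      show *: "b (u j) y = 0" "b (J (u j)) y = 0" using z0[OF that] by (simp_all add: y_def bilinear_rmul[OF b])
      show "b y (u j) = 0" using * sym by simp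
      have "b (J y) (u j) = b (J (J y)) (J (u j))" by (simp only: inv)
      also have "\<dots> = - b y (J (u j))" by (simp add: bilinear_lneg[OF b])
      finally show "b (J y) (u j) = 0" using * sym by simp
    qed
    have "b (J y) y = b (J (J y)) (J y)" by (simp only: inv)
    also have "\<dots> = - b (J y) y" using sym by (simp add: bilinear_lneg[OF b])
    finally have Jy: "b (J y) y = 0" by simp
    have "b y y = 1" using pos[OF z(1)]
      by (simp add: y_def bilinear_rmul[OF b] bilinear_lmul[OF b] flip: power2_eq_square)
    then show ?case
      using u y0 Jy insert by (intro exI[of _ "u(i := y)"]) auto
  qed auto
qed

text \<open>On a unitary frame and its rotation the form takes the standard values. The determinant
  that leads from there to \<open>real_frame\<close> has an undetermined sign, so this argument
  yields nonvanishing only.\<close>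

lemma pf_sum_hermitian_nonzero:
  fixes b :: "complex^'n \<Rightarrow> complex^'n \<Rightarrow> real"
  assumes b: "bilinear b" and sym: "\<And>u v. b u v = b v u" and pos: "\<And>u. u \<noteq> 0 \<Longrightarrow> b u u > 0"
    and inv: "\<And>u v. b (J u) (J v) = b u v"
  shows "pf_sum (\<lambda>u v. b (J u) v) real_frame \<noteq> 0"
proof -
  have w: "bilinear (\<lambda>u v. b (J u) v)"
    using bilinear_kaehler_form[of "\<lambda>_. b"] b by (simp add: kaehler_form_def[abs_def])
  obtain u :: "'n \<Rightarrow> complex^'n" where
    u: "\<And>j k. b (u j) (u k) = (if j = k then 1 else 0)" "\<And>j k. b (J (u j)) (u k) = 0"
    using unitary_frame[OF b sym pos inv, of UNIV] by blast
  have u2: "b (u j) (J (u k)) = 0" for j k using u sym by simp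
  define v where "v k = (if snd k then J (u (fst k)) else u (fst k))" for k
  have "b (J (v k)) (v l) = J (real_frame k) \<bullet> (real_frame l :: complex^'n)" for k l
    by (cases k; cases l)
      (auto simp: v_def u u2 inv J_real_frame real_frame_inner bilinear_lneg[OF b])
  then have "pf_sum (\<lambda>u v. b (J u) v) v = pf_sum (\<lambda>u v. J u \<bullet> v) (real_frame :: 'n \<times> bool \<Rightarrow> complex^'n)"
    by (simp add: pf_sum_def)
  then have "pf_sum (\<lambda>u v. b (J u) v) v \<noteq> 0" using pf_sum_standard_pos[where 'n='n] by simp
  then show ?thesis using pf_sum_image[OF w, of v] by auto
qed

lemma inner_J_J: "J u \<bullet> J v = u \<bullet> (v :: complex^'n)"
  by (simp add: inner_vec_def inner_complex_def add.commute)

text \<open>Nonvanishing along the segment from the standard form to \<open>b\<close>.\<close>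

lemma pf_sum_hermitian_pos:
  fixes b :: "complex^'n \<Rightarrow> complex^'n \<Rightarrow> real"
  assumes b: "bilinear b" and sym: "\<And>u v. b u v = b v u" and pos: "\<And>u. u \<noteq> 0 \<Longrightarrow> b u u > 0"
    and inv: "\<And>u v. b (J u) (J v) = b u v"
  shows "pf_sum (\<lambda>u v. b (J u) v) real_frame > 0"
proof (rule ccontr)
  define P where "P t = pf_sum (\<lambda>u v. (1 - t) * (J u \<bullet> v) + t * b (J u) v) (real_frame :: 'n \<times> bool \<Rightarrow> complex^'n)" for t :: real
  assume "\<not> ?thesis"
  then have "P 1 \<le> 0" "0 \<le> P 0" using pf_sum_standard_pos[where 'n='n] by (simp_all add: P_def)
  moreover have "continuous_on {0..1} P"
    unfolding P_def pf_sum_def by (intro continuous_intros)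
  ultimately obtain t where t: "0 \<le> t" "t \<le> 1" "P t = 0"
    using IVT2'[of P 1 0 0] by auto
  define c where "c u v = (1 - t) * (u \<bullet> v) + t * b u v" for u v :: "complex^'n"
  have "pf_sum (\<lambda>u v. c (J u) v) real_frame \<noteq> 0"
  proof (rule pf_sum_hermitian_nonzero)
    show "bilinear c"
      unfolding c_def bilinear_def
      by (auto simp: bilinear_ladd[OF b] bilinear_radd[OF b] bilinear_lmul[OF b] bilinear_rmul[OF b]
          algebra_simps inner_add_left inner_add_right intro!: linearI)
    show "c u v = c v u" for u v using sym by (simp add: c_def inner_commute)
    show "c (J u) (J v) = c u v" for u v by (simp only: c_def inv inner_J_J)
    show "c u u > 0" if "u \<noteq> 0" for u
    proof (cases "t = 0")
      case False
      then have "t * b u u > 0" using t pos[OF that] by simp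
      moreover have "(1 - t) * (u \<bullet> u) \<ge> 0" using t by simp
      ultimately show ?thesis unfolding c_def by linarith
    qed (use that in \<open>simp add: c_def\<close>)
  qed
  then show False using t(3) by (simp add: P_def c_def)
qed

lemma (in kaehler_chart) omega_power_pos: "x \<in> S \<Longrightarrow> omega_power h x > 0"
  using pf_sum_hermitian_pos[OF bilinear_h sym pos J_invariant]
  by (simp add: omega_power_pf_sum kaehler_form_def[abs_def])

lemma (in kaehler_chart) smooth_omega_power: "smooth_on S (omega_power h)"
  unfolding omega_power_def[abs_def] kaehler_form_def
  by (intro smooth_on_bilinear[OF open_S bounded_bilinear_mult] smooth_on_const smooth_on_sum[OF open_S]
      smooth_on_prod[OF open_S] smooth_h)

text \<open>The determinant is nonnegative as both densities are positive.\<close>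

lemma omega_power_transform:
  fixes h k :: "complex^'n \<Rightarrow> complex^'n \<Rightarrow> complex^'n \<Rightarrow> real"
  assumes "bilinear (k y)" "\<And>u. L (J u) = J (L u)" "\<And>u v. k y (L u) (L v) = h x u v"
    and "omega_power h x > 0" "omega_power k y > 0"
  shows "omega_power h x = \<bar>det (\<chi> i j. L (real_frame i) \<bullet> real_frame j)\<bar> * omega_power k y"
proof -
  have "pf_sum (kaehler_form h x) real_frame = pf_sum (kaehler_form k y) (\<lambda>i. L (real_frame i))"
    using assms(3)[of "J _"] by (simp add: pf_sum_def kaehler_form_def assms(2))
  also have "\<dots> = det (\<chi> i j. L (real_frame i) \<bullet> real_frame j) * pf_sum (kaehler_form k y) real_frame"
    by (rule pf_sum_image[OF bilinear_kaehler_form[of k, OF assms(1)]])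
  finally have "omega_power h x = det (\<chi> i j. L (real_frame i) \<bullet> real_frame j) * omega_power k y"
    by (simp add: omega_power_pf_sum)
  with assms(4,5) show ?thesis by (smt (verit) mult_neg_pos)
qed

section \<open>Integration of compactly supported functions\<close>

text \<open>Only points of \<open>S\<close> are constrained: coordinate expressions take arbitrary
  values off the range of a chart, which is why integrals pass through
  \<open>extend0\<close>.\<close>

definition supported_in :: "'a::topological_space set \<Rightarrow> 'a set \<Rightarrow> ('a \<Rightarrow> 'b::zero) \<Rightarrow> bool" where
  "supported_in S C u \<longleftrightarrow> compact C \<and> C \<subseteq> S \<and> (\<forall>x\<in>S - C. u x = 0)"

definition extend0 :: "'a set \<Rightarrow> ('a \<Rightarrow> 'b::zero) \<Rightarrow> 'a \<Rightarrow> 'b" where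
  "extend0 S u x = (if x \<in> S then u x else 0)"

text \<open>\<open>S\<close> and the complement of \<open>C\<close> form an open cover, and the
  extension is continuous on each of them.\<close>

lemma continuous_extend0:
  fixes u :: "'a::t2_space \<Rightarrow> 'b::real_normed_vector"
  assumes "open S" "continuous_on S u" "supported_in S C u"
  shows "continuous_on UNIV (extend0 S u)"
proof -
  have "continuous_on (S \<union> - C) (extend0 S u)"
  proof (rule continuous_on_open_Un)
    show "open (- C)" using assms(3) by (auto simp: supported_in_def compact_imp_closed open_Compl)
    show "continuous_on S (extend0 S u)"
      using assms(2) by (rule continuous_on_eq) (simp add: extend0_def)
    have "continuous_on (- C) (\<lambda>_. 0 :: 'b)" by simp
    then show "continuous_on (- C) (extend0 S u)"
      by (rule continuous_on_eq) (use assms(3) in \<open>auto simp: extend0_def supported_in_def\<close>)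
  qed (rule assms)
  moreover have "S \<union> - C = UNIV" using assms(3) by (auto simp: supported_in_def)
  ultimately show ?thesis by simp
qed

lemma extend0_outside: "supported_in S C u \<Longrightarrow> x \<notin> C \<Longrightarrow> extend0 S u x = 0"
  by (auto simp: supported_in_def extend0_def)

lemma integrable_supported:
  fixes u :: "'a::euclidean_space \<Rightarrow> 'b::banach"
  assumes "open S" "continuous_on S u" "supported_in S C u"
  shows "u integrable_on S"
proof -
  have "bounded C" using assms(3) by (simp add: supported_in_def compact_imp_bounded)
  then obtain a where a: "C \<subseteq> cbox (-a) a" using bounded_subset_cbox_symmetric by blast
  have "extend0 S u integrable_on cbox (-a) a"
    by (intro integrable_continuous continuous_on_subset[OF continuous_extend0[OF assms]]) auto
  then have "extend0 S u integrable_on UNIV"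
    by (rule integrable_on_superset) (use a extend0_outside[OF assms(3)] in auto)
  then show ?thesis
    by (simp add: extend0_def[abs_def] Henstock_Kurzweil_Integration.integrable_restrict_UNIV)
qed

lemma lborel_integrable_supported:
  fixes u :: "'a::euclidean_space \<Rightarrow> real"
  assumes "open S" "continuous_on S u" "supported_in S C u"
  shows "integrable lborel (extend0 S u)"
proof -
  have "integrable lborel (\<lambda>x. indicator C x *\<^sub>R extend0 S u x)"
    by (intro borel_integrable_compact continuous_on_subset[OF continuous_extend0[OF assms]])
      (use assms(3) in \<open>auto simp: supported_in_def\<close>)
  moreover have "(\<lambda>x. indicator C x *\<^sub>R extend0 S u x) = extend0 S u"
    using extend0_outside[OF assms(3)] by (auto simp: fun_eq_iff indicator_def)
  ultimately show ?thesis by simp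
qed

lemma integral_eq_lborel:
  fixes u :: "'a::euclidean_space \<Rightarrow> real"
  assumes "integrable lborel (extend0 S u)"
  shows "integral S u = integral\<^sup>L lborel (extend0 S u)" "u absolutely_integrable_on S"
proof -
  have "integral S u = integral UNIV (extend0 S u)"
    by (simp add: extend0_def[abs_def] Henstock_Kurzweil_Integration.integral_restrict_UNIV)
  then show "integral S u = integral\<^sup>L lborel (extend0 S u)"
    by (simp add: integral_unique[OF has_integral_integral_lborel[OF assms]])
  have "integrable lebesgue (extend0 S u)"
    by (subst integrable_completion) (simp_all add: assms borel_measurable_integrable[OF assms, simplified])
  then have "(extend0 S u) absolutely_integrable_on UNIV"
    by (simp add: set_integrable_def)
  then show "u absolutely_integrable_on S"
    by (simp add: extend0_def[abs_def] absolutely_integrable_restrict_UNIV)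
qed

lemma integral_supported_nonneg_eq_0:
  fixes u :: "'a::euclidean_space \<Rightarrow> real"
  assumes "open S" "continuous_on S u" "supported_in S C u" "\<And>x. x \<in> S \<Longrightarrow> u x \<ge> 0"
    and "integral S u = 0" "x \<in> S"
  shows "u x = 0"
proof -
  have "bounded (insert x C)" using assms(3) by (simp add: supported_in_def compact_imp_bounded)
  then obtain a where a: "insert x C \<subseteq> box (-a) a" using bounded_subset_box_symmetric by blast
  have "integral UNIV (extend0 S u) = 0"
    using assms(5) by (simp add: extend0_def[abs_def] Henstock_Kurzweil_Integration.integral_restrict_UNIV)
  moreover have "integral UNIV (extend0 S u) = integral UNIV (\<lambda>y. if y \<in> cbox (-a) a then extend0 S u y else 0)"
  proof (rule arg_cong[of _ _ "integral UNIV"], rule ext)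
    fix y
    have "C \<subseteq> cbox (-a) a" using a box_subset_cbox by blast
    then show "extend0 S u y = (if y \<in> cbox (-a) a then extend0 S u y else 0)"
      using extend0_outside[OF assms(3), of y] by auto
  qed
  ultimately have "integral (cbox (-a) a) (extend0 S u) = 0"
    by (simp add: Henstock_Kurzweil_Integration.integral_restrict_UNIV)
  moreover have cont: "continuous_on (cbox (-a) a) (extend0 S u)"
    by (rule continuous_on_subset[OF continuous_extend0[OF assms(1-3)]]) simp
  ultimately have "(extend0 S u has_integral 0) (cbox (-a) a)"
    using integrable_integral[OF integrable_continuous[OF cont]] by simp
  from has_integral_0_cbox_imp_0[OF cont _ this] have "extend0 S u x = 0"
  proof
    show "extend0 S u y \<ge> 0" for y using assms(4) by (simp add: extend0_def)
    show "box (-a) a \<noteq> {}" using a by blast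
    show "x \<in> cbox (-a) a" using a box_subset_cbox by blast
  qed (rule refl)
  then show ?thesis using assms(6) by (simp add: extend0_def)
qed

text \<open>The integral of \<open>u (x + t v)\<close> does not depend on \<open>t\<close>; differentiate at \<open>t = 0\<close>.\<close>

lemma integral_directional_derivative:
  fixes u :: "'a::euclidean_space \<Rightarrow> real"
  assumes S: "open S" and C1: "Ck_on (Suc 0) S u" and supp: "supported_in S C u"
  shows "integral S (\<lambda>x. dd u x v) = 0"
proof -
  define w where "w = extend0 S u"
  have C: "compact C" "C \<subseteq> S" using supp by (auto simp: supported_in_def)
  have openC: "open (- C)" using C by (simp add: compact_imp_closed open_Compl)
  have contu: "continuous_on S u" using Ck_on_SucD[OF C1] by simp
  have w0: "x \<notin> C \<Longrightarrow> w x = 0" for x unfolding w_def by (rule extend0_outside[OF supp])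
  have der0: "(w has_derivative (\<lambda>_. 0)) (at x)" if "x \<notin> C" for x
    by (rule has_derivative_transform_within_open[OF has_derivative_const openC]) (use that w0 in auto)
  have der1: "(w has_derivative dd u x) (at x)" if "x \<in> S" for x
    by (rule has_derivative_transform_within_open[OF differentiable_dd S that])
      (use C1 that in \<open>auto simp: w_def extend0_def\<close>)
  have suppd: "supported_in S C (\<lambda>x. dd u x v)"
    using has_derivative_unique[OF der1 der0] supp unfolding supported_in_def by (metis DiffE)
  define d where "d = extend0 S (\<lambda>x. dd u x v)"
  have contd: "continuous_on UNIV d"
    unfolding d_def by (rule continuous_extend0[OF S _ suppd]) (use C1 in auto)
  have dirder: "((\<lambda>t. w (x + t *\<^sub>R v)) has_real_derivative d (x + t *\<^sub>R v)) (at t)" for x t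
  proof -
    let ?y = "x + t *\<^sub>R v"
    obtain w' where w': "(w has_derivative w') (at ?y)" "w' v = d ?y"
    proof (cases "?y \<in> S")
      case True
      then show ?thesis by (intro that[OF der1]) (simp_all add: d_def extend0_def)
    next
      case False then show ?thesis using der0[of ?y] that C by (auto simp: d_def extend0_def)
    qed
    have "((\<lambda>t. w (x + t *\<^sub>R v)) has_derivative (\<lambda>k. w' (k *\<^sub>R v))) (at t)"
      by (rule has_derivative_compose[of "\<lambda>t. x + t *\<^sub>R v" _ _ _ w, OF _ w'(1)]) (auto intro!: derivative_eq_intros)
    then show ?thesis
      using linear_cmul[OF has_derivative_linear[OF w'(1)]] w'(2)
      by (simp add: has_field_derivative_def mult_commute_abs)
  qed
  have intw: "integrable lborel w" unfolding w_def by (rule lborel_integrable_supported[OF S contu supp])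
  \<comment> \<open>One box is chosen that contains the supports of all translates with
    \<open>t\<close> in \<open>{-1..1}\<close>.\<close>
  have "compact ((\<lambda>(x, t). x - t *\<^sub>R v) ` (C \<times> {-1..1::real}))"
    by (intro compact_continuous_image compact_Times C) (auto intro!: continuous_intros simp: case_prod_unfold)
  then obtain a where a: "(\<lambda>(x, t). x - t *\<^sub>R v) ` (C \<times> {-1..1::real}) \<subseteq> cbox (-a) a"
    using bounded_subset_cbox_symmetric compact_imp_bounded by blast
  have out: "y + t *\<^sub>R v \<notin> C" if "t \<in> {-1..1}" "y \<notin> cbox (-a) a" for t y
  proof
    assume "y + t *\<^sub>R v \<in> C"
    then have "(\<lambda>(x, t). x - t *\<^sub>R v) (y + t *\<^sub>R v, t) \<in> cbox (-a) a" using a that(1) by blast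
    then show False using that(2) by simp
  qed
  have const: "integral (cbox (-a) a) (\<lambda>x. w (x + t *\<^sub>R v)) = integral\<^sup>L lborel w" if "t \<in> {-1..1}" for t
  proof -
    have distr: "distr lborel borel (\<lambda>x. x + t *\<^sub>R v) = (lborel :: 'a measure)"
      using lborel_distr_plus[of "t *\<^sub>R v"] by (simp add: add.commute[of "t *\<^sub>R v"] cong: distr_cong)
    have int: "integrable lborel (\<lambda>x. w (x + t *\<^sub>R v))"
      using intw integrable_distr[of "\<lambda>x. x + t *\<^sub>R v" lborel borel w] distr by simp
    have "integral (cbox (-a) a) (\<lambda>x. w (x + t *\<^sub>R v)) =
        integral UNIV (\<lambda>x. if x \<in> cbox (-a) a then w (x + t *\<^sub>R v) else 0)"
      by (simp add: Henstock_Kurzweil_Integration.integral_restrict_UNIV)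
    also have "(\<lambda>x. if x \<in> cbox (-a) a then w (x + t *\<^sub>R v) else 0) = (\<lambda>x. w (x + t *\<^sub>R v))"
      using out[OF that] w0 by auto
    also have "integral UNIV (\<lambda>x. w (x + t *\<^sub>R v)) = integral\<^sup>L lborel (\<lambda>x. w (x + t *\<^sub>R v))"
      by (rule integral_unique[OF has_integral_integral_lborel[OF int]])
    also have "\<dots> = integral\<^sup>L lborel w"
      using integral_distr[of "\<lambda>x. x + t *\<^sub>R v" lborel borel w] borel_measurable_integrable[OF intw] distr by simp
    finally show ?thesis .
  qed
  have contw: "continuous_on UNIV w" unfolding w_def by (rule continuous_extend0[OF S contu supp])
  \<comment> \<open>Differentiation under the integral sign; by \<open>const\<close> the same
    function is constant on \<open>{-1..1}\<close>, so the integral of \<open>d\<close> is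
    zero.\<close>
  have "((\<lambda>t. integral (cbox (-a) a) (\<lambda>x. w (x + t *\<^sub>R v))) has_real_derivative
      integral (cbox (-a) a) (\<lambda>x. d (x + 0 *\<^sub>R v))) (at 0 within {-1..1})"
  proof (rule leibniz_rule_field_derivative)
    show "((\<lambda>t. w (x + t *\<^sub>R v)) has_real_derivative d (x + t *\<^sub>R v)) (at t within {-1..1})" for x t
      by (rule has_field_derivative_at_within[OF dirder])
    show "(\<lambda>x. w (x + t *\<^sub>R v)) integrable_on cbox (-a) a" for t
      by (intro integrable_continuous continuous_on_compose2[OF contw] continuous_intros) auto
    show "continuous_on ({-1..1} \<times> cbox (-a) a) (\<lambda>(t, x). d (x + t *\<^sub>R v))"
      unfolding case_prod_unfold
      by (intro continuous_on_compose2[OF contd] continuous_intros) auto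
  qed auto
  moreover have "((\<lambda>t. integral (cbox (-a) a) (\<lambda>x. w (x + t *\<^sub>R v))) has_real_derivative 0) (at 0 within {-1..1})"
    by (rule has_field_derivative_transform_within[where f = "\<lambda>_. integral\<^sup>L lborel w" and d = 1])
      (use const in auto)
  moreover have "at (0::real) within {-1..1} = at 0"
    by (rule at_within_interior) simp
  ultimately have "integral (cbox (-a) a) d = 0"
    using DERIV_unique by fastforce
  moreover have "integral S (\<lambda>x. dd u x v) = integral UNIV (\<lambda>x. if x \<in> cbox (-a) a then d x else 0)"
  proof -
    have "(\<lambda>x. if x \<in> cbox (-a) a then d x else 0) = d"
      using out[of 0] extend0_outside[OF suppd] by (auto simp: d_def)
    then show ?thesis
      by (simp add: d_def extend0_def[abs_def] Henstock_Kurzweil_Integration.integral_restrict_UNIV)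
  qed
  ultimately show ?thesis by (simp add: Henstock_Kurzweil_Integration.integral_restrict_UNIV)
qed

text \<open>Conjugation by \<open>\<beta>\<close> preserves the sign of a permutation. This connects
  Jacobians indexed by \<open>'n \<times> bool\<close>, as \<open>real_frame\<close> is, with those
  indexed by \<open>'n bit0\<close>.\<close>

lemma det_reindex:
  fixes M :: "'j::finite \<Rightarrow> 'j \<Rightarrow> real" and \<beta> :: "'i::finite \<Rightarrow> 'j"
  assumes "bij \<beta>"
  shows "det (\<chi> i k. M (\<beta> i) (\<beta> k)) = det (\<chi> i k. M i k)"
proof -
  let ?\<gamma> = "inv \<beta>"
  have inv: "\<And>x. ?\<gamma> (\<beta> x) = x" "\<And>y. \<beta> (?\<gamma> y) = y"
    using assms by (simp_all add: bij_is_inj bij_is_surj surj_f_inv_f)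
  define c where "c p = \<beta> \<circ> p \<circ> ?\<gamma>" for p
  have c: "c p permutes UNIV" "sign (c p) = sign p" if p: "p permutes UNIV" for p
  proof -
    have "bij_betw \<beta> UNIV UNIV" using assms by simp
    interpret permutes_bij_finite p UNIV UNIV \<beta> ?\<gamma> "c p"
      by unfold_locales (use p inv assms in \<open>auto simp: c_def fun_eq_iff intro!: eq_reflection\<close>)
    show "c p permutes UNIV" by (rule permutes_p')
    show "sign (c p) = sign p" by (rule sign_p')
  qed
  have c': "?\<gamma> \<circ> q \<circ> \<beta> permutes UNIV" if "q permutes UNIV" for q
    using permutes_bij[OF that] assms
    by (intro bij_imp_permutes) (auto intro!: bij_comp bij_imp_bij_inv)
  show ?thesis
    unfolding det_def
  proof (rule sum.reindex_bij_witness[of _ "\<lambda>q. ?\<gamma> \<circ> q \<circ> \<beta>" c])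
    fix p :: "'i \<Rightarrow> 'i" assume "p \<in> {p. p permutes UNIV}"
    then have p: "p permutes UNIV" by simp
    have "(\<Prod>i\<in>UNIV. M i (c p i)) = (\<Prod>i\<in>UNIV. M (\<beta> i) (c p (\<beta> i)))"
      by (rule prod.reindex_bij_betw[symmetric]) (use assms in simp)
    then show "of_int (sign (c p)) * (\<Prod>i\<in>UNIV. (\<chi> i k. M i k) $ i $ c p i) =
        of_int (sign p) * (\<Prod>i\<in>UNIV. (\<chi> i k. M (\<beta> i) (\<beta> k)) $ i $ p i)"
      by (simp add: c(2)[OF p]) (simp add: c_def inv)
    show "c p \<in> {p. p permutes UNIV}" using c(1)[OF p] by simp
  qed (use c' in \<open>auto simp: c_def inv fun_eq_iff\<close>)
qed

text \<open>The vector-valued theorem is applied to \<open>f\<close> times the unit vector of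
  \<open>real^1\<close>.\<close>

lemma integral_change_of_variables_scalar:
  fixes f :: "real^'m::{finite,wellorder} \<Rightarrow> real" and g :: "real^'m::_ \<Rightarrow> real^'m::_"
  assumes S: "S \<in> sets lebesgue"
    and der: "\<And>x. x \<in> S \<Longrightarrow> (g has_derivative g' x) (at x within S)"
    and inj: "inj_on g S" and f: "f absolutely_integrable_on (g ` S)"
    and fg: "(\<lambda>x. \<bar>det (matrix (g' x))\<bar> * f (g x)) absolutely_integrable_on S"
  shows "integral (g ` S) f = integral S (\<lambda>x. \<bar>det (matrix (g' x))\<bar> * f (g x))"
proof -
  let ?F = "\<lambda>y. f y *\<^sub>R (axis 1 1 :: real^1)"
  have bl: "bounded_linear (\<lambda>r. r *\<^sub>R (axis 1 1 :: real^1))" by (rule bounded_linear_scaleR_left)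
  have "?F absolutely_integrable_on (g ` S)"
    using absolutely_integrable_linear[OF f bl] by (simp add: o_def)
  then have "integral (g ` S) ?F = integral S (\<lambda>x. \<bar>det (matrix (g' x))\<bar> *\<^sub>R ?F (g x))"
    by (intro integral_change_of_variables S der inj) auto
  moreover have "integral (g ` S) ?F = integral (g ` S) f *\<^sub>R axis 1 1"
    using integral_linear[OF set_lebesgue_integral_eq_integral(1)[OF f] bl] by (simp add: o_def)
  moreover have "integral S (\<lambda>x. \<bar>det (matrix (g' x))\<bar> *\<^sub>R ?F (g x)) =
      integral S (\<lambda>x. \<bar>det (matrix (g' x))\<bar> * f (g x)) *\<^sub>R axis 1 1"
    using integral_linear[OF set_lebesgue_integral_eq_integral(1)[OF fg] bl] by (simp add: o_def)
  ultimately show ?thesis by (simp add: vec_eq_iff)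
qed

lemma real_axis_range: "inj (\<lambda>i. axis i 1 :: real^'m)" "range (\<lambda>i. axis i 1 :: real^'m) = Basis"
  by (auto simp: inj_def axis_eq_axis Basis_vec_def)

text \<open>The library's change of variables theorem needs a well-ordered index type, so it is
  transported from \<open>real ^ ('n bit0)\<close>.\<close>

lemma integral_change_of_variables_complex:
  fixes u :: "complex^'n \<Rightarrow> real" and \<tau> :: "complex^'n \<Rightarrow> complex^'n"
  assumes S: "open S" and T: "open T" and inj: "inj_on \<tau> S" and im: "\<tau> ` S = T"
    and der: "\<And>x. x \<in> S \<Longrightarrow> (\<tau> has_derivative \<tau>' x) (at x)"
    and D: "\<And>x. x \<in> S \<Longrightarrow> D x = \<bar>det (\<chi> i j. \<tau>' x (real_frame i) \<bullet> real_frame j)\<bar>"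
    and u: "continuous_on T u" "supported_in T C u"
    and Du: "continuous_on S (\<lambda>x. D x * u (\<tau> x))" "supported_in S C' (\<lambda>x. D x * u (\<tau> x))"
  shows "integral T u = integral S (\<lambda>x. D x * u (\<tau> x))"
proof -
  have "card (UNIV :: 'n bit0 set) = card (UNIV :: ('n \<times> bool) set)"
    by (simp add: card_bit0)
  then obtain \<beta> :: "'n bit0 \<Rightarrow> 'n \<times> bool" where \<beta>: "bij \<beta>"
    using finite_same_card_bij[of "UNIV :: 'n bit0 set" "UNIV :: ('n \<times> bool) set"] by auto
  \<comment> \<open>\<open>\<Lambda>\<close> carries the standard basis to the real frame, and
    \<open>\<Lambda>'\<close> is its inverse.\<close>
  define \<Lambda> where "\<Lambda> y = (\<Sum>i\<in>UNIV. (y $ i) *\<^sub>R real_frame (\<beta> i))" for y :: "real^('n bit0)"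
  define \<Lambda>' where "\<Lambda>' x = (\<chi> i. x \<bullet> real_frame (\<beta> i))" for x :: "complex^'n"
  have \<beta>_inj: "\<beta> i = \<beta> j \<longleftrightarrow> i = j" for i j using \<beta> by (simp add: bij_is_inj inj_eq)
  have \<Lambda>_inner: "\<Lambda> y \<bullet> real_frame (\<beta> i) = y $ i" for y i
    by (simp add: \<Lambda>_def inner_sum_left real_frame_inner \<beta>_inj if_distrib cong: if_cong)
  have \<Lambda>'\<Lambda>: "\<Lambda>' (\<Lambda> y) = y" for y by (simp add: \<Lambda>'_def \<Lambda>_inner)
  have \<Lambda>\<Lambda>': "\<Lambda> (\<Lambda>' x) = x" for x
  proof -
    have "\<Lambda> (\<Lambda>' x) = (\<Sum>k\<in>UNIV. (x \<bullet> real_frame k) *\<^sub>R real_frame k)"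
      unfolding \<Lambda>_def \<Lambda>'_def by (simp add: sum.reindex_bij_betw[OF \<beta>, of "\<lambda>k. (x \<bullet> real_frame k) *\<^sub>R real_frame k"])
    then show ?thesis by (simp flip: real_frame_expansion)
  qed
  have lin: "linear \<Lambda>" "linear \<Lambda>'"
    by (auto intro!: linearI simp: \<Lambda>_def \<Lambda>'_def vec_eq_iff inner_add_left scaleR_add_left sum.distrib scaleR_sum_right)
  then have bl: "bounded_linear \<Lambda>" "bounded_linear \<Lambda>'" by (simp_all add: linear_conv_bounded_linear)
  have cont: "continuous_on A \<Lambda>" "continuous_on B \<Lambda>'" for A B
    using bl by (simp_all add: linear_continuous_on)
  have meas: "\<Lambda> \<in> borel_measurable borel" by (rule borel_measurable_continuous_onI[OF cont(1)])
  \<comment> \<open>A linear map matching the two standard bases takes boxes to boxes of equal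
    volume, hence Lebesgue measure to Lebesgue measure.\<close>
  have lb: "lborel = distr lborel borel \<Lambda>"
  proof (rule lborel_eqI)
    fix l v :: "complex^'n" assume le: "\<And>b. b \<in> Basis \<Longrightarrow> l \<bullet> b \<le> v \<bullet> b"
    have B: "(\<forall>b\<in>Basis. P b) \<longleftrightarrow> (\<forall>i. P (real_frame (\<beta> i)))" for P :: "complex^'n \<Rightarrow> bool"
      unfolding real_frame_range(2)[symmetric] using bij_is_surj[OF \<beta>] by (metis rangeI surjD imageE)
    have B': "(\<forall>b\<in>Basis. P b) \<longleftrightarrow> (\<forall>i. P (axis i 1))" for P :: "real^('n bit0) \<Rightarrow> bool"
      unfolding real_axis_range(2)[symmetric] by auto
    have "\<Lambda> -` box l v = box (\<Lambda>' l) (\<Lambda>' v)"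
      by (auto simp: box_def B B' \<Lambda>_inner inner_axis \<Lambda>'_def)
    moreover have "\<Lambda>' l \<bullet> b \<le> \<Lambda>' v \<bullet> b" if b: "b \<in> Basis" for b
    proof -
      obtain i where "b = axis i 1" using b by (auto simp flip: real_axis_range(2))
      moreover have "real_frame (\<beta> i) \<in> (Basis :: (complex^'n) set)"
        unfolding real_frame_range(2)[symmetric] by (rule rangeI)
      ultimately show ?thesis using le by (simp add: \<Lambda>'_def inner_axis)
    qed
    moreover have "(\<Prod>b\<in>Basis. (\<Lambda>' v - \<Lambda>' l) \<bullet> b) = (\<Prod>b\<in>Basis. (v - l) \<bullet> b)"
    proof -
      have "(\<Prod>b\<in>Basis. (\<Lambda>' v - \<Lambda>' l) \<bullet> b) = (\<Prod>i\<in>UNIV. (v - l) \<bullet> real_frame (\<beta> i))"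
        unfolding real_axis_range(2)[symmetric]
        by (subst prod.reindex[OF real_axis_range(1)]) (simp add: inner_axis \<Lambda>'_def inner_diff_left)
      also have "\<dots> = (\<Prod>k\<in>UNIV. (v - l) \<bullet> real_frame k)"
        by (rule prod.reindex_bij_betw[OF \<beta>])
      also have "\<dots> = (\<Prod>b\<in>Basis. (v - l) \<bullet> b)"
        unfolding real_frame_range(2)[symmetric] by (subst prod.reindex[OF real_frame_range(1)]) simp
      finally show ?thesis .
    qed
    ultimately show "emeasure (distr lborel borel \<Lambda>) (box l v) = (\<Prod>b\<in>Basis. (v - l) \<bullet> b)"
      using meas by (simp add: emeasure_distr)
  qed simp
  have transfer: "integral A w = integral (\<Lambda> -` A) (\<lambda>y. w (\<Lambda> y))"
      "(\<lambda>y. w (\<Lambda> y)) absolutely_integrable_on (\<Lambda> -` A)"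
    if "integrable lborel (extend0 A w)" for A and w :: "complex^'n \<Rightarrow> real"
  proof -
    have e: "(\<lambda>y. extend0 A w (\<Lambda> y)) = extend0 (\<Lambda> -` A) (\<lambda>y. w (\<Lambda> y))"
      by (auto simp: extend0_def)
    have "integrable lborel (\<lambda>y. extend0 A w (\<Lambda> y))"
      using that lb meas integrable_distr[of \<Lambda> lborel borel "extend0 A w"] by simp
    then have i: "integrable lborel (extend0 (\<Lambda> -` A) (\<lambda>y. w (\<Lambda> y)))" unfolding e .
    show "(\<lambda>y. w (\<Lambda> y)) absolutely_integrable_on (\<Lambda> -` A)" by (rule integral_eq_lborel(2)[OF i])
    have "integral\<^sup>L lborel (extend0 A w) = integral\<^sup>L lborel (\<lambda>y. extend0 A w (\<Lambda> y))"
      using integral_distr[of \<Lambda> lborel borel "extend0 A w"] lb meas borel_measurable_integrable[OF that] by simp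
    then show "integral A w = integral (\<Lambda> -` A) (\<lambda>y. w (\<Lambda> y))"
      by (simp add: integral_eq_lborel(1)[OF that] integral_eq_lborel(1)[OF i] e)
  qed
  define g where "g y = \<Lambda>' (\<tau> (\<Lambda> y))" for y
  define g' where "g' y v = \<Lambda>' (\<tau>' (\<Lambda> y) (\<Lambda> v))" for y v
  have \<Lambda>g: "\<Lambda> (g y) = \<tau> (\<Lambda> y)" for y by (simp add: g_def \<Lambda>\<Lambda>')
  have gim: "g ` (\<Lambda> -` S) = \<Lambda> -` T"
  proof (intro set_eqI iffI)
    fix y assume "y \<in> \<Lambda> -` T"
    then obtain x where x: "x \<in> S" "\<tau> x = \<Lambda> y" using im by auto
    then have "y = g (\<Lambda>' x)" by (simp add: g_def \<Lambda>\<Lambda>' \<Lambda>'\<Lambda>)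
    then show "y \<in> g ` (\<Lambda> -` S)" using x by (auto simp: \<Lambda>\<Lambda>')
  qed (use im \<Lambda>g in auto)
  have detg: "\<bar>det (matrix (g' y))\<bar> = D (\<Lambda> y)" if "\<Lambda> y \<in> S" for y
  proof -
    have "\<Lambda> (axis i 1) = real_frame (\<beta> i)" for i
    proof -
      have "(axis i 1 $ k) *\<^sub>R real_frame (\<beta> k) = (if k = i then real_frame (\<beta> k) else 0 :: complex^'n)" for k
        by (simp add: axis_def)
      then show ?thesis by (simp add: \<Lambda>_def)
    qed
    then have "matrix (g' y) = transpose (\<chi> i j. \<tau>' (\<Lambda> y) (real_frame (\<beta> i)) \<bullet> real_frame (\<beta> j))"
      by (simp add: matrix_def g'_def \<Lambda>'_def transpose_def)
    then show ?thesis
      using det_reindex[OF \<beta>, of "\<lambda>i j. \<tau>' (\<Lambda> y) (real_frame i) \<bullet> real_frame j"] by (simp add: D[OF that])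
  qed
  have "integral T u = integral (g ` (\<Lambda> -` S)) (\<lambda>y. u (\<Lambda> y))"
    unfolding gim by (rule transfer(1)[OF lborel_integrable_supported[OF T u]])
  also have "\<dots> = integral (\<Lambda> -` S) (\<lambda>y. \<bar>det (matrix (g' y))\<bar> * u (\<Lambda> (g y)))"
  proof (rule integral_change_of_variables_scalar)
    have "open (\<Lambda> -` S)" by (rule open_vimage[OF S cont(1)])
    then show "\<Lambda> -` S \<in> sets lebesgue" by simp
    show "(g has_derivative g' y) (at y within \<Lambda> -` S)" if "y \<in> \<Lambda> -` S" for y
    proof -
      have "((\<lambda>y. \<tau> (\<Lambda> y)) has_derivative (\<lambda>v. \<tau>' (\<Lambda> y) (\<Lambda> v))) (at y within \<Lambda> -` S)"
        by (rule has_derivative_compose[OF bounded_linear_imp_has_derivative[OF bl(1)]])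
          (use der that in auto)
      then show ?thesis unfolding g_def g'_def by (rule bounded_linear.has_derivative[OF bl(2)])
    qed
    show "inj_on g (\<Lambda> -` S)"
    proof (rule inj_onI)
      fix y z assume "y \<in> \<Lambda> -` S" "z \<in> \<Lambda> -` S" "g y = g z"
      then have "\<tau> (\<Lambda> y) = \<tau> (\<Lambda> z)" by (metis \<Lambda>g)
      then have "\<Lambda> y = \<Lambda> z" using inj \<open>y \<in> _\<close> \<open>z \<in> _\<close> by (auto dest: inj_onD)
      then show "y = z" by (metis \<Lambda>'\<Lambda>)
    qed
    show "(\<lambda>y. u (\<Lambda> y)) absolutely_integrable_on g ` (\<Lambda> -` S)"
      unfolding gim by (rule transfer(2)[OF lborel_integrable_supported[OF T u]])
    show "(\<lambda>y. \<bar>det (matrix (g' y))\<bar> * u (\<Lambda> (g y))) absolutely_integrable_on \<Lambda> -` S"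
      using transfer(2)[OF lborel_integrable_supported[OF S Du]]
      by (rule set_integrable_cong[THEN iffD1, rotated -1]) (simp_all add: detg \<Lambda>g)
  qed
  also have "\<dots> = integral (\<Lambda> -` S) (\<lambda>y. D (\<Lambda> y) * u (\<tau> (\<Lambda> y)))"
    by (rule Henstock_Kurzweil_Integration.integral_cong) (simp add: detg \<Lambda>g)
  also have "\<dots> = integral S (\<lambda>x. D x * u (\<tau> x))"
    by (rule transfer(1)[OF lborel_integrable_supported[OF S Du], symmetric])
  finally show ?thesis .
qed

section \<open>Charts and group actions\<close>

lemma smooth_atlas_chart:
  assumes "smooth_atlas S A" "c \<in> A"
  shows "openin (top_of_set S) (cdom c)" "open (cran c)" "cdom c \<subseteq> S"
    "continuous_on (cdom c) (coord c)" "continuous_on (cran c) (cinv c)"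
    "\<And>p. p \<in> cdom c \<Longrightarrow> coord c p \<in> cran c" "\<And>x. x \<in> cran c \<Longrightarrow> cinv c x \<in> cdom c"
    "\<And>p. p \<in> cdom c \<Longrightarrow> cinv c (coord c p) = p" "\<And>x. x \<in> cran c \<Longrightarrow> coord c (cinv c x) = x"
proof -
  have o: "openin (top_of_set S) (cdom c)" "open (cran c)"
    and h: "homeomorphism (cdom c) (cran c) (coord c) (cinv c)"
    using assms by (auto simp: smooth_atlas_def)
  show "openin (top_of_set S) (cdom c)" "open (cran c)" by (fact o)+
  show "cdom c \<subseteq> S" using o(1) by (rule openin_imp_subset)
  show "continuous_on (cdom c) (coord c)" "continuous_on (cran c) (cinv c)"
    "\<And>p. p \<in> cdom c \<Longrightarrow> coord c p \<in> cran c" "\<And>x. x \<in> cran c \<Longrightarrow> cinv c x \<in> cdom c"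
    "\<And>p. p \<in> cdom c \<Longrightarrow> cinv c (coord c p) = p" "\<And>x. x \<in> cran c \<Longrightarrow> coord c (cinv c x) = x"
    using h by (auto simp: homeomorphism_def)
qed

lemma smooth_atlas_cover:
  assumes "smooth_atlas S A" "p \<in> S"
  obtains c where "c \<in> A" "p \<in> cdom c"
  using assms by (auto simp: smooth_atlas_def)

lemma rep_apply: "rep c d f x = coord d (f (cinv c x))"
  by (simp add: rep_def)

lemma rep_dom_eq:
  assumes "smooth_atlas S A" "c \<in> A"
  shows "rep_dom c d f = {x \<in> cran c. f (cinv c x) \<in> cdom d}"
  using smooth_atlas_chart[OF assms] by (force simp: rep_dom_def)

lemma smooth_map_continuous:
  assumes "smooth_atlas S A" "smooth_atlas T B" "smooth_map A B f"
  shows "continuous_on S f" "f ` S \<subseteq> T"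
  using assms by (auto simp: smooth_map_def smooth_atlas_def)

lemma smooth_map_chart:
  assumes S: "smooth_atlas S A" and T: "smooth_atlas T B" and f: "smooth_map A B f"
    and c: "c \<in> A" and d: "d \<in> B"
  shows "open (rep_dom c d f)" "smooth_on (rep_dom c d f) (rep c d f)"
proof -
  note sc = smooth_atlas_chart[OF S c]
  note fc = smooth_map_continuous[OF S T f]
  have "continuous_on (cran c) (\<lambda>x. f (cinv c x))"
    by (rule continuous_on_compose2[OF fc(1) sc(5)]) (use sc in auto)
  moreover have "(\<lambda>x. f (cinv c x)) \<in> cran c \<rightarrow> T" using sc(3,7) fc(2) by blast
  ultimately have "openin (top_of_set (cran c)) (cran c \<inter> (\<lambda>x. f (cinv c x)) -` cdom d)"
    using smooth_atlas_chart(1)[OF T d] by (rule continuous_openin_preimage)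
  then have "open (cran c \<inter> (\<lambda>x. f (cinv c x)) -` cdom d)"
    using sc(2) by (simp add: openin_open_eq)
  then show "open (rep_dom c d f)" by (simp add: rep_dom_eq[OF S c] vimage_def Int_def)
  show "smooth_on (rep_dom c d f) (rep c d f)" using f c d by (simp add: smooth_map_def)
qed

text \<open>A chart of \<open>prod_atlas\<close> has its own \<open>cinv\<close>, given by
  \<open>inv_into\<close>; once this is identified with the pair of inverses, a smooth map on the
  product becomes a smooth function of two coordinate variables.\<close>

lemma smooth_map_prod_chart:
  assumes S: "smooth_atlas S A" and T: "smooth_atlas T B" and R: "smooth_atlas R C"
    and f: "smooth_map (prod_atlas A B) C f"
    and a: "a \<in> A" and b: "b \<in> B" and c: "c \<in> C"
  defines "W \<equiv> {(s, x). s \<in> cran a \<and> x \<in> cran b \<and> f (cinv a s, cinv b x) \<in> cdom c}"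
  shows "open W" "smooth_on W (\<lambda>(s, x). coord c (f (cinv a s, cinv b x)))"
    "continuous_on (S \<times> T) f" "f ` (S \<times> T) \<subseteq> R"
proof -
  let ?e = "(cdom a \<times> cdom b, map_prod (coord a) (coord b))"
  note sa = smooth_atlas_chart[OF S a] and sb = smooth_atlas_chart[OF T b]
  have "prod_atlas A B = (\<lambda>z. (cdom (fst z) \<times> cdom (snd z), map_prod (coord (fst z)) (coord (snd z)))) ` (A \<times> B)"
    unfolding prod_atlas_def image_def by force
  then have "(\<Union>e\<in>prod_atlas A B. cdom e) = (\<Union>z\<in>A \<times> B. cdom (fst z) \<times> cdom (snd z))"
    by (simp add: cdom_def[of "(_, _)"])
  also have "\<dots> = (\<Union>a\<in>A. cdom a) \<times> (\<Union>b\<in>B. cdom b)"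
    by fastforce
  finally have "(\<Union>e\<in>prod_atlas A B. cdom e) = (\<Union>a\<in>A. cdom a) \<times> (\<Union>b\<in>B. cdom b)" .
  then have U: "(\<Union>e\<in>prod_atlas A B. cdom e) = S \<times> T"
    using S T by (simp add: smooth_atlas_def)
  show cont: "continuous_on (S \<times> T) f" and im: "f ` (S \<times> T) \<subseteq> R"
    using f R by (auto simp: smooth_map_def U smooth_atlas_def)
  have e: "?e \<in> prod_atlas A B" using a b unfolding prod_atlas_def by blast
  have cdom_e: "cdom ?e = cdom a \<times> cdom b" and cran_e: "cran ?e = cran a \<times> cran b"
    by (simp_all add: cdom_def cran_def coord_def map_prod_image)
  have inj: "inj_on (map_prod (coord a) (coord b)) (cdom a \<times> cdom b)"
    using sa(8) sb(8) by (intro map_prod_inj_on) (metis inj_on_inverseI)+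
  have cinv: "cinv ?e = inv_into (cdom a \<times> cdom b) (map_prod (coord a) (coord b))"
    by (simp add: cinv_def cdom_def coord_def)
  have cinv_e: "cinv ?e (s, x) = (cinv a s, cinv b x)" if "s \<in> cran a" "x \<in> cran b" for s x
  proof -
    have "map_prod (coord a) (coord b) (cinv a s, cinv b x) = (s, x)"
      using sa sb that by simp
    then show ?thesis
      using inv_into_f_f[OF inj, of "(cinv a s, cinv b x)"] sa(7) sb(7) that by (simp add: cinv)
  qed
  have dom: "rep_dom ?e c f = W"
  proof (intro set_eqI iffI)
    fix y assume "y \<in> rep_dom ?e c f"
    then obtain p q where "p \<in> cdom a" "q \<in> cdom b" "f (p, q) \<in> cdom c" "y = (coord a p, coord b q)"
      by (auto simp: rep_dom_def cdom_e coord_def[of ?e])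
    then show "y \<in> W" using sa sb by (simp add: W_def)
  next
    fix y assume "y \<in> W"
    then obtain s x where y: "y = (s, x)" "s \<in> cran a" "x \<in> cran b" "f (cinv a s, cinv b x) \<in> cdom c"
      by (auto simp: W_def)
    then show "y \<in> rep_dom ?e c f"
      using sa sb unfolding rep_dom_def cdom_e
      by (intro image_eqI[of _ _ "(cinv a s, cinv b x)"]) (auto simp: coord_def[of ?e])
  qed
  have "continuous_on (cran a \<times> cran b) (\<lambda>z. f (cinv a (fst z), cinv b (snd z)))"
    by (rule continuous_on_compose2[OF cont])
      (use sa sb in \<open>auto intro!: continuous_on_Pair continuous_on_compose2[OF sa(5)] continuous_on_compose2[OF sb(5)] continuous_intros\<close>)
  moreover have "(\<lambda>z. f (cinv a (fst z), cinv b (snd z))) \<in> cran a \<times> cran b \<rightarrow> R"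
  proof
    fix z assume "z \<in> cran a \<times> cran b"
    then have "(cinv a (fst z), cinv b (snd z)) \<in> S \<times> T" using sa(3,7) sb(3,7) by auto
    then show "f (cinv a (fst z), cinv b (snd z)) \<in> R" using im by blast
  qed
  ultimately have "openin (top_of_set (cran a \<times> cran b))
      ((cran a \<times> cran b) \<inter> (\<lambda>z. f (cinv a (fst z), cinv b (snd z))) -` cdom c)"
    using smooth_atlas_chart(1)[OF R c] by (rule continuous_openin_preimage)
  moreover have "(cran a \<times> cran b) \<inter> (\<lambda>z. f (cinv a (fst z), cinv b (snd z))) -` cdom c = W"
    by (auto simp: W_def)
  ultimately show openW: "open W"
    using sa(2) sb(2) by (simp add: openin_open_eq open_Times)
  have "smooth_on W (rep ?e c f)"
    using f e c by (simp add: smooth_map_def flip: dom)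
  then show "smooth_on W (\<lambda>(s, x). coord c (f (cinv a s, cinv b x)))"
    by (rule smooth_on_cong[OF openW, rotated]) (auto simp: W_def rep_apply cinv_e)
qed

locale kaehler_manifold =
  fixes A :: "('m::t2_space, complex^'n) chart set"
    and g :: "('m, complex^'n) chart \<Rightarrow> complex^'n \<Rightarrow> complex^'n \<Rightarrow> complex^'n \<Rightarrow> real"
  assumes compact_M: "compact (UNIV :: 'm set)" and connected_M: "connected (UNIV :: 'm set)"
    and kaehler: "kaehler A g"
begin

lemma atlas: "smooth_atlas UNIV A"
  using kaehler by (simp add: kaehler_def holomorphic_atlas_def)

lemmas charts = smooth_atlas_chart[OF atlas]

lemma open_cdom: "c \<in> A \<Longrightarrow> open (cdom c)"
  using charts(1) by simp

lemma chart_exists: obtains c where "c \<in> A" "p \<in> cdom c"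
  using smooth_atlas_cover[OF atlas UNIV_I] .

lemma kaehler_chart: "c \<in> A \<Longrightarrow> kaehler_chart (g c) (cran c)"
  using kaehler charts(2)
  by unfold_locales (auto simp: kaehler_def riemannian_metric_def)

lemma smooth_function_chart:
  assumes "smooth_map A (euclidean_atlas UNIV) f" "c \<in> A"
  shows "smooth_on (cran c) (\<lambda>x. f (cinv c x))"
proof -
  let ?d = "(UNIV, \<lambda>x. x)"
  have "smooth_on (rep_dom c ?d f) (rep c ?d f)"
    using assms by (simp add: smooth_map_def euclidean_atlas_def)
  moreover have "rep_dom c ?d f = cran c" by (simp add: rep_dom_eq[OF atlas assms(2)] cdom_def)
  moreover have "rep c ?d f = (\<lambda>x. f (cinv c x))" by (simp add: fun_eq_iff rep_apply coord_def)
  ultimately show ?thesis by simp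
qed

lemma continuous_smooth_function:
  assumes "smooth_map A (euclidean_atlas UNIV) f"
  shows "continuous_on UNIV f"
  using assms atlas by (simp add: smooth_map_def smooth_atlas_def)

definition overlap :: "('m, complex^'n) chart \<Rightarrow> ('m, complex^'n) chart \<Rightarrow> (complex^'n) set" where
  "overlap c d = {x \<in> cran c. cinv c x \<in> cdom d}"

definition transition :: "('m, complex^'n) chart \<Rightarrow> ('m, complex^'n) chart \<Rightarrow> complex^'n \<Rightarrow> complex^'n" where
  "transition c d x = coord d (cinv c x)"

context
  fixes c d assumes c: "c \<in> A" and d: "d \<in> A"
begin

lemma transition: "open (overlap c d)" "smooth_on (overlap c d) (transition c d)"
    "\<And>x. x \<in> overlap c d \<Longrightarrow> transition c d x \<in> overlap d c"
    "\<And>x. x \<in> overlap c d \<Longrightarrow> transition d c (transition c d x) = x"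
    "\<And>x. x \<in> overlap c d \<Longrightarrow> cinv d (transition c d x) = cinv c x"
    "\<And>x v. x \<in> overlap c d \<Longrightarrow> dd (transition c d) x (J v) = J (dd (transition c d) x v)"
    "\<And>x u v. x \<in> overlap c d \<Longrightarrow>
      g d (transition c d x) (dd (transition c d) x u) (dd (transition c d) x v) = g c x u v"
    "overlap c d \<subseteq> cran c"
proof -
  have dom: "rep_dom c d (\<lambda>p. p) = overlap c d"
    by (simp add: rep_dom_eq[OF atlas c] overlap_def)
  have rep: "rep c d (\<lambda>p. p) = transition c d" by (simp add: fun_eq_iff rep_apply transition_def)
  have id: "smooth_map A A (\<lambda>p. p)" using atlas by (simp add: smooth_atlas_def)
  show "open (overlap c d)" "smooth_on (overlap c d) (transition c d)"
    using smooth_map_chart[OF atlas atlas id c d] by (simp_all add: dom rep)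
  show "\<And>x. x \<in> overlap c d \<Longrightarrow> transition c d x \<in> overlap d c"
    "\<And>x. x \<in> overlap c d \<Longrightarrow> transition d c (transition c d x) = x"
    "\<And>x. x \<in> overlap c d \<Longrightarrow> cinv d (transition c d x) = cinv c x"
    "overlap c d \<subseteq> cran c"
    using charts[OF c] charts[OF d] by (auto simp: overlap_def transition_def)
  show "\<And>x v. x \<in> overlap c d \<Longrightarrow> dd (transition c d) x (J v) = J (dd (transition c d) x v)"
    using kaehler c d unfolding kaehler_def holomorphic_atlas_def by (metis dom rep)
  show "\<And>x u v. x \<in> overlap c d \<Longrightarrow>
      g d (transition c d x) (dd (transition c d) x u) (dd (transition c d) x v) = g c x u v"
    using kaehler c d unfolding kaehler_def riemannian_metric_def preserves_metric_def by (metis dom rep)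
qed

text \<open>The derivative of a transition preserves the metric, so its kernel is trivial.\<close>

lemma transition_bij:
  assumes x: "x \<in> overlap c d"
  obtains M where "linear M" "\<And>v. M (dd (transition c d) x v) = v" "\<And>v. dd (transition c d) x (M v) = v"
proof -
  interpret kc: kaehler_chart "g c" "cran c" by (rule kaehler_chart[OF c])
  interpret kd: kaehler_chart "g d" "cran d" by (rule kaehler_chart[OF d])
  have lin: "linear (dd (transition c d) x)"
    by (rule linear_dd[OF smooth_onD[OF transition(2) x]])
  have "v = 0" if "dd (transition c d) x v = 0" for v
  proof (rule ccontr)
    assume "v \<noteq> 0"
    then have "g c x v v > 0" using kc.pos transition(8) x by auto
    moreover have "transition c d x \<in> cran d" using transition(3)[OF x] by (simp add: overlap_def)
    then have "g c x v v = 0" using transition(7)[OF x, of v v] that kd.h_simps by simp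
    ultimately show False by simp
  qed
  then have "inj (dd (transition c d) x)" by (simp add: linear_injective_0[OF lin])
  then show ?thesis
    using linear_injective_isomorphism[OF lin] that by blast
qed

end

end

section \<open>Fundamental vector fields\<close>

lemma (in metric_chart) has_derivative_h_path:
  assumes T: "open T" "t \<in> T" "\<And>s. s \<in> T \<Longrightarrow> \<gamma> s \<in> S"
    and \<gamma>: "(\<gamma> has_derivative \<gamma>') (at t)" and a: "(a has_derivative a') (at t)" and b: "(b has_derivative b') (at t)"
  shows "((\<lambda>s. h (\<gamma> s) (a s) (b s)) has_derivative
    (\<lambda>k. dd (\<lambda>y. h y (a t) (b t)) (\<gamma> t) (\<gamma>' k) + h (\<gamma> t) (a' k) (b t) + h (\<gamma> t) (a t) (b' k))) (at t)"
proof -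
  have 0: "((\<lambda>s. h (\<gamma> s) u v) has_derivative (\<lambda>k. dd (\<lambda>y. h y u v) (\<gamma> t) (\<gamma>' k))) (at t)" for u v
    by (rule has_derivative_compose[OF \<gamma> differentiable_dd[OF diff_h[OF T(3)[OF T(2)]]]])
  have 1: "((\<lambda>s. h (\<gamma> s) (a s) v) has_derivative
      (\<lambda>k. dd (\<lambda>s. h (\<gamma> s) (a t) v) t k + h (\<gamma> t) (a' k) v)) (at t)" for v
    by (rule has_derivative_linear_family[OF T(1,2) lin1 _ a]) (use T 0 in \<open>auto simp: differentiable_def\<close>)
  have "((\<lambda>s. h (\<gamma> s) (a s) (b s)) has_derivative
      (\<lambda>k. dd (\<lambda>s. h (\<gamma> s) (a s) (b t)) t k + h (\<gamma> t) (a t) (b' k))) (at t)"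
    by (rule has_derivative_linear_family[OF T(1,2) lin2 _ b]) (use T 1 in \<open>auto simp: differentiable_def\<close>)
  then show ?thesis by (simp add: dd_eq[OF 1] dd_eq[OF 0])
qed

locale hamiltonian_kaehler = kaehler_manifold A g
  for A :: "('m::t2_space, complex^'n) chart set" and g +
  fixes K :: "('m \<Rightarrow> 'm) set" and B :: "('m \<Rightarrow> 'm, 'k::euclidean_space) chart set"
    and e :: "('m \<Rightarrow> 'm, 'k) chart" and \<mu> :: "'m \<Rightarrow> 'k \<Rightarrow>\<^sub>L real"
  assumes lie: "lie_group_of_isometries A g K B" and identity_chart: "identity_chart B e"
    and moment_map: "moment_map A g K e \<mu>"
begin

lemma group_atlas: "smooth_atlas K B"
  using lie by (simp add: lie_group_of_isometries_def)

lemma identity_in_chart: "e \<in> B" "(\<lambda>p. p) \<in> cdom e"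
  using identity_chart by (auto simp: identity_chart_def)

lemmas echart = smooth_atlas_chart[OF group_atlas identity_in_chart(1)]

definition s0 :: 'k where "s0 = coord e (\<lambda>p. p)"

lemma s0: "s0 \<in> cran e" "cinv e s0 = (\<lambda>p. p)"
  unfolding s0_def using echart identity_in_chart by auto

lemma smooth_action: "smooth_map (prod_atlas B A) A (\<lambda>(k, p). k p)"
  using lie by (simp add: lie_group_of_isometries_def)

definition act_dom :: "('m, complex^'n) chart \<Rightarrow> ('k \<times> (complex^'n)) set" where
  "act_dom c = {(s, x). s \<in> cran e \<and> x \<in> cran c \<and> cinv e s (cinv c x) \<in> cdom c}"

text \<open>The action read in the chart \<open>e\<close> of the group and in one chart
  \<open>c\<close> before and after, so that \<open>s0\<close>, the coordinates of the identity,
  acts as the identity on \<open>cran c\<close>.\<close>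

definition act :: "('m, complex^'n) chart \<Rightarrow> 'k \<times> (complex^'n) \<Rightarrow> complex^'n" where
  "act c z = coord c (cinv e (fst z) (cinv c (snd z)))"

lemma act:
  assumes c: "c \<in> A"
  shows "open (act_dom c)" "smooth_on (act_dom c) (act c)"
    "\<And>x. x \<in> cran c \<Longrightarrow> (s0, x) \<in> act_dom c" "\<And>x. x \<in> cran c \<Longrightarrow> act c (s0, x) = x"
  using smooth_map_prod_chart(1,2)[OF group_atlas atlas atlas smooth_action identity_in_chart(1) c c] charts[OF c] s0
  by (simp_all add: act_dom_def act_def[abs_def] case_prod_unfold)

definition fund :: "('m, complex^'n) chart \<Rightarrow> 'k \<Rightarrow> complex^'n \<Rightarrow> complex^'n" where
  "fund c \<xi> x = fundamental_field e c x \<xi>"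

definition ham :: "('m, complex^'n) chart \<Rightarrow> 'k \<Rightarrow> complex^'n \<Rightarrow> real" where
  "ham c \<xi> x = blinfun_apply (\<mu> (cinv c x)) \<xi>"

lemma diff_act: "c \<in> A \<Longrightarrow> z \<in> act_dom c \<Longrightarrow> act c differentiable (at z)"
  by (rule smooth_onD[OF act(2)])

lemma has_derivative_act1:
  assumes "c \<in> A" "(s, x) \<in> act_dom c"
  shows "((\<lambda>s. act c (s, x)) has_derivative (\<lambda>\<xi>. dd (act c) (s, x) (\<xi>, 0))) (at s)"
  by (rule has_derivative_compose[of "\<lambda>s. (s, x)" _ _ _ "act c", OF _ differentiable_dd[OF diff_act[OF assms]]])
    (auto intro!: derivative_eq_intros)

lemma has_derivative_act2:
  assumes "c \<in> A" "(s, x) \<in> act_dom c"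
  shows "((\<lambda>x. act c (s, x)) has_derivative (\<lambda>v. dd (act c) (s, x) (0, v))) (at x)"
  by (rule has_derivative_compose[of "\<lambda>x. (s, x)" _ _ _ "act c", OF _ differentiable_dd[OF diff_act[OF assms]]])
    (auto intro!: derivative_eq_intros)

lemma fund_eq:
  assumes "c \<in> A" "x \<in> cran c"
  shows "fund c \<xi> x = dd (act c) (s0, x) (\<xi>, 0)"
proof -
  have "rep e c (\<lambda>k. k (cinv c x)) = (\<lambda>s. act c (s, x))"
    by (simp add: fun_eq_iff rep_apply act_def)
  then show ?thesis
    using dd_eq[OF has_derivative_act1[OF assms(1) act(3)[OF assms]]]
    by (simp add: fund_def fundamental_field_def s0_def)
qed

lemma linear_fund:
  assumes "c \<in> A" "x \<in> cran c"
  shows "linear (\<lambda>\<xi>. fund c \<xi> x)"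
proof (rule linearI)
  have lin: "linear (dd (act c) (s0, x))" by (rule linear_dd[OF diff_act[OF assms(1) act(3)[OF assms]]])
  fix \<xi> \<eta> :: 'k and r :: real
  show "fund c (\<xi> + \<eta>) x = fund c \<xi> x + fund c \<eta> x"
    using linear_add[OF lin, of "(\<xi>, 0)" "(\<eta>, 0)"] by (simp add: fund_eq[OF assms])
  show "fund c (r *\<^sub>R \<xi>) x = r *\<^sub>R fund c \<xi> x"
    using linear_cmul[OF lin, of r "(\<xi>, 0)"] by (simp add: fund_eq[OF assms])
qed

text \<open>The field is a partial derivative, in a group direction at \<open>s0\<close>, of the
  jointly smooth map \<open>act c\<close>.\<close>

lemma smooth_fund:
  assumes "c \<in> A"
  shows "smooth_on (cran c) (fund c \<xi>)"
proof (rule smooth_on_cong[OF charts(2)[OF assms]])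
  have "bounded_linear (\<lambda>x :: complex^'n. (0 :: 'k, x))"
    by (simp add: bounded_linear_Pair)
  from smooth_on_affine[OF charts(2)[OF assms] this smooth_on_dd[OF act(2)[OF assms]], of "(s0, 0)" "(\<xi>, 0)"]
  show "smooth_on (cran c) (\<lambda>x. dd (act c) (s0, x) (\<xi>, 0))"
    using act(3)[OF assms] by simp
qed (simp add: fund_eq[OF assms])

lemma smooth_\<mu>: "smooth_map A (euclidean_atlas UNIV) \<mu>"
  using moment_map by (simp add: moment_map_def)

lemma smooth_ham: "c \<in> A \<Longrightarrow> smooth_on (cran c) (ham c \<xi>)"
  unfolding ham_def[abs_def]
  by (rule smooth_on_bounded_linear[OF charts(2) _ smooth_function_chart[OF smooth_\<mu>], of c "\<lambda>L. blinfun_apply L \<xi>"])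
    (auto intro: bounded_linear_intros)

lemma moment_ham:
  assumes c: "c \<in> A" and x: "x \<in> cran c"
  shows "dd (ham c \<xi>) x v = g c x (J v) (fund c \<xi> x)"
proof -
  have "((\<lambda>x. \<mu> (cinv c x)) has_derivative dd (\<mu> \<circ> cinv c) x) (at x)"
    using differentiable_dd[OF smooth_onD[OF smooth_function_chart[OF smooth_\<mu> c] x]] by (simp add: o_def)
  then have "(ham c \<xi> has_derivative (\<lambda>v. blinfun_apply (dd (\<mu> \<circ> cinv c) x v) \<xi>)) (at x)"
    unfolding ham_def[abs_def] by (rule bounded_linear.has_derivative[rotated]) (auto intro: bounded_linear_intros)
  then have "dd (ham c \<xi>) x v = blinfun_apply (dd (\<mu> \<circ> cinv c) x v) \<xi>" by (rule dd_eq)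
  also have "\<dots> = g c x (J v) (fund c \<xi> x)"
    using moment_map c x by (simp add: moment_map_def kaehler_form_def fund_def)
  finally show ?thesis .
qed

lemma isometry_K: "k \<in> K \<Longrightarrow> isometry A g k"
  using lie by (simp add: lie_group_of_isometries_def)

text \<open>The group elements with coordinates \<open>s0 + t \<xi>\<close> are isometries, so the
  metric pulled back to \<open>x\<close> is constant in \<open>t\<close>; its derivative at 0 is the
  Killing equation. The line is no one-parameter subgroup in general, but only its velocity at 0
  matters.\<close>

lemma killing_equation:
  assumes c: "c \<in> A" and x: "x \<in> cran c"
  shows "dd (\<lambda>y. g c y u v) x (fund c \<xi> x) + g c x (dd (fund c \<xi>) x u) v + g c x u (dd (fund c \<xi>) x v) = 0"
proof -
  interpret kc: kaehler_chart "g c" "cran c" by (rule kaehler_chart[OF c])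
  note W = act[OF c]
  define T where "T = {t::real. (s0 + t *\<^sub>R \<xi>, x) \<in> act_dom c}"
  have T: "open T"
  proof -
    have "continuous_on UNIV (\<lambda>t. (s0 + t *\<^sub>R \<xi>, x))" by (intro continuous_intros)
    from open_vimage[OF W(1) this] show ?thesis by (simp add: T_def vimage_def)
  qed
  have T0: "0 \<in> T" using W(3)[OF x] by (simp add: T_def)
  let ?\<gamma> = "\<lambda>t. act c (s0 + t *\<^sub>R \<xi>, x)"
  let ?a = "\<lambda>u t. dd (act c) (s0 + t *\<^sub>R \<xi>, x) (0, u)"
  have \<gamma>S: "?\<gamma> t \<in> cran c" if "t \<in> T" for t
    using that charts(6)[OF c] by (simp add: T_def act_dom_def act_def)
  have inner: "((\<lambda>t. (s0 + t *\<^sub>R \<xi>, x)) has_derivative (\<lambda>k. (k *\<^sub>R \<xi>, 0))) (at t)" for t :: real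
    by (auto intro!: derivative_eq_intros)
  have \<gamma>': "(?\<gamma> has_derivative (\<lambda>k. dd (act c) (s0, x) (k *\<^sub>R \<xi>, 0))) (at 0)"
    using has_derivative_compose[OF inner[of 0] differentiable_dd[OF diff_act[OF c]]] W(3)[OF x] by simp
  have d2: "(\<lambda>z. dd (act c) z (0, u)) differentiable (at (s0, x))" for u
    by (rule smooth_onD[OF smooth_on_dd[OF W(2)] W(3)[OF x]])
  have a': "(?a u has_derivative (\<lambda>k. dd (\<lambda>z. dd (act c) z (0, u)) (s0, x) (k *\<^sub>R \<xi>, 0))) (at 0)" for u
    using has_derivative_compose[OF inner[of 0] differentiable_dd[of "\<lambda>z. dd (act c) z (0, u)"]] d2 by simp
  have "((\<lambda>t. g c (?\<gamma> t) (?a u t) (?a v t)) has_derivative (\<lambda>k. dd (\<lambda>y. g c y (?a u 0) (?a v 0)) (?\<gamma> 0) (dd (act c) (s0, x) (k *\<^sub>R \<xi>, 0)) +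
      g c (?\<gamma> 0) (dd (\<lambda>z. dd (act c) z (0, u)) (s0, x) (k *\<^sub>R \<xi>, 0)) (?a v 0) +
      g c (?\<gamma> 0) (?a u 0) (dd (\<lambda>z. dd (act c) z (0, v)) (s0, x) (k *\<^sub>R \<xi>, 0)))) (at 0)"
    by (rule kc.has_derivative_h_path[OF T T0 \<gamma>S \<gamma>' a' a'])
  moreover have "((\<lambda>t. g c (?\<gamma> t) (?a u t) (?a v t)) has_derivative (\<lambda>k. 0)) (at 0)"
  proof (rule has_derivative_transform_within_open[OF has_derivative_const T T0])
    fix t assume t: "t \<in> T"
    let ?s = "s0 + t *\<^sub>R \<xi>"
    have W': "(?s, x) \<in> act_dom c" using t by (simp add: T_def)
    have "cinv e ?s \<in> K" using W' echart(3,7) by (auto simp: act_dom_def)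
    then have "preserves_metric A g (cinv e ?s)" using isometry_K by (simp add: isometry_def)
    then have pm: "x \<in> rep_dom c c (cinv e ?s) \<Longrightarrow> g c (rep c c (cinv e ?s) x)
        (dd (rep c c (cinv e ?s)) x u) (dd (rep c c (cinv e ?s)) x v) = g c x u v"
      using c unfolding preserves_metric_def by blast
    have "x \<in> rep_dom c c (cinv e ?s)"
      using W' by (simp add: rep_dom_eq[OF atlas c] act_dom_def)
    moreover have "rep c c (cinv e ?s) = (\<lambda>x. act c (?s, x))"
      by (simp add: fun_eq_iff rep_apply act_def)
    ultimately show "g c x u v = g c (?\<gamma> t) (?a u t) (?a v t)"
      using pm dd_eq[OF has_derivative_act2[OF c W']] by simp
  qed
  ultimately have 0: "dd (\<lambda>y. g c y (?a u 0) (?a v 0)) (?\<gamma> 0) (dd (act c) (s0, x) (1 *\<^sub>R \<xi>, 0)) +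
      g c (?\<gamma> 0) (dd (\<lambda>z. dd (act c) z (0, u)) (s0, x) (1 *\<^sub>R \<xi>, 0)) (?a v 0) +
      g c (?\<gamma> 0) (?a u 0) (dd (\<lambda>z. dd (act c) z (0, v)) (s0, x) (1 *\<^sub>R \<xi>, 0)) = 0"
    by (rule fun_cong[OF has_derivative_unique])
  have a0: "?a u 0 = u" for u
  proof -
    have "((\<lambda>x. act c (s0, x)) has_derivative (\<lambda>v. v)) (at x)"
      by (rule has_derivative_transform_within_open[OF has_derivative_ident kc.open_S x]) (simp add: W(4))
    then show ?thesis
      using fun_cong[OF has_derivative_unique[OF has_derivative_act2[OF c W(3)[OF x]]]] by simp
  qed
  \<comment> \<open>Interchanging the derivatives in the group and in the point turns the variation
    of the Jacobian into the Jacobian of \<open>fund\<close>.\<close>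
  have mixed: "dd (\<lambda>z. dd (act c) z (0, u)) (s0, x) (\<xi>, 0) = dd (fund c \<xi>) x u" for u
  proof -
    have "dd (\<lambda>z. dd (act c) z (0, u)) (s0, x) (\<xi>, 0) = dd (\<lambda>z. dd (act c) z (\<xi>, 0)) (s0, x) (0, u)"
      by (rule smooth_on_dd_dd_symmetric[OF W(1) W(3)[OF x] W(2)])
    also have "\<dots> = dd (\<lambda>x. dd (act c) (s0, x) (\<xi>, 0)) x u"
    proof (rule dd_eq[symmetric])
      show "((\<lambda>x. dd (act c) (s0, x) (\<xi>, 0)) has_derivative (\<lambda>u. dd (\<lambda>z. dd (act c) z (\<xi>, 0)) (s0, x) (0, u))) (at x)"
        by (rule has_derivative_compose[of "\<lambda>x. (s0, x)" _ _ _ "\<lambda>z. dd (act c) z (\<xi>, 0)"],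
            auto intro!: derivative_eq_intros)
          (rule differentiable_dd[OF smooth_onD[OF smooth_on_dd[OF W(2)] W(3)[OF x]]])
    qed
    also have "\<dots> = dd (fund c \<xi>) x u"
      by (rule fun_cong[OF dd_cong_open[OF kc.open_S x]]) (simp add: fund_eq[OF c])
    finally show ?thesis .
  qed
  show ?thesis
    using 0 W(4)[OF x] by (simp add: a0[simplified] mixed fund_eq[OF c x])
qed

lemma killing_chart: "c \<in> A \<Longrightarrow> killing_chart (g c) (cran c) (fund c \<xi>) (ham c \<xi>)"
  by (intro killing_chart.intro kaehler_chart killing_chart_axioms.intro smooth_fund smooth_ham
      killing_equation moment_ham)

end

section \<open>The divergence theorem\<close>

text \<open>The last term measures the failure of the coordinate Hessian to be a tensor; for
  holomorphic transitions it drops out of the \<open>J\<close>-invariant part.\<close>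

lemma hess_compose:
  fixes f :: "'b::euclidean_space \<Rightarrow> real" and \<tau> :: "'a::euclidean_space \<Rightarrow> 'b"
  assumes S: "open S" "x \<in> S" and T: "\<And>y. y \<in> S \<Longrightarrow> \<tau> y \<in> T"
    and \<tau>: "smooth_on S \<tau>" and f: "smooth_on T f"
  shows "hess (\<lambda>y. f (\<tau> y)) x u v = hess f (\<tau> x) (dd \<tau> x u) (dd \<tau> x v) + dd f (\<tau> x) (dd (\<lambda>y. dd \<tau> y v) x u)"
proof -
  have d\<tau>: "(\<tau> has_derivative dd \<tau> y) (at y)" if "y \<in> S" for y
    by (rule differentiable_dd[OF smooth_onD[OF \<tau> that]])
  have comp: "dd (\<lambda>y. f (\<tau> y)) y v = dd f (\<tau> y) (dd \<tau> y v)" if "y \<in> S" for y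
    by (rule dd_eq, rule has_derivative_compose[OF d\<tau>[OF that]]) (rule differentiable_dd[OF smooth_onD[OF f T[OF that]]])
  have db: "((\<lambda>y. dd f (\<tau> y) b) has_derivative (\<lambda>u. hess f (\<tau> x) (dd \<tau> x u) b)) (at x)" for b
    unfolding hess_def
    by (rule has_derivative_compose[OF d\<tau>[OF S(2)] differentiable_dd[OF smooth_onD[OF smooth_on_dd[OF f] T[OF S(2)]]]])
  have "((\<lambda>y. dd f (\<tau> y) (dd \<tau> y v)) has_derivative
      (\<lambda>u. dd (\<lambda>y. dd f (\<tau> y) (dd \<tau> x v)) x u + dd f (\<tau> x) (dd (\<lambda>y. dd \<tau> y v) x u))) (at x)"
  proof (rule has_derivative_linear_family[OF S])
    show "linear (dd f (\<tau> y))" if "y \<in> S" for y by (rule linear_dd[OF smooth_onD[OF f T[OF that]]])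
    show "(\<lambda>y. dd f (\<tau> y) b) differentiable (at x)" for b using db differentiable_def by blast
    show "((\<lambda>y. dd \<tau> y v) has_derivative dd (\<lambda>y. dd \<tau> y v) x) (at x)"
      by (rule differentiable_dd[OF smooth_onD[OF smooth_on_dd[OF \<tau>] S(2)]])
  qed
  then have "dd (\<lambda>y. dd f (\<tau> y) (dd \<tau> y v)) x u =
      hess f (\<tau> x) (dd \<tau> x u) (dd \<tau> x v) + dd f (\<tau> x) (dd (\<lambda>y. dd \<tau> y v) x u)"
    by (simp add: dd_eq dd_eq[OF db])
  then show ?thesis
    unfolding hess_def using dd_cong_open[OF S comp] by simp
qed

context kaehler_manifold
begin

lemma has_derivative_trans:
  "c \<in> A \<Longrightarrow> d \<in> A \<Longrightarrow> x \<in> overlap c d \<Longrightarrow> (transition c d has_derivative dd (transition c d) x) (at x)"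
  by (rule differentiable_dd[OF smooth_onD[OF transition(2)]])

lemma has_derivative_function_trans:
  fixes f :: "'m \<Rightarrow> real"
  assumes "c \<in> A" "d \<in> A" "x \<in> overlap c d" "smooth_map A (euclidean_atlas UNIV) f"
  shows "dd (\<lambda>y. f (cinv c y)) x v = dd (\<lambda>y. f (cinv d y)) (transition c d x) (dd (transition c d) x v)"
proof -
  have "transition c d x \<in> cran d" using transition(8)[OF assms(2,1)] transition(3)[OF assms(1,2,3)] by blast
  then have "((\<lambda>y. f (cinv d (transition c d y))) has_derivative
      (\<lambda>v. dd (\<lambda>y. f (cinv d y)) (transition c d x) (dd (transition c d) x v))) (at x)"
    by (intro has_derivative_compose[OF has_derivative_trans[OF assms(1-3)]]
        differentiable_dd[OF smooth_onD[OF smooth_function_chart[OF assms(4,2)]]])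
  then have "((\<lambda>y. f (cinv c y)) has_derivative
      (\<lambda>v. dd (\<lambda>y. f (cinv d y)) (transition c d x) (dd (transition c d) x v))) (at x)"
    by (rule has_derivative_transform_within_open[OF _ transition(1)[OF assms(1,2)] assms(3)])
      (simp add: transition(5)[OF assms(1,2)])
  then show ?thesis by (rule dd_eq)
qed

text \<open>The second derivative of a holomorphic map is complex bilinear, and rotating both
  arguments multiplies it by \<open>-1\<close>.\<close>

lemma transition_second_derivative_J:
  assumes c: "c \<in> A" and d: "d \<in> A" and x: "x \<in> overlap c d"
  shows "dd (\<lambda>y. dd (transition c d) y (J v)) x (J u) = - dd (\<lambda>y. dd (transition c d) y v) x u"
proof -
  let ?\<tau> = "transition c d"
  have J1: "dd (\<lambda>y. dd ?\<tau> y (J v)) x u = J (dd (\<lambda>y. dd ?\<tau> y v) x u)" for u v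
  proof -
    have "dd (\<lambda>y. dd ?\<tau> y (J v)) x u = dd (\<lambda>y. J (dd ?\<tau> y v)) x u"
      by (rule fun_cong[OF dd_cong_open[OF transition(1)[OF c d] x]]) (rule transition(6)[OF c d])
    also have "\<dots> = J (dd (\<lambda>y. dd ?\<tau> y v) x u)"
      by (rule dd_eq, rule bounded_linear.has_derivative[OF bounded_linear_J])
        (rule differentiable_dd[OF smooth_onD[OF smooth_on_dd[OF transition(2)[OF c d]] x]])
    finally show ?thesis .
  qed
  have sym: "dd (\<lambda>y. dd ?\<tau> y v) x u = dd (\<lambda>y. dd ?\<tau> y u) x v" for u v
    by (rule smooth_on_dd_dd_symmetric[OF transition(1)[OF c d] x transition(2)[OF c d]])
  show ?thesis using J1[of v "J u"] sym[of v "J u"] J1[of u v] sym[of u v] by simp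
qed

definition dens :: "('m, complex^'n) chart \<Rightarrow> complex^'n \<Rightarrow> real" where
  "dens c = omega_power (g c)"

lemma dens:
  assumes "c \<in> A"
  shows "x \<in> cran c \<Longrightarrow> dens c x > 0" "smooth_on (cran c) (dens c)"
    "x \<in> cran c \<Longrightarrow> (dens c has_derivative (\<lambda>v. metric_chart.div_form (g c) x v * dens c x)) (at x)"
proof -
  interpret kaehler_chart "g c" "cran c" by (rule kaehler_chart[OF assms])
  show "x \<in> cran c \<Longrightarrow> dens c x > 0" "smooth_on (cran c) (dens c)"
    "x \<in> cran c \<Longrightarrow> (dens c has_derivative (\<lambda>v. metric_chart.div_form (g c) x v * dens c x)) (at x)"
    unfolding dens_def by (fact omega_power_pos smooth_omega_power has_derivative_omega_power)+
qed

lemma supported_in_chart: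
  fixes \<psi> :: "'m \<Rightarrow> 'b::zero"
  assumes c: "c \<in> A" and C: "compact C" "C \<subseteq> cdom c" and \<psi>: "\<And>p. p \<notin> C \<Longrightarrow> \<psi> p = 0"
    and S: "coord c ` C \<subseteq> S" "S \<subseteq> cran c" and w: "\<And>x. \<psi> (cinv c x) = 0 \<Longrightarrow> w x = 0"
  shows "supported_in S (coord c ` C) w"
proof -
  have "compact (coord c ` C)"
    by (rule compact_continuous_image[OF continuous_on_subset[OF charts(4)[OF c] C(2)] C(1)])
  moreover have "w x = 0" if "x \<in> S - coord c ` C" for x
  proof -
    have "cinv c x \<notin> C" using that S(2) charts(9)[OF c] by (metis DiffD1 DiffD2 imageI subsetD)
    then show ?thesis using \<psi> w by blast
  qed
  ultimately show ?thesis using S by (auto simp: supported_in_def)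
qed

text \<open>The density transforms by the absolute Jacobian determinant, so a change of variables
  along the transition equates the two integrals; as \<open>C\<close> lies in both domains, both
  integrands vanish off the overlap.\<close>

lemma integral_overlap:
  fixes \<psi> :: "'m \<Rightarrow> real"
  assumes c: "c \<in> A" and d: "d \<in> A" and C: "compact C" "C \<subseteq> cdom c" "C \<subseteq> cdom d"
    and \<psi>: "\<And>p. p \<notin> C \<Longrightarrow> \<psi> p = 0"
    and cont: "continuous_on (cran c) (\<lambda>x. \<psi> (cinv c x))" "continuous_on (cran d) (\<lambda>x. \<psi> (cinv d x))"
  shows "integral (cran c) (\<lambda>x. \<psi> (cinv c x) * dens c x) = integral (cran d) (\<lambda>x. \<psi> (cinv d x) * dens d x)"
proof -
  have restrict: "integral (cran c) (\<lambda>x. \<psi> (cinv c x) * dens c x) = integral (overlap c d) (\<lambda>x. \<psi> (cinv c x) * dens c x)"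
    if c: "c \<in> A" and C: "C \<subseteq> cdom d" for c d
  proof -
    have "(\<lambda>x. if x \<in> cran c then \<psi> (cinv c x) * dens c x else 0) =
      (\<lambda>x. if x \<in> overlap c d then \<psi> (cinv c x) * dens c x else 0)"
      using \<psi> C by (auto simp: overlap_def fun_eq_iff)
    then have "integral UNIV (\<lambda>x. if x \<in> cran c then \<psi> (cinv c x) * dens c x else 0) =
      integral UNIV (\<lambda>x. if x \<in> overlap c d then \<psi> (cinv c x) * dens c x else 0)" by simp
    then show ?thesis by (simp only: Henstock_Kurzweil_Integration.integral_restrict_UNIV)
  qed
  let ?D = "\<lambda>x. \<bar>det (\<chi> i j. dd (transition c d) x (real_frame i) \<bullet> real_frame j)\<bar>"
  have D: "?D x * (\<psi> (cinv d (transition c d x)) * dens d (transition c d x)) = \<psi> (cinv c x) * dens c x"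
    if x: "x \<in> overlap c d" for x
  proof -
    interpret kd: kaehler_chart "g d" "cran d" by (rule kaehler_chart[OF d])
    have y: "transition c d x \<in> cran d" using transition(3)[OF c d x] by (simp add: overlap_def)
    have "dens c x = ?D x * dens d (transition c d x)"
      unfolding dens_def
      by (rule omega_power_transform[where k = "g d" and h = "g c"])
        (use kd.bilinear_h[OF y] x transition(6,7)[OF c d x] dens(1)[OF c, of x] dens(1)[OF d y] in \<open>auto simp: dens_def overlap_def\<close>)
    then show ?thesis by (simp add: transition(5)[OF c d x])
  qed
  have sub: "coord d ` C \<subseteq> overlap d c" "coord c ` C \<subseteq> overlap c d"
    using C(2,3) charts(6,8)[OF c] charts(6,8)[OF d] by (auto simp: overlap_def subset_iff)
  have cd: "continuous_on (overlap d c) (\<lambda>x. \<psi> (cinv d x) * dens d x)"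
    by (rule continuous_on_subset[OF continuous_on_mult[OF cont(2) smooth_on_continuous[OF dens(2)[OF d]]] transition(8)[OF d c]])
  have cc: "continuous_on (overlap c d) (\<lambda>x. \<psi> (cinv c x) * dens c x)"
    by (rule continuous_on_subset[OF continuous_on_mult[OF cont(1) smooth_on_continuous[OF dens(2)[OF c]]] transition(8)[OF c d]])
  have "integral (overlap d c) (\<lambda>x. \<psi> (cinv d x) * dens d x) =
      integral (overlap c d) (\<lambda>x. ?D x * (\<psi> (cinv d (transition c d x)) * dens d (transition c d x)))"
  proof (rule integral_change_of_variables_complex[OF transition(1)[OF c d] transition(1)[OF d c] _ _ has_derivative_trans[OF c d] refl cd])
    show "inj_on (transition c d) (overlap c d)" using transition(4)[OF c d] by (rule inj_on_inverseI)
    show "transition c d ` overlap c d = overlap d c"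
      using transition(3)[OF c d] transition(3,4)[OF d c] by (metis image_eqI subsetI image_subsetI subset_antisym)
    show "supported_in (overlap d c) (coord d ` C) (\<lambda>x. \<psi> (cinv d x) * dens d x)"
      by (rule supported_in_chart[OF d C(1,3) \<psi> sub(1) transition(8)[OF d c]]) auto
    show "continuous_on (overlap c d) (\<lambda>x. ?D x * (\<psi> (cinv d (transition c d x)) * dens d (transition c d x)))"
      using cc by (rule continuous_on_eq) (simp add: D)
    have "supported_in (overlap c d) (coord c ` C) (\<lambda>x. \<psi> (cinv c x) * dens c x)"
      by (rule supported_in_chart[OF c C(1,2) \<psi> sub(2) transition(8)[OF c d]]) auto
    then show "supported_in (overlap c d) (coord c ` C) (\<lambda>x. ?D x * (\<psi> (cinv d (transition c d x)) * dens d (transition c d x)))"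
      by (auto simp: supported_in_def D)
  qed
  also have "\<dots> = integral (overlap c d) (\<lambda>x. \<psi> (cinv c x) * dens c x)"
    by (rule Henstock_Kurzweil_Integration.integral_cong) (rule D)
  finally show ?thesis using restrict[OF c C(3)] restrict[OF d C(2)] by simp
qed

end

context kaehler_manifold
begin

lemma partition:
  assumes "partition_of_unity A P \<rho>"
  shows "finite P" "c \<in> P \<Longrightarrow> c \<in> A" "c \<in> P \<Longrightarrow> smooth_map A (euclidean_atlas UNIV) (\<rho> c)"
    "c \<in> P \<Longrightarrow> \<rho> c p \<ge> 0" "c \<in> P \<Longrightarrow> closure {p. \<rho> c p \<noteq> 0} \<subseteq> cdom c"
    "c \<in> P \<Longrightarrow> compact (closure {p. \<rho> c p \<noteq> 0})" "(\<Sum>c\<in>P. \<rho> c p) = 1"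
    "p \<notin> closure {p. \<rho> c p \<noteq> 0} \<Longrightarrow> \<rho> c p = 0"
proof -
  show "compact (closure {p. \<rho> c p \<noteq> 0})"
    using compact_Int_closed[OF compact_M closed_closure] by simp
  show "p \<notin> closure {p. \<rho> c p \<noteq> 0} \<Longrightarrow> \<rho> c p = 0"
    using closure_subset[of "{p. \<rho> c p \<noteq> 0}"] by blast
  note p = assms[unfolded partition_of_unity_def]
  show "finite P" "c \<in> P \<Longrightarrow> c \<in> A" "c \<in> P \<Longrightarrow> smooth_map A (euclidean_atlas UNIV) (\<rho> c)"
    "c \<in> P \<Longrightarrow> \<rho> c p \<ge> 0" "c \<in> P \<Longrightarrow> closure {p. \<rho> c p \<noteq> 0} \<subseteq> cdom c" "(\<Sum>c\<in>P. \<rho> c p) = 1"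
    using p by blast+
qed

text \<open>The derivatives of the functions of the partition along \<open>Z\<close> cancel; they are collected in a
  common chart by means of \<open>integral_overlap\<close>.\<close>

lemma divergence_theorem:
  assumes part: "partition_of_unity A P \<rho>"
    and Z: "\<And>c. c \<in> A \<Longrightarrow> smooth_on (cran c) (Z c)"
    and Z_trans: "\<And>c d x. c \<in> A \<Longrightarrow> d \<in> A \<Longrightarrow> x \<in> overlap c d \<Longrightarrow> Z d (transition c d x) = dd (transition c d) x (Z c x)"
  shows "(\<Sum>c\<in>P. integral (cran c) (\<lambda>x. \<rho> c (cinv c x) * dens c x *
    (tr (dd (Z c) x) + metric_chart.div_form (g c) x (Z c x)))) = 0"
proof -
  note P = partition[OF part]
  define K where "K c = closure {p. \<rho> c p \<noteq> 0}" for c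
  have \<rho>_0: "\<rho> c p = 0" if "p \<notin> K c" for c p
    by (rule P(8)) (use that in \<open>simp add: K_def\<close>)
  have smooth_\<rho>: "smooth_on (cran d) (\<lambda>y. \<rho> c (cinv d y))" if "c \<in> P" "d \<in> A" for c d
    by (rule smooth_function_chart[OF P(3)[OF that(1)] that(2)])
  \<comment> \<open>\<open>\<theta> c\<close> is the derivative of \<open>\<rho> c\<close> along
    \<open>Z\<close> as a function on the manifold; \<open>SOME\<close> picks a chart, and the
    transformation law of \<open>Z\<close> makes the choice immaterial.\<close>
  define \<theta> where "\<theta> c p = (let d = SOME d. d \<in> A \<and> p \<in> cdom d in
    dd (\<lambda>y. \<rho> c (cinv d y)) (coord d p) (Z d (coord d p)))" for c p
  have \<theta>: "\<theta> c (cinv d y) = dd (\<lambda>y. \<rho> c (cinv d y)) y (Z d y)" if c: "c \<in> P" and d: "d \<in> A" and y: "y \<in> cran d" for c d y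
  proof -
    define d' where "d' = (SOME d'. d' \<in> A \<and> cinv d y \<in> cdom d')"
    have d': "d' \<in> A" "cinv d y \<in> cdom d'"
      using someI[of "\<lambda>d'. d' \<in> A \<and> cinv d y \<in> cdom d'" d] d charts(7)[OF d y] by (simp_all add: d'_def)
    have x: "y \<in> overlap d d'" using y d' by (simp add: overlap_def)
    have "\<theta> c (cinv d y) = dd (\<lambda>y. \<rho> c (cinv d' y)) (transition d d' y) (Z d' (transition d d' y))"
      by (simp add: \<theta>_def d'_def[symmetric] transition_def Let_def)
    also have "\<dots> = dd (\<lambda>y. \<rho> c (cinv d y)) y (Z d y)"
      unfolding Z_trans[OF d d'(1) x] by (rule has_derivative_function_trans[OF d d'(1) x P(3)[OF c], symmetric])
    finally show ?thesis .
  qed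
  have \<theta>_0: "\<theta> c p = 0" if c: "c \<in> P" and p: "p \<notin> K c" for c p
  proof -
    obtain d where d: "d \<in> A" "p \<in> cdom d" by (rule chart_exists)
    have "open (cran d \<inter> cinv d -` (- K c))"
      by (rule continuous_open_preimage[OF charts(5,2)[OF d(1)]]) (simp add: K_def open_Compl)
    moreover have "coord d p \<in> cran d \<inter> cinv d -` (- K c)" using p d charts(6,8)[OF d(1)] by auto
    moreover have "\<rho> c (cinv d y) = 0" if "y \<in> cran d \<inter> cinv d -` (- K c)" for y
      using that \<rho>_0 by auto
    ultimately have "dd (\<lambda>y. \<rho> c (cinv d y)) (coord d p) = dd (\<lambda>y. 0) (coord d p)"
      by (rule dd_cong_open)
    then have "\<theta> c (cinv d (coord d p)) = 0"
      using \<theta>[OF c d(1) charts(6)[OF d]] by simp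
    then show ?thesis using charts(8)[OF d] by simp
  qed
  have cont_\<theta>: "continuous_on (cran d) (\<lambda>y. \<theta> c (cinv d y))" if "c \<in> P" "d \<in> A" for c d
  proof -
    have "continuous_on (cran d) (\<lambda>y. \<Sum>b\<in>Basis. (Z d y \<bullet> b) *\<^sub>R dd (\<lambda>y. \<rho> c (cinv d y)) y b)"
      by (intro continuous_intros smooth_on_continuous smooth_on_dd smooth_\<rho> that Z)
    then show ?thesis
    proof (rule continuous_on_eq)
      fix y assume y: "y \<in> cran d"
      show "(\<Sum>b\<in>Basis. (Z d y \<bullet> b) *\<^sub>R dd (\<lambda>y. \<rho> c (cinv d y)) y b) = \<theta> c (cinv d y)"
        unfolding \<theta>[OF that y]
        by (rule linear_basis_sum[OF linear_dd[OF smooth_onD[OF smooth_\<rho>[OF that] y]], symmetric])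
    qed
  qed
  have sum_\<theta>: "(\<Sum>c\<in>P. \<theta> c p) = 0" for p
  proof -
    obtain d where d: "d \<in> A" "p \<in> cdom d" by (rule chart_exists)
    let ?x = "coord d p"
    have x: "?x \<in> cran d" by (rule charts(6)[OF d])
    have "((\<lambda>y. \<Sum>c\<in>P. \<rho> c (cinv d y)) has_derivative (\<lambda>v. \<Sum>c\<in>P. dd (\<lambda>y. \<rho> c (cinv d y)) ?x v)) (at ?x)"
      by (intro has_derivative_sum differentiable_dd smooth_onD[OF smooth_\<rho> x] d)
    moreover have "(\<lambda>y. \<Sum>c\<in>P. \<rho> c (cinv d y)) = (\<lambda>y. 1)" by (simp add: P(7))
    ultimately have "(\<Sum>c\<in>P. dd (\<lambda>y. \<rho> c (cinv d y)) ?x (Z d ?x)) = 0"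
      using fun_cong[OF has_derivative_unique[OF _ has_derivative_const]] by fastforce
    then show ?thesis using \<theta>[OF _ d(1) x] charts(8)[OF d] by simp
  qed
  have cont_\<rho>: "continuous_on (cran d) (\<lambda>y. \<rho> c (cinv d y))" if "c \<in> P" "d \<in> A" for c d
    by (rule smooth_on_continuous[OF smooth_\<rho>[OF that]])
  have supp: "supported_in (cran c) (coord c ` K c') w"
    if "c' \<in> P" "c \<in> A" "K c' \<subseteq> cdom c" "\<And>x. x \<in> cran c \<Longrightarrow> cinv c x \<notin> K c' \<Longrightarrow> w x = 0"
    for c c' and w :: "_ \<Rightarrow> real"
    using compact_continuous_image[OF continuous_on_subset[OF charts(4)[OF that(2)] that(3)]] P(6)[OF that(1)]
      charts(6,9)[OF that(2)] that by (fastforce simp: supported_in_def K_def image_iff)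
  \<comment> \<open>By the Leibniz rule the weighted divergence is the coordinate divergence of the
    compactly supported functions \<open>?u b\<close>, which integrates to zero, minus the term with
    \<open>\<theta>\<close>.\<close>
  have chart: "integral (cran c) (\<lambda>x. \<rho> c (cinv c x) * dens c x *
      (tr (dd (Z c) x) + metric_chart.div_form (g c) x (Z c x))) = - integral (cran c) (\<lambda>x. \<theta> c (cinv c x) * dens c x)"
    if cP: "c \<in> P" for c
  proof -
    have c: "c \<in> A" using P(2) cP .
    interpret kc: kaehler_chart "g c" "cran c" by (rule kaehler_chart[OF c])
    have Kc: "K c \<subseteq> cdom c" using P(5)[OF cP] by (simp add: K_def open_Compl)
    let ?r = "\<lambda>x. \<rho> c (cinv c x)"
    let ?u = "\<lambda>b x. ?r x * dens c x * (Z c x \<bullet> b)"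
    have smooth_u: "smooth_on (cran c) (?u b)" for b
      by (intro smooth_on_bilinear[OF kc.open_S bounded_bilinear_mult] smooth_\<rho> cP c dens(2)
          smooth_on_bounded_linear[OF kc.open_S bounded_linear_inner_left] Z)
    have supp_u: "supported_in (cran c) (coord c ` K c) (?u b)" for b
      by (rule supp[OF cP c Kc]) (use \<rho>_0 in auto)
    have int0: "integral (cran c) (\<lambda>x. dd (?u b) x b) = 0" for b
      using smooth_u by (intro integral_directional_derivative[OF kc.open_S _ supp_u]) (auto simp: smooth_on_def)
    have du: "dd (?u b) x v = (dd ?r x v * dens c x + ?r x * (kc.div_form x v * dens c x)) * (Z c x \<bullet> b) +
        ?r x * dens c x * (dd (Z c) x v \<bullet> b)" if x: "x \<in> cran c" for b v x
    proof -
      have 1: "(?r has_derivative dd ?r x) (at x)" by (rule differentiable_dd[OF smooth_onD[OF smooth_\<rho>[OF cP c] x]])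
      have 2: "(Z c has_derivative dd (Z c) x) (at x)" by (rule differentiable_dd[OF smooth_onD[OF Z[OF c] x]])
      show ?thesis
        by (rule dd_eq) (auto intro!: derivative_eq_intros 1 2 dens(3)[OF c x] simp: algebra_simps)
    qed
    have sum_du: "(\<Sum>b\<in>Basis. dd (?u b) x b) = \<theta> c (cinv c x) * dens c x +
        ?r x * dens c x * (tr (dd (Z c) x) + kc.div_form x (Z c x))" if x: "x \<in> cran c" for x
    proof -
      have l1: "dd ?r x (Z c x) = (\<Sum>b\<in>Basis. (Z c x \<bullet> b) * dd ?r x b)"
        by (rule linear_basis_sum[OF linear_dd[OF smooth_onD[OF smooth_\<rho>[OF cP c] x]], unfolded real_scaleR_def])
      have l2: "kc.div_form x (Z c x) = (\<Sum>b\<in>Basis. (Z c x \<bullet> b) * kc.div_form x b)"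
        by (rule linear_basis_sum[OF kc.linear_div_form[OF x], unfolded real_scaleR_def])
      show ?thesis
        unfolding du[OF x] \<theta>[OF cP c x] l1 l2 tr_def sum_distrib_right sum.distrib[symmetric] sum_distrib_left
        by (rule sum.cong[OF refl]) (simp only: distrib_left distrib_right mult_ac add_ac)
    qed
    have int_du: "(\<lambda>x. dd (?u b) x b) integrable_on cran c" for b
    proof (rule integrable_supported[OF kc.open_S smooth_on_continuous[OF smooth_on_dd[OF smooth_u]]])
      show "supported_in (cran c) (coord c ` K c) (\<lambda>x. dd (?u b) x b)"
      proof (rule supp[OF cP c Kc])
        fix x assume x: "x \<in> cran c" "cinv c x \<notin> K c"
        have "open (cran c \<inter> cinv c -` (- K c))"
          by (rule continuous_open_preimage[OF charts(5,2)[OF c]]) (simp add: K_def open_Compl)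
        moreover have "x \<in> cran c \<inter> cinv c -` (- K c)" using x by simp
        moreover have "?u b y = 0" if "y \<in> cran c \<inter> cinv c -` (- K c)" for y
          using that \<rho>_0 by auto
        ultimately have "dd (?u b) x = dd (\<lambda>y. 0) x" by (rule dd_cong_open)
        then show "dd (?u b) x b = 0" by simp
      qed
    qed
    have int_\<theta>: "(\<lambda>x. \<theta> c (cinv c x) * dens c x) integrable_on cran c"
      by (rule integrable_supported[OF kc.open_S continuous_on_mult[OF cont_\<theta>[OF cP c] smooth_on_continuous[OF dens(2)[OF c]]]])
        (rule supp[OF cP c Kc], use \<theta>_0[OF cP] in auto)
    have "integral (cran c) (\<lambda>x. ?r x * dens c x * (tr (dd (Z c) x) + kc.div_form x (Z c x))) =
        integral (cran c) (\<lambda>x. (\<Sum>b\<in>Basis. dd (?u b) x b) - \<theta> c (cinv c x) * dens c x)"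
      by (rule Henstock_Kurzweil_Integration.integral_cong) (simp add: sum_du)
    also have "\<dots> = integral (cran c) (\<lambda>x. \<Sum>b\<in>Basis. dd (?u b) x b) - integral (cran c) (\<lambda>x. \<theta> c (cinv c x) * dens c x)"
      by (rule Henstock_Kurzweil_Integration.integral_diff) (auto intro: integrable_sum int_du int_\<theta>)
    also have "integral (cran c) (\<lambda>x. \<Sum>b\<in>Basis. dd (?u b) x b) = (\<Sum>b\<in>Basis. integral (cran c) (\<lambda>x. dd (?u b) x b))"
      by (rule Henstock_Kurzweil_Integration.integral_sum) (auto intro: int_du)
    finally show ?thesis by (simp add: int0)
  qed
  \<comment> \<open>Inserting \<open>1\<close> as the sum of the \<open>\<rho> d\<close> gives terms
    supported in both \<open>cdom c\<close> and \<open>cdom d\<close>. Such a term can be moved from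
    the chart \<open>c\<close> to the chart \<open>d\<close>, where the sum over \<open>c\<close>
    meets the derivative of the constant 1.\<close>
  define I where "I c d a = integral (cran a) (\<lambda>x. \<rho> d (cinv a x) * \<theta> c (cinv a x) * dens a x)" for c d a
  have intI: "(\<lambda>x. \<rho> d (cinv a x) * \<theta> c (cinv a x) * dens a x) integrable_on cran a"
    if "c \<in> P" "d \<in> P" "a = c \<or> a = d" for a c d
  proof -
    have a: "a \<in> P" using that by auto
    note a = a P(2)[OF a]
    show ?thesis
      by (rule integrable_supported[OF charts(2)[OF a(2)] continuous_on_mult[OF continuous_on_mult[OF cont_\<rho>[OF that(2) a(2)] cont_\<theta>[OF that(1) a(2)]] smooth_on_continuous[OF dens(2)[OF a(2)]]]])
        (rule supp[OF a P(5)[OF a(1), folded K_def]], use \<theta>_0[OF that(1)] that(3) \<rho>_0 in \<open>metis mult_zero_left mult_zero_right\<close>)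
  qed
  have "(\<Sum>c\<in>P. integral (cran c) (\<lambda>x. \<theta> c (cinv c x) * dens c x)) = (\<Sum>c\<in>P. \<Sum>d\<in>P. I c d c)"
  proof (rule sum.cong[OF refl])
    fix c assume c: "c \<in> P"
    have "integral (cran c) (\<lambda>x. \<theta> c (cinv c x) * dens c x) =
        integral (cran c) (\<lambda>x. \<Sum>d\<in>P. \<rho> d (cinv c x) * \<theta> c (cinv c x) * dens c x)"
      by (simp add: P(7) flip: sum_distrib_right)
    also have "\<dots> = (\<Sum>d\<in>P. I c d c)"
      unfolding I_def by (rule Henstock_Kurzweil_Integration.integral_sum[OF P(1)]) (use intI c in auto)
    finally show "integral (cran c) (\<lambda>x. \<theta> c (cinv c x) * dens c x) = (\<Sum>d\<in>P. I c d c)" .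
  qed
  also have "\<dots> = (\<Sum>c\<in>P. \<Sum>d\<in>P. I c d d)"
  proof (intro sum.cong refl)
    fix c d assume cd: "c \<in> P" "d \<in> P"
    have A: "c \<in> A" "d \<in> A" using cd P(2) by blast+
    show "I c d c = I c d d"
      unfolding I_def
    proof (rule integral_overlap[OF A, of "K c \<inter> K d"])
      show "compact (K c \<inter> K d)" using P(6)[OF cd(1)] by (auto simp: K_def intro: compact_Int_closed)
      show "K c \<inter> K d \<subseteq> cdom c" "K c \<inter> K d \<subseteq> cdom d" using P(5)[OF cd(1)] P(5)[OF cd(2)] by (auto simp: K_def)
      show "\<rho> d p * \<theta> c p = 0" if "p \<notin> K c \<inter> K d" for p
        using that \<theta>_0[OF cd(1)] \<rho>_0 by (metis IntI mult_zero_left mult_zero_right)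
    qed (intro continuous_on_mult cont_\<rho> cont_\<theta> cd A)+
  qed
  also have "\<dots> = (\<Sum>d\<in>P. \<Sum>c\<in>P. I c d d)" by (rule sum.swap)
  also have "\<dots> = (\<Sum>d\<in>P. 0)"
  proof (rule sum.cong[OF refl])
    fix d assume d: "d \<in> P"
    have "(\<Sum>c\<in>P. I c d d) = integral (cran d) (\<lambda>x. \<Sum>c\<in>P. \<rho> d (cinv d x) * \<theta> c (cinv d x) * dens d x)"
      unfolding I_def by (rule Henstock_Kurzweil_Integration.integral_sum[OF P(1), symmetric]) (use intI d in auto)
    also have "\<dots> = 0"
      by (simp add: sum_\<theta> flip: sum_distrib_right sum_distrib_left)
    finally show "(\<Sum>c\<in>P. I c d d) = 0" .
  qed
  finally show ?thesis using chart by (simp add: sum_negf)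
qed

end

section \<open>The divergence of the rotated fundamental fields\<close>

context hamiltonian_kaehler
begin

lemma smooth_ham_fun: "smooth_map A (euclidean_atlas UNIV) (\<lambda>p. blinfun_apply (\<mu> p) \<xi>)"
  unfolding smooth_map_def
proof (intro conjI ballI)
  fix c :: "('m, complex^'n) chart" and d :: "(real, real) chart"
  assume c: "c \<in> A" and d: "d \<in> euclidean_atlas UNIV"
  have "rep_dom c d (\<lambda>p. blinfun_apply (\<mu> p) \<xi>) = cran c"
    using d by (simp add: rep_dom_eq[OF atlas c] euclidean_atlas_def cdom_def)
  moreover have "rep c d (\<lambda>p. blinfun_apply (\<mu> p) \<xi>) = ham c \<xi>"
    using d by (simp add: fun_eq_iff rep_apply euclidean_atlas_def coord_def ham_def)
  ultimately show "smooth_on (rep_dom c d (\<lambda>p. blinfun_apply (\<mu> p) \<xi>)) (rep c d (\<lambda>p. blinfun_apply (\<mu> p) \<xi>))"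
    using smooth_ham[OF c] by simp
next
  have "continuous_on UNIV \<mu>" by (rule continuous_smooth_function[OF smooth_\<mu>])
  then have "continuous_on UNIV (\<lambda>p. blinfun_apply (\<mu> p) \<xi>)" by (intro continuous_intros)
  then show "continuous_on (\<Union>c\<in>A. cdom c) (\<lambda>p. blinfun_apply (\<mu> p) \<xi>)"
    by (rule continuous_on_subset) simp
qed (auto simp: euclidean_atlas_def cdom_def)

context
  fixes c d x assumes c: "c \<in> A" and d: "d \<in> A" and x: "x \<in> overlap c d"
begin

lemma transition_in: "x \<in> cran c" "transition c d x \<in> cran d"
  using x transition(3)[OF c d x] by (auto simp: overlap_def)

lemma dd_ham_trans: "dd (ham c \<xi>) x v = dd (ham d \<xi>) (transition c d x) (dd (transition c d) x v)"
  using has_derivative_function_trans[OF c d x smooth_ham_fun] by (simp add: ham_def[abs_def])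

text \<open>Since \<open>\<omega>\<close> is nondegenerate, the field is determined by the
  differential of its Hamiltonian function, whose behaviour under transitions is known.\<close>

lemma fund_trans: "fund d \<xi> (transition c d x) = dd (transition c d) x (fund c \<xi> x)"
proof -
  interpret kd: kaehler_chart "g d" "cran d" by (rule kaehler_chart[OF d])
  obtain M where M: "\<And>v. dd (transition c d) x (M v) = v" using transition_bij[OF c d x] by metis
  show ?thesis
  proof (rule kd.nondegenerate[OF transition_in(2)])
    fix w
    \<comment> \<open>Chosen so that \<open>J v\<close> has image \<open>w\<close>: the derivative
      commutes with \<open>J\<close>, and \<open>J (J w) = - w\<close>.\<close>
    define v where "v = - M (J w)"
    have lin: "linear (dd (transition c d) x)" by (rule linear_dd[OF smooth_onD[OF transition(2)[OF c d] x]])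
    have w: "w = dd (transition c d) x (J v)"
      by (simp add: transition(6)[OF c d x] v_def linear_neg[OF lin] M)
    have "g d (transition c d x) (J (dd (transition c d) x v)) (fund d \<xi> (transition c d x)) = dd (ham c \<xi>) x v"
      by (simp add: dd_ham_trans moment_ham[OF d transition_in(2)])
    also have "\<dots> = g c x (J v) (fund c \<xi> x)" by (rule moment_ham[OF c transition_in(1)])
    also have "\<dots> = g d (transition c d x) (dd (transition c d) x (J v)) (dd (transition c d) x (fund c \<xi> x))"
      by (simp add: transition(7)[OF c d x])
    finally show "g d (transition c d x) (fund d \<xi> (transition c d x)) w = g d (transition c d x) (dd (transition c d) x (fund c \<xi> x)) w"
      unfolding w by (simp add: transition(6)[OF c d x] kd.sym[OF transition_in(2)])
  qed
qed

text \<open>The second derivatives of the transition in the two terms cancel by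
  \<open>transition_second_derivative_J\<close>.\<close>

lemma complex_hess_trans:
  "hess (ham c \<xi>) x u v + hess (ham c \<xi>) x (J u) (J v) =
   hess (ham d \<xi>) (transition c d x) (dd (transition c d) x u) (dd (transition c d) x v) +
   hess (ham d \<xi>) (transition c d x) (J (dd (transition c d) x u)) (J (dd (transition c d) x v))"
proof -
  have h: "hess (ham c \<xi>) x u v = hess (ham d \<xi>) (transition c d x) (dd (transition c d) x u) (dd (transition c d) x v) +
      dd (ham d \<xi>) (transition c d x) (dd (\<lambda>y. dd (transition c d) y v) x u)" for u v
  proof -
    have "hess (\<lambda>y. ham d \<xi> (transition c d y)) x u v = hess (ham d \<xi>) (transition c d x) (dd (transition c d) x u) (dd (transition c d) x v) +
      dd (ham d \<xi>) (transition c d x) (dd (\<lambda>y. dd (transition c d) y v) x u)"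
      using transition(3)[OF c d] transition(8)[OF d c]
      by (intro hess_compose[OF transition(1)[OF c d] x _ transition(2)[OF c d] smooth_ham[OF d]]) auto
    moreover have "hess (ham c \<xi>) x u v = hess (\<lambda>y. ham d \<xi> (transition c d y)) x u v"
    proof -
      have "ham c \<xi> y = ham d \<xi> (transition c d y)" if "y \<in> overlap c d" for y
        by (simp add: ham_def transition(5)[OF c d that])
      from dd_cong_open[OF transition(1)[OF c d] _ this]
      have "dd (ham c \<xi>) y v = dd (\<lambda>y. ham d \<xi> (transition c d y)) y v" if "y \<in> overlap c d" for y
        using that by simp
      from dd_cong_open[OF transition(1)[OF c d] x this] show ?thesis by (simp add: hess_def)
    qed
    ultimately show ?thesis by simp
  qed
  have "linear (dd (ham d \<xi>) (transition c d x))" by (rule linear_dd[OF smooth_onD[OF smooth_ham[OF d] transition_in(2)]])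
  then show ?thesis
    by (simp add: h transition_second_derivative_J[OF c d x] transition(6)[OF c d x] linear_neg)
qed

text \<open>By \<open>complex_hess\<close> the metric and the \<open>J\<close>-invariant Hessian
  determine \<open>J \<nabla>X\<close>. Both are tensors, so this endomorphism is conjugated by the
  derivative of the transition and keeps its trace.\<close>

lemma div_J_trans:
  "killing_chart.div_J (g d) (fund d \<xi>) (transition c d x) = killing_chart.div_J (g c) (fund c \<xi>) x"
proof -
  interpret kc: killing_chart "g c" "cran c" "fund c \<xi>" "ham c \<xi>" by (rule killing_chart[OF c])
  interpret kd: killing_chart "g d" "cran d" "fund d \<xi>" "ham d \<xi>" by (rule killing_chart[OF d])
  let ?y = "transition c d x" and ?L = "dd (transition c d) x"
  obtain M where M: "linear M" "\<And>v. M (?L v) = v" "\<And>v. ?L (M v) = v" using transition_bij[OF c d x] by metis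
  have lin: "linear ?L" by (rule linear_dd[OF smooth_onD[OF transition(2)[OF c d] x]])
  have nab: "J (kd.nab ?y (?L u)) = ?L (J (kc.nab x u))" for u
  proof (rule kd.nondegenerate[OF transition_in(2)])
    fix w
    have "- 2 * g d ?y (J (kd.nab ?y (?L u))) (?L (M w)) = - 2 * g c x (J (kc.nab x u)) (M w)"
      using complex_hess_trans[of \<xi> u "M w"]
      by (simp only: kc.complex_hess[OF transition_in(1)] kd.complex_hess[OF transition_in(2)])
    also have "\<dots> = - 2 * g d ?y (?L (J (kc.nab x u))) (?L (M w))" by (simp only: transition(7)[OF c d x])
    finally show "g d ?y (J (kd.nab ?y (?L u))) w = g d ?y (?L (J (kc.nab x u))) w" by (simp add: M)
  qed
  have "kd.div_J ?y = tr (\<lambda>v. ?L (J (kc.nab x (M v))))"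
    unfolding kd.div_J_def by (rule arg_cong[of _ _ tr]) (simp add: fun_eq_iff M flip: nab)
  also have "\<dots> = tr (\<lambda>v. J (kc.nab x (M (?L v))))"
    using tr_comp_commute[OF lin linear_compose[OF M(1) linear_compose[OF kc.linear_nab[OF transition_in(1)] linear_J]]]
    by (simp add: o_def)
  finally show ?thesis by (simp add: M kc.div_J_def)
qed

end

definition div_J_fund :: "'k \<Rightarrow> 'm \<Rightarrow> real" where
  "div_J_fund \<xi> p = (let c = SOME c. c \<in> A \<and> p \<in> cdom c in
    killing_chart.div_J (g c) (fund c \<xi>) (coord c p))"

lemma div_J_fund:
  assumes c: "c \<in> A" and x: "x \<in> cran c"
  shows "div_J_fund \<xi> (cinv c x) = killing_chart.div_J (g c) (fund c \<xi>) x"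
proof -
  define d where "d = (SOME d. d \<in> A \<and> cinv c x \<in> cdom d)"
  have d: "d \<in> A" "cinv c x \<in> cdom d"
    using someI[of "\<lambda>d. d \<in> A \<and> cinv c x \<in> cdom d" c] c charts(7)[OF c x] by (simp_all add: d_def)
  have "x \<in> overlap c d" using x d by (simp add: overlap_def)
  from div_J_trans[OF c d(1) this] show ?thesis
    by (simp add: div_J_fund_def d_def[symmetric] transition_def Let_def)
qed

text \<open>The divergence of \<open>J X\<close> is \<open>2 l\<close> times the Hamiltonian function of \<open>X\<close> plus a constant, which
  vanishes since the integrals of both functions do. If \<open>l = 0\<close>, then the divergence of the
  Hamiltonian function times \<open>J X\<close> is minus the square norm of \<open>X\<close>, so that \<open>X = 0\<close>.\<close>

lemma einstein_div_J_fund: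
  assumes einstein: "\<And>c x u v. c \<in> A \<Longrightarrow> x \<in> cran c \<Longrightarrow> ricci (g c) x u v = l * g c x u v"
    and int: "has_omega_integral A g \<mu> 0"
  shows "div_J_fund \<xi> p = 0 \<longleftrightarrow> blinfun_apply (\<mu> p) \<xi> = 0"
proof -
  let ?f = "\<lambda>p. blinfun_apply (\<mu> p) \<xi>"
  obtain P \<rho> where part: "partition_of_unity A P \<rho>"
    and int0: "0 = (\<Sum>c\<in>P. integral (cran c) (\<lambda>x. (\<rho> c (cinv c x) * omega_power (g c) x) *\<^sub>R \<mu> (cinv c x)))"
    using int unfolding has_omega_integral_def by blast
  note P = partition[OF part]
  have supp: "supported_in (cran c) (coord c ` closure {p. \<rho> c p \<noteq> 0}) w"
    if c: "c \<in> P" and w: "\<And>x. \<rho> c (cinv c x) = 0 \<Longrightarrow> w x = 0" for c and w :: "_ \<Rightarrow> 'z::zero"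
  proof (rule supported_in_chart[OF P(2)[OF c] P(6)[OF c] P(5)[OF c], of "\<rho> c"])
    show "coord c ` closure {p. \<rho> c p \<noteq> 0} \<subseteq> cran c"
      using P(5)[OF c] charts(6)[OF P(2)[OF c]] by blast
    show "\<rho> c p = 0" if "p \<notin> closure {p. \<rho> c p \<noteq> 0}" for p by (rule P(8)[OF that])
  qed (simp, rule w)
  have cont_\<rho>: "continuous_on (cran c) (\<lambda>x. \<rho> c (cinv c x) * dens c x)" if "c \<in> P" for c
    by (intro continuous_on_mult smooth_on_continuous smooth_function_chart dens P that)
  have cont_f: "continuous_on (cran c) (ham c \<xi>)" if "c \<in> P" for c
    by (intro smooth_on_continuous smooth_ham P that)
  define m where "m = (\<Sum>c\<in>P. integral (cran c) (\<lambda>x. \<rho> c (cinv c x) * dens c x))"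
  have nonneg: "\<rho> c (cinv c x) * dens c x \<ge> 0" if "c \<in> P" "x \<in> cran c" for c x
    using P(4)[OF that(1)] dens(1)[OF P(2)[OF that(1)] that(2)] by simp
  have exists_\<rho>: "\<exists>c\<in>P. p \<in> cdom c \<and> \<rho> c p > 0" for p
  proof (rule ccontr)
    assume "\<not> ?thesis"
    then have none: "\<not> \<rho> c p > 0" if "c \<in> P" "p \<in> cdom c" for c using that by blast
    have "\<rho> c p = 0" if c: "c \<in> P" for c
    proof (cases "p \<in> cdom c")
      case True
      then show ?thesis using P(4)[OF c, of p] none[OF c] by linarith
    next
      case False
      then show ?thesis using P(5)[OF c] by (intro P(8)) blast
    qed
    then show False using P(7)[of p] by simp
  qed
  \<comment> \<open>A nonnegative function with zero weighted integral has zero integral in each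
    chart of the partition, hence vanishes wherever the weight is positive. It is applied to the
    constant 1, to show that the volume \<open>m\<close> is nonzero, and to the square norm of
    \<open>X\<close>.\<close>
  have weight_0: "W c x = 0"
    if w: "\<And>c. c \<in> P \<Longrightarrow> continuous_on (cran c) (\<lambda>x. W c x)" "\<And>c x. c \<in> P \<Longrightarrow> x \<in> cran c \<Longrightarrow> W c x \<ge> 0"
      "(\<Sum>c\<in>P. integral (cran c) (\<lambda>x. \<rho> c (cinv c x) * dens c x * W c x)) = 0"
      and c: "c \<in> P" "x \<in> cran c" "\<rho> c (cinv c x) > 0" for W :: "_ \<Rightarrow> _ \<Rightarrow> real" and c x
  proof -
    let ?I = "\<lambda>c. integral (cran c) (\<lambda>x. \<rho> c (cinv c x) * dens c x * W c x)"
    have pos: "\<rho> c (cinv c x) * dens c x * W c x \<ge> 0" if "c \<in> P" "x \<in> cran c" for c x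
      using nonneg[OF that] w(2)[OF that] by simp
    have "?I c \<ge> 0" if "c \<in> P" for c
      by (rule integral_nonneg[OF integrable_supported[OF charts(2)[OF P(2)[OF that]] continuous_on_mult[OF cont_\<rho> w(1)] supp]])
        (use that pos in auto)
    then have "?I c = 0" using w(3) sum_nonneg_eq_0_iff[OF P(1), of ?I] c(1) by auto
    then have "\<rho> c (cinv c x) * dens c x * W c x = 0"
      by (rule integral_supported_nonneg_eq_0[OF charts(2)[OF P(2)[OF c(1)]] continuous_on_mult[OF cont_\<rho> w(1)] supp, rotated -2])
        (use c pos in auto)
    then show ?thesis using c dens(1)[OF P(2)[OF c(1)] c(2)] by simp
  qed
  have m: "m \<noteq> 0"
  proof
    assume "m = 0"
    obtain c where c: "c \<in> P" "p \<in> cdom c" "\<rho> c p > 0" using exists_\<rho> by blast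
    have "(1 :: real) = 0"
      by (rule weight_0[of "\<lambda>_ _. 1" c "coord c p"])
        (use \<open>m = 0\<close> c charts(6,8)[OF P(2)[OF c(1)]] in \<open>auto simp: m_def\<close>)
    then show False by simp
  qed
  have int_f: "(\<Sum>c\<in>P. integral (cran c) (\<lambda>x. \<rho> c (cinv c x) * dens c x * ham c \<xi> x)) = 0"
  proof -
    have "integral (cran c) (\<lambda>x. \<rho> c (cinv c x) * dens c x * ham c \<xi> x) =
        blinfun_apply (integral (cran c) (\<lambda>x. (\<rho> c (cinv c x) * dens c x) *\<^sub>R \<mu> (cinv c x))) \<xi>" if c: "c \<in> P" for c
    proof -
      have "(\<lambda>x. (\<rho> c (cinv c x) * dens c x) *\<^sub>R \<mu> (cinv c x)) integrable_on cran c"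
        by (rule integrable_supported[OF charts(2)[OF P(2)[OF c]] continuous_on_scaleR[OF cont_\<rho>[OF c] smooth_on_continuous[OF smooth_function_chart[OF smooth_\<mu> P(2)[OF c]]]] supp[OF c]])
          simp
      from integral_linear[OF this, of "\<lambda>L. blinfun_apply L \<xi>"] show ?thesis
        by (simp add: o_def blinfun.scaleR_left ham_def bounded_linear_intros)
    qed
    then have "(\<Sum>c\<in>P. integral (cran c) (\<lambda>x. \<rho> c (cinv c x) * dens c x * ham c \<xi> x)) =
        blinfun_apply (\<Sum>c\<in>P. integral (cran c) (\<lambda>x. (\<rho> c (cinv c x) * dens c x) *\<^sub>R \<mu> (cinv c x))) \<xi>"
      by (simp add: blinfun.sum_left)
    then show ?thesis using int0 by (simp add: dens_def)
  qed
  have "(\<lambda>p. div_J_fund \<xi> p - 2 * l * ?f p) constant_on UNIV"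
  proof (rule locally_constant_imp_constant[OF connected_M])
    fix p :: 'm
    obtain c where c: "c \<in> A" "p \<in> cdom c" by (rule chart_exists)
    interpret kc: killing_chart "g c" "cran c" "fund c \<xi>" "ham c \<xi>" by (rule killing_chart[OF c(1)])
    have "coord c p \<in> cran c" by (rule charts(6)[OF c])
    then obtain r where r: "r > 0" "ball (coord c p) r \<subseteq> cran c" using kc.open_S openE by blast
    let ?U = "cdom c \<inter> coord c -` ball (coord c p) r"
    let ?F = "\<lambda>x. kc.div_J x - 2 * l * ham c \<xi> x"
    have F: "?F x = ?F (coord c p)" if "x \<in> ball (coord c p) r" for x
    proof (rule has_derivative_zero_unique[of "ball (coord c p) r" ?F])
      show "(?F has_derivative (\<lambda>h. 0)) (at x within ball (coord c p) r)" if "x \<in> ball (coord c p) r" for x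
      proof -
        have x: "x \<in> cran c" using r(2) that by blast
        have "(?F has_derivative (\<lambda>v. 2 * l * dd (ham c \<xi>) x v - 2 * l * dd (ham c \<xi>) x v)) (at x)"
          by (intro has_derivative_diff kc.has_derivative_div_J[OF x einstein[OF c(1) x]]
              has_derivative_mult_right differentiable_dd kc.diff_f x)
        then show ?thesis by (simp add: has_derivative_at_withinI)
      qed
    qed (use that r in auto)
    have "open ?U" by (rule continuous_open_preimage[OF charts(4)[OF c(1)] open_cdom[OF c(1)]]) simp
    then have "openin (top_of_set UNIV) ?U" by simp
    moreover have "p \<in> ?U" using c r by simp
    moreover have "div_J_fund \<xi> q - 2 * l * ?f q = div_J_fund \<xi> p - 2 * l * ?f p" if "q \<in> ?U" for q
      using F[of "coord c q"] that c div_J_fund[OF c(1) charts(6)[OF c(1)], of q \<xi>] div_J_fund[OF c(1) charts(6)[OF c], of \<xi>]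
        charts(8)[OF c(1), of q] charts(8)[OF c] by (auto simp: ham_def)
    ultimately show "\<exists>T. openin (top_of_set UNIV) T \<and> p \<in> T \<and>
        (\<forall>q\<in>T. div_J_fund \<xi> q - 2 * l * ?f q = div_J_fund \<xi> p - 2 * l * ?f p)"
      by blast
  qed
  then obtain k where "\<And>p. div_J_fund \<xi> p - 2 * l * ?f p = k"
    unfolding constant_on_def by blast
  then have k: "div_J_fund \<xi> p = 2 * l * ?f p + k" for p by (metis diff_eq_eq add.commute)
  have div_J_chart: "tr (\<lambda>b. J (dd (fund c \<xi>) x b)) + metric_chart.div_form (g c) x (J (fund c \<xi> x)) = 2 * l * ham c \<xi> x + k"
    if c: "c \<in> A" and x: "x \<in> cran c" for c x
  proof -
    interpret kc: killing_chart "g c" "cran c" "fund c \<xi>" "ham c \<xi>" by (rule killing_chart[OF c])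
    show ?thesis using k[of "cinv c x"] div_J_fund[OF c x, of \<xi>] kc.div_J_eq[OF x] by (simp add: ham_def)
  qed
  have dX: "(fund c \<xi> has_derivative dd (fund c \<xi>) x) (at x)" if "c \<in> A" "x \<in> cran c" for c x
    by (rule differentiable_dd[OF smooth_onD[OF smooth_fund[OF that(1)] that(2)]])
  have JX_trans: "J (fund d \<xi> (transition c d x)) = dd (transition c d) x (J (fund c \<xi> x))"
    if "c \<in> A" "d \<in> A" "x \<in> overlap c d" for c d x
    using transition(6)[OF that] fund_trans[OF that] by simp
  have smooth_JX: "smooth_on (cran c) (\<lambda>x. J (fund c \<xi> x))" if "c \<in> A" for c
    by (rule smooth_on_bounded_linear[OF charts(2)[OF that] bounded_linear_J smooth_fund[OF that]])
  have k0: "k = 0"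
  proof -
    have "(\<Sum>c\<in>P. integral (cran c) (\<lambda>x. \<rho> c (cinv c x) * dens c x *
        (tr (dd (\<lambda>x. J (fund c \<xi> x)) x) + metric_chart.div_form (g c) x (J (fund c \<xi> x))))) = 0"
      by (rule divergence_theorem[OF part smooth_JX JX_trans])
    moreover have "integral (cran c) (\<lambda>x. \<rho> c (cinv c x) * dens c x *
        (tr (dd (\<lambda>x. J (fund c \<xi> x)) x) + metric_chart.div_form (g c) x (J (fund c \<xi> x)))) =
        2 * l * integral (cran c) (\<lambda>x. \<rho> c (cinv c x) * dens c x * ham c \<xi> x) +
        k * integral (cran c) (\<lambda>x. \<rho> c (cinv c x) * dens c x)" if c: "c \<in> P" for c
    proof -
      note cA = P(2)[OF c]
      have dJ: "dd (\<lambda>x. J (fund c \<xi> x)) x = (\<lambda>b. J (dd (fund c \<xi>) x b))" if "x \<in> cran c" for x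
        using dd_eq[OF bounded_linear.has_derivative[OF bounded_linear_J dX[OF cA that]]] by auto
      have "integral (cran c) (\<lambda>x. \<rho> c (cinv c x) * dens c x *
        (tr (dd (\<lambda>x. J (fund c \<xi> x)) x) + metric_chart.div_form (g c) x (J (fund c \<xi> x)))) =
        integral (cran c) (\<lambda>x. 2 * l * (\<rho> c (cinv c x) * dens c x * ham c \<xi> x) + k * (\<rho> c (cinv c x) * dens c x))"
        by (intro Henstock_Kurzweil_Integration.integral_cong)
          (simp only: dJ div_J_chart[OF cA], simp add: algebra_simps)
      also have "\<dots> = integral (cran c) (\<lambda>x. 2 * l * (\<rho> c (cinv c x) * dens c x * ham c \<xi> x)) +
          integral (cran c) (\<lambda>x. k * (\<rho> c (cinv c x) * dens c x))"
      proof (rule Henstock_Kurzweil_Integration.integral_add)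
        show "(\<lambda>x. 2 * l * (\<rho> c (cinv c x) * dens c x * ham c \<xi> x)) integrable_on cran c"
          by (rule integrable_supported[OF charts(2)[OF cA] continuous_on_mult[OF continuous_on_const continuous_on_mult[OF cont_\<rho>[OF c] cont_f[OF c]]] supp[OF c]]) simp
        show "(\<lambda>x. k * (\<rho> c (cinv c x) * dens c x)) integrable_on cran c"
          by (rule integrable_supported[OF charts(2)[OF cA] continuous_on_mult[OF continuous_on_const cont_\<rho>[OF c]] supp[OF c]]) simp
      qed
      finally show ?thesis by simp
    qed
    ultimately have "2 * l * (\<Sum>c\<in>P. integral (cran c) (\<lambda>x. \<rho> c (cinv c x) * dens c x * ham c \<xi> x)) + k * m = 0"
      by (simp add: m_def sum.distrib sum_distrib_left)
    then show ?thesis using int_f m by simp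
  qed
  show ?thesis
  proof (cases "l = 0")
    case False
    then show ?thesis using k[of p] k0 by simp
  next
    case True
    have Z: "(\<Sum>c\<in>P. integral (cran c) (\<lambda>x. \<rho> c (cinv c x) * dens c x *
        (tr (dd (\<lambda>x. ham c \<xi> x *\<^sub>R J (fund c \<xi> x)) x) + metric_chart.div_form (g c) x (ham c \<xi> x *\<^sub>R J (fund c \<xi> x))))) = 0"
    proof (rule divergence_theorem[OF part])
      show "smooth_on (cran c) (\<lambda>x. ham c \<xi> x *\<^sub>R J (fund c \<xi> x))" if "c \<in> A" for c
        by (rule smooth_on_bilinear[OF charts(2)[OF that] bounded_bilinear_scaleR smooth_ham[OF that] smooth_JX[OF that]])
      show "ham d \<xi> (transition c d x) *\<^sub>R J (fund d \<xi> (transition c d x)) = dd (transition c d) x (ham c \<xi> x *\<^sub>R J (fund c \<xi> x))"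
        if "c \<in> A" "d \<in> A" "x \<in> overlap c d" for c d x
        using JX_trans[OF that] linear_cmul[OF linear_dd[OF smooth_onD[OF transition(2)[OF that(1,2)] that(3)]]]
        by (simp add: ham_def transition(5)[OF that])
    qed
    \<comment> \<open>With \<open>l = 0\<close> and \<open>k = 0\<close> the field
      \<open>J X\<close> is divergence-free, and the product rule leaves only the derivative of
      \<open>f\<close> along \<open>J X\<close>.\<close>
    have div_Z: "tr (dd (\<lambda>x. ham c \<xi> x *\<^sub>R J (fund c \<xi> x)) x) + metric_chart.div_form (g c) x (ham c \<xi> x *\<^sub>R J (fund c \<xi> x)) =
        - g c x (fund c \<xi> x) (fund c \<xi> x)" if c: "c \<in> A" and x: "x \<in> cran c" for c x
    proof -
      interpret kc: killing_chart "g c" "cran c" "fund c \<xi>" "ham c \<xi>" by (rule killing_chart[OF c])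
      have "dd (\<lambda>x. ham c \<xi> x *\<^sub>R J (fund c \<xi> x)) x =
          (\<lambda>b. ham c \<xi> x *\<^sub>R J (dd (fund c \<xi>) x b) + dd (ham c \<xi>) x b *\<^sub>R J (fund c \<xi> x))"
        using dd_eq[OF has_derivative_scaleR[OF differentiable_dd[OF kc.diff_f[OF x]] kc.has_derivative_J[OF dX[OF c x]]]] by auto
      then have "tr (dd (\<lambda>x. ham c \<xi> x *\<^sub>R J (fund c \<xi> x)) x) =
          ham c \<xi> x * tr (\<lambda>b. J (dd (fund c \<xi>) x b)) + tr (\<lambda>b. dd (ham c \<xi>) x b *\<^sub>R J (fund c \<xi> x))"
        by (simp add: tr_add tr_scaleR)
      also have "tr (\<lambda>b. dd (ham c \<xi>) x b *\<^sub>R J (fund c \<xi> x)) = dd (ham c \<xi>) x (J (fund c \<xi> x))"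
        using linear_basis_sum[OF linear_dd[OF kc.diff_f[OF x]], of "J (fund c \<xi> x)"]
        by (simp add: tr_def mult.commute)
      also have "\<dots> = - g c x (fund c \<xi> x) (fund c \<xi> x)"
        by (simp add: moment_ham[OF c x] kc.h_simps[OF x])
      finally have "tr (dd (\<lambda>x. ham c \<xi> x *\<^sub>R J (fund c \<xi> x)) x) + kc.div_form x (ham c \<xi> x *\<^sub>R J (fund c \<xi> x)) =
          ham c \<xi> x * (tr (\<lambda>b. J (dd (fund c \<xi>) x b)) + kc.div_form x (J (fund c \<xi> x))) - g c x (fund c \<xi> x) (fund c \<xi> x)"
        by (simp add: linear_cmul[OF kc.linear_div_form[OF x]] distrib_left)
      then show ?thesis by (simp add: div_J_chart[OF c x] True k0)
    qed
    let ?N = "\<lambda>c x. g c x (fund c \<xi> x) (fund c \<xi> x)"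
    have int_N: "(\<Sum>c\<in>P. integral (cran c) (\<lambda>x. \<rho> c (cinv c x) * dens c x * ?N c x)) = 0"
    proof -
      have "integral (cran c) (\<lambda>x. \<rho> c (cinv c x) * dens c x * (tr (dd (\<lambda>x. ham c \<xi> x *\<^sub>R J (fund c \<xi> x)) x) +
          metric_chart.div_form (g c) x (ham c \<xi> x *\<^sub>R J (fund c \<xi> x)))) =
          - integral (cran c) (\<lambda>x. \<rho> c (cinv c x) * dens c x * ?N c x)" if "c \<in> P" for c
        unfolding Henstock_Kurzweil_Integration.integral_neg[symmetric]
        by (intro Henstock_Kurzweil_Integration.integral_cong) (simp add: div_Z[OF P(2)[OF that]])
      then show ?thesis using Z by (simp add: sum_negf)
    qed
    have fund_0: "fund c \<xi> x = 0" if c: "c \<in> P" "x \<in> cran c" "\<rho> c (cinv c x) > 0" for c x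
    proof -
      have "?N c x = 0"
      proof (rule weight_0[of ?N, OF _ _ int_N c])
        fix c assume c: "c \<in> P"
        interpret kc: killing_chart "g c" "cran c" "fund c \<xi>" "ham c \<xi>" by (rule killing_chart[OF P(2)[OF c]])
        show "continuous_on (cran c) (?N c)"
        proof (rule differentiable_imp_continuous_on, rule differentiable_at_imp_differentiable_on)
          show "?N c differentiable (at x)" if "x \<in> cran c" for x
            using kc.has_derivative_h[OF that dX[OF P(2)[OF c] that] dX[OF P(2)[OF c] that]] differentiable_def by blast
        qed
        show "?N c x \<ge> 0" if "x \<in> cran c" for x
          using kc.pos[OF that, of "fund c \<xi> x"] kc.h_simps[OF that] by (cases "fund c \<xi> x = 0") auto
      qed
      interpret kc: killing_chart "g c" "cran c" "fund c \<xi>" "ham c \<xi>" by (rule killing_chart[OF P(2)[OF c(1)]])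
      show ?thesis using kc.pos[OF c(2), of "fund c \<xi> x"] \<open>?N c x = 0\<close> by (cases "fund c \<xi> x = 0") auto
    qed
    have "?f constant_on UNIV"
    proof (rule locally_constant_imp_constant[OF connected_M])
      fix p :: 'm
      obtain c where c: "c \<in> P" "p \<in> cdom c" "\<rho> c p > 0" using exists_\<rho> by blast
      note cA = P(2)[OF c(1)]
      let ?V = "cran c \<inter> (\<lambda>x. \<rho> c (cinv c x)) -` {0<..}"
      have "open ?V"
        by (rule continuous_open_preimage[OF smooth_on_continuous[OF smooth_function_chart[OF P(3)[OF c(1)] cA]] charts(2)[OF cA]]) simp
      moreover have "coord c p \<in> ?V" using c charts(6,8)[OF cA] by simp
      ultimately obtain r where r: "r > 0" "ball (coord c p) r \<subseteq> ?V" using openE by blast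
      let ?U = "cdom c \<inter> coord c -` ball (coord c p) r"
      have F: "ham c \<xi> x = ham c \<xi> (coord c p)" if "x \<in> ball (coord c p) r" for x
      proof (rule has_derivative_zero_unique[of "ball (coord c p) r" "ham c \<xi>"])
        show "(ham c \<xi> has_derivative (\<lambda>h. 0)) (at x within ball (coord c p) r)" if "x \<in> ball (coord c p) r" for x
        proof -
          have x: "x \<in> cran c" "\<rho> c (cinv c x) > 0" using r(2) that by auto
          interpret kc: killing_chart "g c" "cran c" "fund c \<xi>" "ham c \<xi>" by (rule killing_chart[OF cA])
          have "dd (ham c \<xi>) x = (\<lambda>v. 0)"
            using moment_ham[OF cA x(1)] fund_0[OF c(1) x] kc.h_simps[OF x(1)] by auto
          then show ?thesis using differentiable_dd[OF kc.diff_f[OF x(1)]] by (simp add: has_derivative_at_withinI)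
        qed
      qed (use that r in auto)
      have "open ?U" by (rule continuous_open_preimage[OF charts(4)[OF cA] open_cdom[OF cA]]) simp
      then have "openin (top_of_set UNIV) ?U" by simp
      moreover have "p \<in> ?U" using c r by simp
      moreover have "?f q = ?f p" if "q \<in> ?U" for q
        using F[of "coord c q"] that c charts(8)[OF cA, of q] charts(8)[OF cA c(2)] by (auto simp: ham_def)
      ultimately show "\<exists>T. openin (top_of_set UNIV) T \<and> p \<in> T \<and> (\<forall>q\<in>T. ?f q = ?f p)"
        by blast
    qed
    then obtain b where b: "\<And>q. ?f q = b" unfolding constant_on_def by blast
    have "b * m = 0"
      using int_f by (simp add: m_def ham_def b sum_distrib_left mult.commute)
    then have "b = 0" using m by simp
    then show ?thesis using k[of p] k0 True b by simp
  qed
qed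

end

section \<open>Maps of constant rank\<close>

lemma inverse_function_C1:
  fixes G :: "'a::euclidean_space \<Rightarrow> 'a"
  assumes V: "open V" "s \<in> V" and C1: "Ck_on (Suc 0) V G" and id: "\<And>v. dd G s v = v"
  obtains U W \<gamma> where "open U" "U \<subseteq> V" "s \<in> U" "open W" "homeomorphism U W G \<gamma>"
    "\<And>w. w \<in> W \<Longrightarrow> \<gamma> differentiable (at w)" "\<And>w z. w \<in> W \<Longrightarrow> dd G (\<gamma> w) (dd \<gamma> w z) = z"
proof -
  define G' where "G' x = Blinfun (dd G x)" for x
  have diff: "G differentiable (at x)" if "x \<in> V" for x using C1 that by simp
  have G': "blinfun_apply (G' x) = dd G x" if "x \<in> V" for x
    unfolding G'_def using diff[OF that]
    by (intro bounded_linear_Blinfun_apply has_derivative_bounded_linear[OF differentiable_dd])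
  have 1: "(G has_derivative blinfun_apply (G' x)) (at x)" if "x \<in> V" for x
    using differentiable_dd[OF diff[OF that]] by (simp add: G'[OF that])
  have 2: "continuous_on V G'"
  proof (rule continuous_on_blinfun_componentwise)
    fix i :: 'a
    have "continuous_on V (\<lambda>x. dd G x i)" using C1 by simp
    then show "continuous_on V (\<lambda>x. blinfun_apply (G' x) i)"
      by (rule continuous_on_eq) (simp add: G')
  qed
  have 3: "id_blinfun o\<^sub>L G' s = id_blinfun"
    by (rule blinfun_eqI) (simp add: G'[OF V(2)] id)
  obtain U W \<gamma> \<gamma>' where U: "open U" "U \<subseteq> V" "s \<in> U" "open W" "homeomorphism U W G \<gamma>"
    and \<gamma>: "\<And>w. w \<in> W \<Longrightarrow> (\<gamma> has_derivative \<gamma>' w) (at w)" "\<And>w. w \<in> W \<Longrightarrow> \<gamma>' w = inv (blinfun_apply (G' (\<gamma> w)))"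
      "\<And>w. w \<in> W \<Longrightarrow> bij (blinfun_apply (G' (\<gamma> w)))"
    using inverse_function_theorem[OF V(1) 1 2 V(2) 3] by metis
  show ?thesis
  proof (rule that[OF U])
    show "\<gamma> differentiable (at w)" if "w \<in> W" for w using \<gamma>(1)[OF that] differentiable_def by blast
    show "dd G (\<gamma> w) (dd \<gamma> w z) = z" if "w \<in> W" for w z
    proof -
      have "\<gamma> w \<in> V" using U that by (auto simp: homeomorphism_def)
      then show ?thesis
        using \<gamma>(2,3)[OF that] dd_eq[OF \<gamma>(1)[OF that]] by (simp add: G' bij_is_surj surj_f_inv_f)
    qed
  qed
qed

text \<open>A right inverse of \<open>P\<close> on its image of \<open>U\<close> has a range inside
  \<open>U\<close> of dimension at least \<open>dim U\<close>, hence equal to \<open>U\<close>; so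
  \<open>P\<close> is injective there.\<close>

lemma linear_on_subspace_injective:
  fixes P :: "'a::euclidean_space \<Rightarrow> 'b::euclidean_space"
  assumes P: "linear P" and U: "subspace U" and d: "dim U \<le> dim (P ` U)" and u: "u \<in> U" "P u = 0"
  shows "u = 0"
proof -
  obtain g where g: "range g \<subseteq> U" "linear g" "\<And>v. v \<in> P ` U \<Longrightarrow> P (g v) = v"
    using linear_exists_right_inverse_on[OF P U] by auto
  have sub: "subspace (P ` U)" by (rule linear_subspace_image[OF P U])
  have "inj_on g (span (P ` U))" using g(3) sub by (metis inj_onI span_eq_iff)
  then have "dim (g ` (P ` U)) = dim (P ` U)" by (rule dim_image_eq[OF g(2)])
  then have "g ` (P ` U) = U"
    using g(1) d by (intro subspace_dim_equal[OF linear_subspace_image[OF g(2) sub] U]) auto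
  then obtain w where w: "w \<in> P ` U" "u = g w" using u by blast
  then have "w = 0" using g(3)[OF w(1)] u by simp
  then show ?thesis using w linear_0[OF g(2)] by simp
qed

text \<open>The straightening \<open>G = A \<circ> f + (id - A \<circ> D f)\<close>, where \<open>A\<close> is a right inverse of \<open>D f\<close> at the
  given point, makes \<open>f\<close> constant along the kernel of \<open>D f\<close>.\<close>

lemma constant_rank_negligible:
  fixes f :: "'k::euclidean_space \<Rightarrow> 'e::euclidean_space"
  assumes V: "open V" "s \<in> V" and C1: "Ck_on (Suc 0) V f"
    and rank: "\<And>x. x \<in> V \<Longrightarrow> dim (range (dd f x)) \<le> dim (range (dd f s))"
    and small: "dim (range (dd f s)) < CARD('n)"
  shows "\<exists>N (R :: (real^'n) set) \<eta>. open N \<and> s \<in> N \<and> N \<subseteq> V \<and> negligible R \<and> \<eta> differentiable_on R \<and>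
    \<eta> ` R \<subseteq> f ` V \<and> f ` N \<subseteq> \<eta> ` R"
proof -
  define D where "D = dd f s"
  have diff: "f differentiable (at x)" if "x \<in> V" for x using C1 that by simp
  have linD: "linear D" unfolding D_def by (rule linear_dd[OF diff[OF V(2)]])
  obtain A where A: "linear A" "\<And>v. D (A (D v)) = D v"
    using linear_exists_right_inverse_on[OF linD subspace_UNIV] by auto
  have blA: "bounded_linear A" and blD: "bounded_linear D"
    using A(1) linD by (simp_all add: linear_conv_bounded_linear)
  have blAD: "bounded_linear (\<lambda>v. A (D v))" by (rule bounded_linear_compose[OF blA blD])
  have blQ: "bounded_linear (\<lambda>x. x - A (D x))"
    by (intro bounded_linear_sub bounded_linear_ident blAD)
  define G where "G x = A (f x) + (x - A (D x))" for x
  have C1G: "Ck_on (Suc 0) V G"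
    unfolding G_def
  proof (intro Ck_on_add[OF V(1)] Ck_on_bounded_linear[OF V(1) blA C1] Ck_on_bounded_linear[OF V(1) blQ])
    have "dd (\<lambda>x. x) x v = v" for x v :: 'k by (rule dd_eq[OF has_derivative_ident])
    then show "Ck_on (Suc 0) V (\<lambda>x. x)" by simp
  qed
  have dG: "dd G x v = A (dd f x v) + (v - A (D v))" if "x \<in> V" for x v
    unfolding G_def[abs_def]
    by (rule dd_eq, intro has_derivative_add bounded_linear.has_derivative[OF blA differentiable_dd[OF diff[OF that]]]
        bounded_linear_imp_has_derivative[OF blQ])
  have "dd G s v = v" for v using dG[OF V(2)] by (simp add: D_def)
  from inverse_function_C1[OF V C1G this]
  obtain U W \<gamma> where U: "open U" "U \<subseteq> V" "s \<in> U" "open W" "homeomorphism U W G \<gamma>"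
    and \<gamma>: "\<And>w. w \<in> W \<Longrightarrow> \<gamma> differentiable (at w)" "\<And>w z. w \<in> W \<Longrightarrow> dd G (\<gamma> w) (dd \<gamma> w z) = z" by metis
  have hom: "\<And>x. x \<in> U \<Longrightarrow> G x \<in> W" "\<And>w. w \<in> W \<Longrightarrow> \<gamma> w \<in> U" "\<And>x. x \<in> U \<Longrightarrow> \<gamma> (G x) = x"
    "continuous_on U G"
    using U(5) by (auto simp: homeomorphism_def)
  \<comment> \<open>Applying \<open>D\<close> to
    \<open>dd G (\<gamma> w) (dd \<gamma> w y) = y\<close> leaves
    \<open>D (A (dd f (\<gamma> w) (dd \<gamma> w y))) = D y\<close>. The rank bound then makes
    \<open>D \<circ> A\<close> injective on the range of \<open>dd f (\<gamma> w)\<close>, so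
    directions in the kernel of \<open>D\<close> are sent to zero.\<close>
  have ker: "dd f (\<gamma> w) (dd \<gamma> w z) = 0" if w: "w \<in> W" and z: "D z = 0" for w z
  proof -
    let ?x = "\<gamma> w"
    have x: "?x \<in> V" using hom(2)[OF w] U(2) by auto
    have eq: "D (A (dd f ?x (dd \<gamma> w y))) = D y" for y
    proof -
      let ?v = "dd \<gamma> w y"
      have "D (A (dd f ?x ?v) + (?v - A (D ?v))) = D y"
        using \<gamma>(2)[OF w, of y] dG[OF x] by simp
      then show ?thesis by (simp add: linear_add[OF linD] linear_diff[OF linD] A(2))
    qed
    have linf: "linear (dd f ?x)" by (rule linear_dd[OF diff[OF x]])
    have "range D \<subseteq> (\<lambda>y. D (A y)) ` range (dd f ?x)"
    proof
      fix y assume "y \<in> range D"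
      then obtain v where "y = D v" by blast
      then show "y \<in> (\<lambda>y. D (A y)) ` range (dd f ?x)" using eq[of v] by (metis image_eqI rangeI)
    qed
    then have "dim (range D) \<le> dim ((\<lambda>y. D (A y)) ` range (dd f ?x))" by (rule dim_subset)
    then have "dim (range (dd f ?x)) \<le> dim ((\<lambda>y. D (A y)) ` range (dd f ?x))"
      using rank[OF x] by (simp add: D_def)
    then show ?thesis
      using linear_on_subspace_injective[of "\<lambda>y. D (A y)" "range (dd f ?x)" "dd f ?x (dd \<gamma> w z)"]
        linear_compose[OF A(1) linD] linear_subspace_image[OF linf subspace_UNIV] eq[of z] z by (auto simp: o_def)
  qed
  define w0 where "w0 = G s"
  have w0: "w0 \<in> W" using hom(1) U(3) by (simp add: w0_def)
  then obtain r where r: "r > 0" "ball w0 r \<subseteq> W" using U(4) openE by blast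
  \<comment> \<open>The affine projection along the kernel of \<open>D\<close> onto a slice through
    \<open>w0\<close>; near \<open>w0\<close> the map \<open>f \<circ> \<gamma>\<close> factors
    through it.\<close>
  define p where "p w = w0 + A (D (w - w0))" for w
  have contp: "continuous_on UNIV p"
    unfolding p_def by (intro continuous_intros bounded_linear.continuous_on[OF blAD])
  have fp: "f (\<gamma> w) = f (\<gamma> (p w))" if w: "w \<in> ball w0 r" "p w \<in> ball w0 r" for w
  proof -
    define z where "z = w - p w"
    have "D (p w) = D w0 + D (w - w0)" by (simp only: p_def linear_add[OF linD] A(2))
    then have z: "D z = 0" by (simp add: z_def linear_diff[OF linD])
    have seg: "p w + t *\<^sub>R z \<in> ball w0 r" if "t \<in> {0..1}" for t
    proof -
      have "p w + t *\<^sub>R z = (1 - t) *\<^sub>R p w + t *\<^sub>R w" by (simp add: z_def algebra_simps)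
      then show ?thesis using convexD[OF convex_ball w(2) w(1), of "1 - t" t] that by simp
    qed
    have "(\<lambda>t. f (\<gamma> (p w + t *\<^sub>R z))) 0 = (\<lambda>t. f (\<gamma> (p w + t *\<^sub>R z))) 1"
    proof (rule has_derivative_zero_unique[of "{0..1::real}"])
      fix t :: real assume t: "t \<in> {0..1}"
      let ?w = "p w + t *\<^sub>R z"
      have W: "?w \<in> W" using seg[OF t] r by blast
      have fx: "f differentiable (at (\<gamma> ?w))" using hom(2)[OF W] U(2) diff by blast
      have "((\<lambda>t. p w + t *\<^sub>R z) has_derivative (\<lambda>k. k *\<^sub>R z)) (at t)" by (auto intro!: derivative_eq_intros)
      from has_derivative_compose[OF has_derivative_compose[OF this differentiable_dd[OF \<gamma>(1)[OF W]]] differentiable_dd[OF fx]]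
      have "((\<lambda>t. f (\<gamma> (p w + t *\<^sub>R z))) has_derivative (\<lambda>k. dd f (\<gamma> ?w) (dd \<gamma> ?w (k *\<^sub>R z)))) (at t)" .
      moreover have "D (k *\<^sub>R z) = 0" for k using z by (simp add: linear_cmul[OF linD])
      ultimately show "((\<lambda>t. f (\<gamma> (p w + t *\<^sub>R z))) has_derivative (\<lambda>h. 0)) (at t within {0..1})"
        using ker[OF W] by (simp add: has_derivative_at_withinI)
    qed auto
    then show ?thesis by (simp add: z_def)
  qed
  \<comment> \<open>The slice has dimension below \<open>CARD('n)\<close>; placed in
    \<open>real^'n\<close> as a subspace of that dimension, it becomes a null set.\<close>
  let ?L = "range (\<lambda>v. A (D v))"
  have L: "subspace ?L" by (rule linear_subspace_image[OF bounded_linear.linear[OF blAD] subspace_UNIV])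
  have "?L = A ` range D" by auto
  then have "dim ?L \<le> dim (range D)" using dim_image_le[OF A(1)] by simp
  then have dimL: "dim ?L < DIM(real^'n)" using small by (simp add: D_def)
  then have "dim ?L \<le> dim (UNIV :: (real^'n) set)" by simp
  then obtain R0 :: "(real^'n) set" where R0: "subspace R0" "dim R0 = dim ?L"
    using choose_subspace_of_subspace by metis
  obtain \<iota> where \<iota>: "linear \<iota>" "\<iota> ` R0 = ?L" using isometries_subspaces[OF R0(1) L R0(2)] by metis
  define R where "R = {\<rho> \<in> R0. w0 + \<iota> \<rho> \<in> ball w0 r}"
  define \<eta> where "\<eta> \<rho> = f (\<gamma> (w0 + \<iota> \<rho>))" for \<rho>
  define N where "N = {x \<in> U. G x \<in> ball w0 r \<and> p (G x) \<in> ball w0 r}"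
  have "open N"
  proof -
    have "open (ball w0 r \<inter> p -` ball w0 r)"
      by (intro open_Int open_ball open_vimage contp)
    then have "open (U \<inter> G -` (ball w0 r \<inter> p -` ball w0 r))"
      by (rule continuous_open_preimage[OF hom(4) U(1)])
    moreover have "U \<inter> G -` (ball w0 r \<inter> p -` ball w0 r) = N" by (auto simp: N_def)
    ultimately show ?thesis by simp
  qed
  moreover have "s \<in> N"
    using U(3) r(1) by (simp add: N_def w0_def[symmetric] p_def linear_0[OF linD] linear_0[OF A(1)])
  moreover have "N \<subseteq> V" using U(2) by (auto simp: N_def)
  moreover have "negligible R"
    by (rule negligible_subset[OF negligible_lowdim]) (use dimL R0(2) in \<open>auto simp: R_def\<close>)
  moreover have "\<eta> differentiable_on R"
    unfolding \<eta>_def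
  proof (rule differentiable_at_imp_differentiable_on)
    fix \<rho> assume "\<rho> \<in> R"
    then have W: "w0 + \<iota> \<rho> \<in> W" using r by (auto simp: R_def)
    have fx: "f differentiable (at (\<gamma> (w0 + \<iota> \<rho>)))" using hom(2)[OF W] U(2) diff by blast
    have "bounded_linear \<iota>" using \<iota>(1) by (simp add: linear_conv_bounded_linear)
    from bounded_linear_imp_has_derivative[OF this]
    have "((\<lambda>\<rho>. w0 + \<iota> \<rho>) has_derivative \<iota>) (at \<rho>)" by (auto intro!: derivative_eq_intros)
    from has_derivative_compose[OF has_derivative_compose[OF this differentiable_dd[OF \<gamma>(1)[OF W]]] differentiable_dd[OF fx]]
    show "(\<lambda>\<rho>. f (\<gamma> (w0 + \<iota> \<rho>))) differentiable (at \<rho>)" by (rule differentiableI)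
  qed
  moreover have "\<eta> ` R \<subseteq> f ` V"
    unfolding \<eta>_def R_def using r(2) hom(2) U(2) by blast
  moreover have "f ` N \<subseteq> \<eta> ` R"
  proof
    fix y assume "y \<in> f ` N"
    then obtain x where x: "x \<in> U" "G x \<in> ball w0 r" "p (G x) \<in> ball w0 r" "y = f x" by (auto simp: N_def)
    have "A (D (G x - w0)) \<in> \<iota> ` R0" unfolding \<iota>(2) by blast
    then obtain \<rho> where \<rho>: "\<rho> \<in> R0" "\<iota> \<rho> = A (D (G x - w0))" by force
    have "y = f (\<gamma> (p (G x)))" using fp[OF x(2,3)] hom(3)[OF x(1)] x(4) by simp
    then have "y = \<eta> \<rho>" by (simp add: \<eta>_def p_def \<rho>)
    moreover have "\<rho> \<in> R" using \<rho> x(3) by (simp add: R_def p_def)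
    ultimately show "y \<in> \<eta> ` R" by blast
  qed
  ultimately show ?thesis by blast
qed

text \<open>With \<open>M\<close> a left inverse of \<open>dd F t\<close>, the composite
  \<open>M \<circ> F\<close> has the identity as derivative at \<open>t\<close> and is locally
  invertible. Then \<open>\<psi> \<circ> M\<close> recovers parameters from points of the image and
  is differentiable on the ambient space.\<close>

lemma immersion_left_inverse:
  fixes F :: "'a::euclidean_space \<Rightarrow> 'e::euclidean_space"
  assumes T: "open T" "t \<in> T" and F: "Ck_on (Suc 0) T F" and inj: "inj (dd F t)"
 obtains M :: "'e \<Rightarrow> 'a" and U W \<psi> where "linear M" "open U" "U \<subseteq> T" "t \<in> U" "open W" "homeomorphism U W (\<lambda>x. M (F x)) \<psi>"
    "\<And>w. w \<in> W \<Longrightarrow> \<psi> differentiable (at w)"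
proof -
  have diff: "F differentiable (at x)" if "x \<in> T" for x using F that by simp
  obtain M where M: "linear M" "\<And>v. M (dd F t v) = v"
    using linear_exists_left_inverse_on[OF linear_dd[OF diff[OF T(2)]] subspace_UNIV inj] by auto
  have blM: "bounded_linear M" using M(1) by (simp add: linear_conv_bounded_linear)
  have C1: "Ck_on (Suc 0) T (\<lambda>x. M (F x))" by (rule Ck_on_bounded_linear[OF T(1) blM F])
  have "dd (\<lambda>x. M (F x)) t v = v" for v
    using dd_eq[OF bounded_linear.has_derivative[OF blM differentiable_dd[OF diff[OF T(2)]]]] M(2) by simp
  from inverse_function_C1[OF T C1 this] show ?thesis using that[OF M(1)] by metis
qed

section \<open>Tangent spaces of orbits\<close>

context hamiltonian_kaehler
begin

lemma group: "(\<lambda>p. p) \<in> K" "h \<in> K \<Longrightarrow> k \<in> K \<Longrightarrow> h \<circ> k \<in> K" "k \<in> K \<Longrightarrow> inv k \<in> K"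
  using lie by (simp_all add: lie_group_of_isometries_def)

lemma isometry_facts:
  assumes "k \<in> K"
  shows "bij k" "smooth_map A A k" "inv k (k p) = p" "k (inv k p) = p"
proof -
  have b: "bij k" "smooth_map A A k" using isometry_K[OF assms] by (simp_all add: isometry_def)
  then show "bij k" "smooth_map A A k" "inv k (k p) = p" "k (inv k p) = p"
    by (simp_all add: bij_is_inj bij_is_surj surj_f_inv_f)
qed

lemma smooth_compose: "smooth_map (prod_atlas B B) B (\<lambda>(h, k). h \<circ> k)"
  using lie by (simp add: lie_group_of_isometries_def)

lemma cinv_e_in_K: "s \<in> cran e \<Longrightarrow> cinv e s \<in> K"
  using echart(3,7) by blast

text \<open>Together with the next lemma, this shows that the orbit map has constant rank.\<close>

lemma dim_fund_le:
  assumes c: "c \<in> A" and k: "k \<in> K" and x: "x \<in> rep_dom c c k"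
  shows "dim (range (\<lambda>\<xi>. fund c \<xi> (rep c c k x))) \<le> dim (range (\<lambda>\<xi>. fund c \<xi> x))"
proof -
  interpret kc: kaehler_chart "g c" "cran c" by (rule kaehler_chart[OF c])
  let ?r = "rep c c k"
  let ?y = "?r x" and ?L = "dd ?r x"
  have rd: "open (rep_dom c c k)" "smooth_on (rep_dom c c k) ?r"
    using smooth_map_chart[OF atlas atlas isometry_facts(2)[OF k] c c] by auto
  have xy: "x \<in> cran c" "?y \<in> cran c" "cinv c ?y = k (cinv c x)"
    using x charts(6,8)[OF c] by (auto simp: rep_dom_eq[OF atlas c] rep_apply)
  have dr: "(?r has_derivative ?L) (at x)" by (rule differentiable_dd[OF smooth_onD[OF rd(2) x]])
  have lin: "linear ?L" by (rule has_derivative_linear[OF dr])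
  have pm: "g c ?y (?L u) (?L v) = g c x u v" for u v
    using isometry_K[OF k] c x by (simp add: isometry_def preserves_metric_def)
  have "v = 0" if "?L v = 0" for v
    using pm[of v v] that kc.pos[OF xy(1), of v] kc.h_simps[OF xy(2)] by (metis less_irrefl)
  then have inj: "inj ?L" by (simp add: linear_injective_0[OF lin])
  obtain M where M: "linear M" "\<And>v. ?L (M v) = v"
    using linear_injective_isomorphism[OF lin inj] by metis
  have equiv: "dd (ham c \<xi>) ?y (?L v) = dd (ham c (Ad e (inv k) \<xi>)) x v" for \<xi> v
  proof -
    have "((\<lambda>z. ham c \<xi> (?r z)) has_derivative (\<lambda>v. dd (ham c \<xi>) ?y (?L v))) (at x)"
      by (rule has_derivative_compose[OF dr differentiable_dd[OF smooth_onD[OF smooth_ham[OF c] xy(2)]]])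
    moreover have "ham c \<xi> (?r z) = ham c (Ad e (inv k) \<xi>) z" if "z \<in> rep_dom c c k" for z
    proof -
      have "cinv c (?r z) = k (cinv c z)"
        using that charts(8)[OF c] by (auto simp: rep_dom_eq[OF atlas c] rep_apply)
      then show ?thesis using moment_map k by (simp add: ham_def moment_map_def)
    qed
    ultimately have "(ham c (Ad e (inv k) \<xi>) has_derivative (\<lambda>v. dd (ham c \<xi>) ?y (?L v))) (at x)"
      by (rule has_derivative_transform_within_open[OF _ rd(1) x])
    then show ?thesis by (simp add: dd_eq)
  qed
  \<comment> \<open>Commutation of \<open>k\<close> with \<open>J\<close> is not at hand, so the
    fields at the two points are matched not by \<open>?L\<close> itself but by the adjoint of
    \<open>J \<circ> ?L \<circ> J\<close>, up to sign, which is what equivariance of the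
    Hamiltonians and \<open>moment_ham\<close> provide.\<close>
  have "\<exists>w. \<forall>u. g c x w u = - g c ?y (J (?L (J u))) z" for z
  proof -
    have "linear (\<lambda>u. g c ?y (J (?L (J u))) z)"
      using linear_compose[OF linear_J linear_compose[OF lin linear_compose[OF linear_J kc.lin1[OF xy(2)]]]]
      by (simp add: o_def)
    then have "linear (\<lambda>u. - g c ?y (J (?L (J u))) z)" by (rule linear_compose_neg)
    from bilinear_form_representer[OF kc.bilinear_h[OF xy(1)] kc.pos[OF xy(1)] this] show ?thesis by blast
  qed
  then obtain \<psi> where \<psi>: "\<And>z u. g c x (\<psi> z) u = - g c ?y (J (?L (J u))) z" by metis
  have lin\<psi>: "linear \<psi>"
    by (rule linearI; rule kc.nondegenerate[OF xy(1)]) (simp_all add: \<psi> kc.h_simps[OF xy(1)] kc.h_simps[OF xy(2)])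
  have inj\<psi>: "inj \<psi>"
    unfolding linear_injective_0[OF lin\<psi>]
  proof (intro allI impI)
    fix z assume "\<psi> z = 0"
    then have 0: "g c ?y (J (?L (J u))) z = 0" for u using \<psi>[of z u] kc.h_simps[OF xy(1)] by simp
    have "g c ?y z w = 0" for w
    proof -
      have "J (?L (J (J (M (J w))))) = w" by (simp add: linear_neg[OF lin] M(2))
      then show ?thesis using 0[of "J (M (J w))"] kc.sym[OF xy(2), of z w] by simp
    qed
    then show "z = 0" using kc.nondegenerate[OF xy(2), of z 0] kc.h_simps[OF xy(2)] by simp
  qed
  have \<psi>_fund: "\<psi> (fund c \<xi> ?y) = fund c (Ad e (inv k) \<xi>) x" for \<xi>
  proof (rule kc.nondegenerate[OF xy(1)])
    fix u
    have "g c x (\<psi> (fund c \<xi> ?y)) u = - dd (ham c \<xi>) ?y (?L (J u))"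
      by (simp add: \<psi> moment_ham[OF c xy(2)])
    also have "\<dots> = - g c x (J (J u)) (fund c (Ad e (inv k) \<xi>) x)"
      by (simp only: equiv moment_ham[OF c xy(1)])
    also have "\<dots> = g c x (fund c (Ad e (inv k) \<xi>) x) u"
      by (simp add: kc.h_simps[OF xy(1)] kc.sym[OF xy(1)])
    finally show "g c x (\<psi> (fund c \<xi> ?y)) u = g c x (fund c (Ad e (inv k) \<xi>) x) u" .
  qed
  have "dim (range (\<lambda>\<xi>. fund c \<xi> ?y)) = dim (\<psi> ` range (\<lambda>\<xi>. fund c \<xi> ?y))"
    using dim_image_eq[OF lin\<psi> inj_on_subset[OF inj\<psi>]] by simp
  also have "\<dots> \<le> dim (range (\<lambda>\<xi>. fund c \<xi> x))"
    by (rule dim_subset) (auto simp: \<psi>_fund)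
  finally show ?thesis .
qed

text \<open>Near \<open>s\<close>, the orbit map at \<open>x\<close> is a right translation followed by the orbit map at the image
  point.\<close>

lemma range_act_derivative:
  assumes c: "c \<in> A" and s: "(s, x) \<in> act_dom c"
  shows "range (dd (\<lambda>s. act c (s, x)) s) \<subseteq> range (\<lambda>\<xi>. fund c \<xi> (act c (s, x)))"
proof -
  let ?k = "cinv e s"
  have sx: "s \<in> cran e" "x \<in> cran c" "?k (cinv c x) \<in> cdom c" using s by (auto simp: act_dom_def)
  have k: "?k \<in> K" by (rule cinv_e_in_K[OF sx(1)])
  \<comment> \<open>The inverse of \<open>?k\<close> may lie outside the domain of \<open>e\<close>,
    so it gets a group chart of its own.\<close>
  obtain d where d: "d \<in> B" "inv ?k \<in> cdom d"
    using smooth_atlas_cover[OF group_atlas group(3)[OF k]] by blast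
  note sd = smooth_atlas_chart[OF group_atlas d(1)]
  define \<sigma> where "\<sigma> = coord d (inv ?k)"
  have \<sigma>: "\<sigma> \<in> cran d" "cinv d \<sigma> = inv ?k" unfolding \<sigma>_def using sd d by auto
  define W where "W = {(s', \<sigma>'). s' \<in> cran e \<and> \<sigma>' \<in> cran d \<and> (\<lambda>(h, k). h \<circ> k) (cinv e s', cinv d \<sigma>') \<in> cdom e}"
  define C where "C = (\<lambda>(s', \<sigma>'). coord e ((\<lambda>(h, k). h \<circ> k) (cinv e s', cinv d \<sigma>')))"
  have W: "open W" "smooth_on W C"
    unfolding W_def C_def using smooth_map_prod_chart(1,2)[OF group_atlas group_atlas group_atlas smooth_compose identity_in_chart(1) d(1) identity_in_chart(1)] by auto
  have id: "?k \<circ> inv ?k = (\<lambda>p. p)" using isometry_facts(4)[OF k] by auto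
  have sW: "(s, \<sigma>) \<in> W" using sx \<sigma> identity_in_chart(2) id by (simp add: W_def)
  have Cs: "C (s, \<sigma>) = s0" by (simp add: C_def \<sigma> id s0_def)
  let ?\<theta> = "\<lambda>s'. C (s', \<sigma>)"
  define \<theta>' where "\<theta>' v = dd C (s, \<sigma>) (v, 0)" for v
  have "((\<lambda>s'. (s', \<sigma>)) has_derivative (\<lambda>v. (v, 0))) (at s)" by (auto intro!: derivative_eq_intros)
  from has_derivative_compose[OF this differentiable_dd[OF smooth_onD[OF W(2) sW]]]
  have \<theta>': "(?\<theta> has_derivative \<theta>') (at s)" by (simp add: \<theta>'_def[abs_def])
  let ?y = "act c (s, x)"
  have y: "?y \<in> cran c" "cinv c ?y = ?k (cinv c x)" using sx charts(6,8)[OF c] by (auto simp: act_def)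
  have ey: "(s0, ?y) \<in> act_dom c" by (rule act(3)[OF c y(1)])
  have "((\<lambda>s'. act c (?\<theta> s', ?y)) has_derivative (\<lambda>v. dd (act c) (s0, ?y) (\<theta>' v, 0))) (at s)"
    using has_derivative_compose[OF \<theta>', of "\<lambda>s. act c (s, ?y)"] has_derivative_act1[OF c ey] Cs by simp
  then have "((\<lambda>s'. act c (s', x)) has_derivative (\<lambda>v. dd (act c) (s0, ?y) (\<theta>' v, 0))) (at s)"
  proof (rule has_derivative_transform_within_open)
    show "open {s'. (s', \<sigma>) \<in> W}"
    proof -
      have "continuous_on UNIV (\<lambda>s'. (s', \<sigma>))" by (intro continuous_intros)
      from open_vimage[OF W(1) this] show ?thesis by (simp add: vimage_def)
    qed
    show "s \<in> {s'. (s', \<sigma>) \<in> W}" using sW by simp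
    fix s' assume "s' \<in> {s'. (s', \<sigma>) \<in> W}"
    then have "cinv e (?\<theta> s') = cinv e s' \<circ> inv ?k" using echart(8) by (simp add: W_def C_def \<sigma>)
    then show "act c (?\<theta> s', ?y) = act c (s', x)"
      by (simp add: act_def y(2)[unfolded act_def, simplified] isometry_facts(3)[OF k])
  qed
  then have "dd (\<lambda>s. act c (s, x)) s v = fund c (\<theta>' v) ?y" for v
    by (simp add: dd_eq fund_eq[OF c y(1)])
  then show ?thesis by auto
qed

lemma orbit_eq: "q \<in> orbit K p \<Longrightarrow> orbit K q = orbit K p"
proof -
  assume "q \<in> orbit K p"
  then obtain k where k: "k \<in> K" "q = k p" by (auto simp: orbit_def)
  show ?thesis
  proof (intro set_eqI iffI)
    fix y assume "y \<in> orbit K q"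
    then obtain h where "h \<in> K" "y = (h \<circ> k) p" using k by (auto simp: orbit_def)
    then show "y \<in> orbit K p" using group(2)[OF _ k(1)] unfolding orbit_def by blast
  next
    fix y assume "y \<in> orbit K p"
    then obtain h where "h \<in> K" "y = (h \<circ> inv k) q" using k isometry_facts(3)[OF k(1)] by (auto simp: orbit_def)
    then show "y \<in> orbit K q" using group(2)[OF _ group(3)[OF k(1)]] unfolding orbit_def by blast
  qed
qed

context
  fixes p :: 'm and U :: "(real^'n) set" and f :: "real^'n \<Rightarrow> 'm"
  assumes param: "local_parametrization A (orbit K p) U f"
begin

lemma open_U: "open U" and continuous_f: "continuous_on U f"
  using param by (auto simp: local_parametrization_def smooth_map_def euclidean_atlas_def cdom_def)

definition pdom :: "('m, complex^'n) chart \<Rightarrow> (real^'n) set" where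
  "pdom c = U \<inter> f -` cdom c"

context
  fixes c assumes c: "c \<in> A"
begin

lemma pdom: "open (pdom c)" "smooth_on (pdom c) (coord c \<circ> f)" "t \<in> pdom c \<Longrightarrow> inj (dd (coord c \<circ> f) t)"
    "t \<in> pdom c \<Longrightarrow> (coord c \<circ> f) t \<in> cran c" "t \<in> pdom c \<Longrightarrow> cinv c ((coord c \<circ> f) t) = f t"
proof -
  show op: "open (pdom c)"
    unfolding pdom_def by (rule continuous_open_preimage[OF continuous_f open_U open_cdom[OF c]])
  let ?d = "(U, \<lambda>x. x) :: (real^'n, real^'n) chart"
  have "smooth_on (rep_dom ?d c f) (rep ?d c f)"
    using param c by (simp add: local_parametrization_def smooth_map_def euclidean_atlas_def)
  moreover have "rep_dom ?d c f = pdom c" by (auto simp: rep_dom_def pdom_def cdom_def coord_def)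
  moreover have "rep ?d c f t = (coord c \<circ> f) t" if "t \<in> pdom c" for t
  proof -
    have "cinv ?d t = t"
      using inv_into_f_f[of "\<lambda>x. x" U t] that by (simp add: cinv_def cdom_def coord_def pdom_def)
    then show ?thesis by (simp add: rep_apply)
  qed
  ultimately show "smooth_on (pdom c) (coord c \<circ> f)"
    using smooth_on_cong[OF op] by metis
  show "t \<in> pdom c \<Longrightarrow> inj (dd (coord c \<circ> f) t)"
    using param c by (auto simp: local_parametrization_def pdom_def)
  show "t \<in> pdom c \<Longrightarrow> (coord c \<circ> f) t \<in> cran c" "t \<in> pdom c \<Longrightarrow> cinv c ((coord c \<circ> f) t) = f t"
    using charts(6,8)[OF c] by (auto simp: pdom_def)
qed

lemma diff_param: "t \<in> pdom c \<Longrightarrow> (coord c \<circ> f) differentiable (at t)"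
  by (rule smooth_onD[OF pdom(2)])

text \<open>The curve \<open>q\<close> starting at \<open>f t\<close> stays in the orbit. As the
  orbit carries the subspace topology, \<open>q\<close> lifts continuously to parameters for small
  times; \<open>\<psi> \<circ> M\<close> shows that the lift is differentiable, so the velocity of
  the curve is tangent.\<close>

lemma fund_tangent:
  assumes t: "t \<in> pdom c"
  shows "fund c \<xi> ((coord c \<circ> f) t) \<in> range (dd (coord c \<circ> f) t)"
proof -
  let ?F = "coord c \<circ> f"
  let ?x = "?F t"
  note x = pdom(4,5)[OF t]
  obtain f' where f': "homeomorphism U (f ` U) f f'" and opn: "openin (top_of_set (orbit K p)) (f ` U)"
    using param by (auto simp: local_parametrization_def)
  obtain V where V: "open V" "f ` U = orbit K p \<inter> V" using opn by (auto simp: openin_open)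
  have "Ck_on (Suc 0) (pdom c) ?F" using pdom(2) by (simp add: smooth_on_def del: Ck_on.simps)
  from immersion_left_inverse[OF pdom(1) t this pdom(3)[OF t]]
  obtain M :: "complex^'n \<Rightarrow> real^'n" and U' W \<psi> where M: "linear M" and U': "open U'" "U' \<subseteq> pdom c" "t \<in> U'" "open W"
    "homeomorphism U' W (\<lambda>x. M (?F x)) \<psi>" and d\<psi>: "\<And>w. w \<in> W \<Longrightarrow> \<psi> differentiable (at w)" by metis
  define q where "q \<tau> = cinv e (s0 + \<tau> *\<^sub>R \<xi>) (f t)" for \<tau> :: real
  define T where "T = {\<tau>::real. (s0 + \<tau> *\<^sub>R \<xi>, ?x) \<in> act_dom c}"
  let ?\<gamma> = "\<lambda>\<tau>. act c (s0 + \<tau> *\<^sub>R \<xi>, ?x)"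
  have contT: "continuous_on UNIV (\<lambda>\<tau>. (s0 + \<tau> *\<^sub>R \<xi>, ?x))" by (intro continuous_intros)
  have T: "open T" "0 \<in> T"
    using open_vimage[OF act(1)[OF c] contT] act(3)[OF c x(1)] by (simp_all add: T_def vimage_def)
  have cont\<gamma>: "continuous_on T ?\<gamma>"
    by (rule continuous_on_compose2[OF smooth_on_continuous[OF act(2)[OF c]] continuous_on_subset[OF contT]])
      (auto simp: T_def)
  have q: "q \<tau> = cinv c (?\<gamma> \<tau>)" "?\<gamma> \<tau> \<in> cran c" "q \<tau> \<in> orbit K p" if \<tau>: "\<tau> \<in> T" for \<tau>
  proof -
    have *: "s0 + \<tau> *\<^sub>R \<xi> \<in> cran e" "cinv e (s0 + \<tau> *\<^sub>R \<xi>) (f t) \<in> cdom c"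
      using \<tau> x(2) by (auto simp: T_def act_dom_def)
    show "q \<tau> = cinv c (?\<gamma> \<tau>)" "?\<gamma> \<tau> \<in> cran c"
      using charts(6,8)[OF c *(2)] x(2) by (simp_all add: q_def act_def)
    have "f t \<in> orbit K p" using V t by (auto simp: pdom_def)
    from orbit_eq[OF this] show "q \<tau> \<in> orbit K p"
      using cinv_e_in_K[OF *(1)] by (auto simp: q_def orbit_def)
  qed
  have contq: "continuous_on T q"
  proof -
    have "continuous_on T (\<lambda>\<tau>. cinv c (?\<gamma> \<tau>))"
      by (rule continuous_on_compose2[OF charts(5)[OF c] cont\<gamma>]) (use q in auto)
    then show ?thesis by (rule continuous_on_eq) (simp add: q)
  qed
  have q0: "q 0 = f t" by (simp add: q_def s0)
  \<comment> \<open>Relative openness of the image of \<open>f\<close> in the orbit keeps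
    \<open>q\<close> inside this image for small times.\<close>
  define T1 where "T1 = T \<inter> q -` V"
  have T1: "open T1" "0 \<in> T1"
    using continuous_open_preimage[OF contq T(1) V(1)] T(2) q0 V(2) t by (auto simp: T1_def pdom_def)
  have qU: "q \<tau> \<in> f ` U" if "\<tau> \<in> T1" for \<tau> using that q(3) V(2) by (auto simp: T1_def)
  define T2 where "T2 = T1 \<inter> (\<lambda>\<tau>. f' (q \<tau>)) -` U'"
  have contf': "continuous_on T1 (\<lambda>\<tau>. f' (q \<tau>))"
    by (rule continuous_on_compose2[of "f ` U" f'])
      (use f' qU contq in \<open>auto simp: homeomorphism_def T1_def intro: continuous_on_subset\<close>)
  have f't: "f' (f t) = t" using f' t by (auto simp: homeomorphism_def pdom_def)
  have T2: "open T2" "0 \<in> T2"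
    using continuous_open_preimage[OF contf' T1(1) U'(1)] T1(2) q0 f't U'(3) by (auto simp: T2_def)
  \<comment> \<open>The lift to parameters in a visibly differentiable form; its agreement with
    \<open>f' (q \<tau>)\<close> rests on continuity of the latter, which keeps it in
    \<open>U'\<close>.\<close>
  define \<tau>t where "\<tau>t \<tau> = \<psi> (M (?\<gamma> \<tau>))" for \<tau>
  have F\<tau>: "?F (\<tau>t \<tau>) = ?\<gamma> \<tau>" if \<tau>: "\<tau> \<in> T2" for \<tau>
  proof -
    let ?u = "f' (q \<tau>)"
    have u: "?u \<in> U'" using \<tau> by (simp add: T2_def)
    have "q \<tau> \<in> f ` U" using \<tau> qU by (simp add: T2_def)
    then have fu: "f ?u = q \<tau>" by (rule homeomorphism_apply2[OF f'])
    have Fu: "?F ?u = ?\<gamma> \<tau>"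
    proof -
      have T: "\<tau> \<in> T" using \<tau> by (simp add: T2_def T1_def)
      have "?F ?u = coord c (q \<tau>)" by (simp only: o_apply fu)
      also have "\<dots> = ?\<gamma> \<tau>" unfolding q(1)[OF T] by (rule charts(9)[OF c q(2)[OF T]])
      finally show ?thesis .
    qed
    have "\<tau>t \<tau> = ?u" unfolding \<tau>t_def Fu[symmetric] by (rule homeomorphism_apply1[OF U'(5) u])
    then show ?thesis by (simp only: Fu)
  qed
  have d\<gamma>: "(?\<gamma> has_derivative (\<lambda>k. k *\<^sub>R fund c \<xi> ?x)) (at 0)"
  proof -
    have "((\<lambda>\<tau>::real. s0 + \<tau> *\<^sub>R \<xi>) has_derivative (\<lambda>k. k *\<^sub>R \<xi>)) (at 0)" by (auto intro!: derivative_eq_intros)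
    from has_derivative_compose[OF this, of "\<lambda>s. act c (s, ?x)"] has_derivative_act1[OF c act(3)[OF c x(1)]]
    have "(?\<gamma> has_derivative (\<lambda>k. dd (act c) (s0, ?x) (k *\<^sub>R \<xi>, 0))) (at 0)" by simp
    moreover have "dd (act c) (s0, ?x) (k *\<^sub>R \<xi>, 0) = k *\<^sub>R fund c \<xi> ?x" for k
      by (rule HOL.trans[OF fund_eq[OF c x(1), symmetric] linear_cmul[OF linear_fund[OF c x(1)]]])
    ultimately show ?thesis by (simp only:)
  qed
  have M\<gamma>: "M (?\<gamma> 0) \<in> W" and \<psi>0: "\<psi> (M (?\<gamma> 0)) = t"
    using U'(3,5) act(4)[OF c x(1)] by (auto simp: homeomorphism_def)
  have blM: "bounded_linear M" using M by (simp add: linear_conv_bounded_linear)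
  have "(\<tau>t has_derivative (\<lambda>k. dd \<psi> (M (?\<gamma> 0)) (M (k *\<^sub>R fund c \<xi> ?x)))) (at 0)"
    unfolding \<tau>t_def[abs_def]
    by (rule has_derivative_compose[OF bounded_linear.has_derivative[OF blM d\<gamma>] differentiable_dd[OF d\<psi>[OF M\<gamma>]]])
  moreover have "\<tau>t 0 = t" using \<psi>0 by (simp add: \<tau>t_def)
  ultimately have "((\<lambda>\<tau>. ?F (\<tau>t \<tau>)) has_derivative (\<lambda>k. dd ?F t (dd \<psi> (M (?\<gamma> 0)) (M (k *\<^sub>R fund c \<xi> ?x))))) (at 0)"
    using has_derivative_compose[of \<tau>t _ 0 UNIV ?F] differentiable_dd[OF diff_param[OF t]] by metis
  then have "(?\<gamma> has_derivative (\<lambda>k. dd ?F t (dd \<psi> (M (?\<gamma> 0)) (M (k *\<^sub>R fund c \<xi> ?x))))) (at 0)"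
    by (rule has_derivative_transform_within_open[OF _ T2]) (rule F\<tau>)
  from fun_cong[OF has_derivative_unique[OF d\<gamma> this], of 1]
  have "fund c \<xi> ?x = dd ?F t (dd \<psi> (M (?\<gamma> 0)) (M (1 *\<^sub>R fund c \<xi> ?x)))" by simp
  then show ?thesis by blast
qed

text \<open>If the fields spanned less, the orbit map would have deficient rank near the identity,
  and the image of a neighbourhood would come from a null set. Finitely many translates of that
  neighbourhood cover the compact group, so the open set \<open>W\<close> of parameters would be a
  finite union of null sets.\<close>

lemma fund_spans_tangent:
  assumes K: "compact K" and t: "t \<in> pdom c"
  shows "range (dd (coord c \<circ> f) t) = range (\<lambda>\<xi>. fund c \<xi> ((coord c \<circ> f) t))"
proof (rule ccontr)
  let ?F = "coord c \<circ> f"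
  let ?x = "?F t"
  assume ne: "range (dd ?F t) \<noteq> range (\<lambda>\<xi>. fund c \<xi> ?x)"
  note x = pdom(4,5)[OF t]
  have linF: "linear (dd ?F t)" by (rule linear_dd[OF diff_param[OF t]])
  have sub: "range (\<lambda>\<xi>. fund c \<xi> ?x) \<subseteq> range (dd ?F t)" using fund_tangent[OF t] by blast
  have "dim (range (dd ?F t)) = CARD('n)"
    using dim_image_eq[OF linF inj_on_subset[OF pdom(3)[OF t]], of UNIV] by simp
  then have small: "dim (range (\<lambda>\<xi>. fund c \<xi> ?x)) < CARD('n)"
    using subspace_dim_equal[OF linear_subspace_image[OF linear_fund[OF c x(1)] subspace_UNIV]
        linear_subspace_image[OF linF subspace_UNIV] sub] ne by force
  define V where "V = {s. (s, ?x) \<in> act_dom c}"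
  let ?\<Phi> = "\<lambda>s. act c (s, ?x)"
  have contV: "continuous_on UNIV (\<lambda>s. (s, ?x))" by (intro continuous_intros)
  have V: "open V" "s0 \<in> V"
    using open_vimage[OF act(1)[OF c] contV] act(3)[OF c x(1)] by (simp_all add: V_def vimage_def)
  have C1: "Ck_on (Suc 0) V ?\<Phi>"
  proof -
    have "Ck_on (Suc 0) V (\<lambda>s. act c ((0, ?x) + (s, 0)))"
    proof (rule Ck_on_affine[OF V(1), of "\<lambda>s. (s, 0)"])
      show "Ck_on (Suc 0) (act_dom c) (act c)" using act(2)[OF c] by (simp add: smooth_on_def del: Ck_on.simps)
    qed (auto simp: V_def bounded_linear_Pair)
    then show ?thesis by simp
  qed
  have range0: "range (dd ?\<Phi> s0) = range (\<lambda>\<xi>. fund c \<xi> ?x)"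
  proof -
    have "dd ?\<Phi> s0 = (\<lambda>\<xi>. fund c \<xi> ?x)"
      unfolding fund_eq[OF c x(1)] by (rule ext, rule dd_eq[OF has_derivative_act1[OF c act(3)[OF c x(1)]]])
    then show ?thesis by (simp only:)
  qed
  have \<Phi>: "?\<Phi> s \<in> cran c" "cinv c (?\<Phi> s) = cinv e s (f t)" "cinv e s \<in> K" if "s \<in> V" for s
    using that charts(6,8)[OF c] cinv_e_in_K x(2) by (auto simp: V_def act_dom_def act_def)
  have rank: "dim (range (dd ?\<Phi> s)) \<le> dim (range (dd ?\<Phi> s0))" if s: "s \<in> V" for s
  proof -
    have "dim (range (dd ?\<Phi> s)) \<le> dim (range (\<lambda>\<xi>. fund c \<xi> (?\<Phi> s)))"
      by (rule dim_subset[OF range_act_derivative[OF c]]) (use s in \<open>simp add: V_def\<close>)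
    also have "?\<Phi> s = rep c c (cinv e s) ?x" by (simp add: rep_apply act_def)
    also have "dim (range (\<lambda>\<xi>. fund c \<xi> (rep c c (cinv e s) ?x))) \<le> dim (range (\<lambda>\<xi>. fund c \<xi> ?x))"
      by (rule dim_fund_le[OF c \<Phi>(3)[OF s]]) (use s in \<open>simp add: rep_dom_eq[OF atlas c] V_def act_dom_def\<close>)
    finally show ?thesis unfolding range0 .
  qed
  obtain N and R :: "(real^'n) set" and \<eta> where N: "open N" "s0 \<in> N" "N \<subseteq> V" and R: "negligible R" "\<eta> differentiable_on R"
    "\<eta> ` R \<subseteq> ?\<Phi> ` V" "?\<Phi> ` N \<subseteq> \<eta> ` R"
    using constant_rank_negligible[OF V C1 rank] small unfolding range0 by blast
  \<comment> \<open>The left translate by \<open>k\<close> of the neighbourhood of the identity with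
    coordinates in \<open>N\<close>.\<close>
  define O' where "O' k = {h \<in> K. inv k \<circ> h \<in> cinv e ` N}" for k
  have Ncran: "N \<subseteq> cran e" using N(3) by (auto simp: V_def act_dom_def)
  have openN: "openin (top_of_set K) (cinv e ` N)"
  proof -
    have "openin (top_of_set (cdom e)) (cdom e \<inter> coord e -` N)"
      by (rule continuous_openin_preimage_gen[OF echart(4) N(1)])
    moreover have "cdom e \<inter> coord e -` N = cinv e ` N"
      using Ncran echart(7,8,9) by force
    ultimately show ?thesis using openin_trans[OF _ echart(1)] by simp
  qed
  have O': "openin (top_of_set K) (O' k)" "k \<in> O' k" if k: "k \<in> K" for k
  proof -
    have "continuous_on K (\<lambda>h. (\<lambda>(h, k). h \<circ> k) (inv k, h))"
      by (rule continuous_on_compose2[OF smooth_map_prod_chart(3)[OF group_atlas group_atlas group_atlas smooth_compose identity_in_chart(1) identity_in_chart(1) identity_in_chart(1)]])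
        (use group(3)[OF k] in \<open>auto intro!: continuous_intros\<close>)
    then have "continuous_on K (\<lambda>h. inv k \<circ> h)" by simp
    moreover have "(\<lambda>h. inv k \<circ> h) \<in> K \<rightarrow> K" using group(2)[OF group(3)[OF k]] by auto
    ultimately have "openin (top_of_set K) (K \<inter> (\<lambda>h. inv k \<circ> h) -` (cinv e ` N))"
      using openN by (rule continuous_openin_preimage)
    moreover have "K \<inter> (\<lambda>h. inv k \<circ> h) -` (cinv e ` N) = O' k" by (auto simp: O'_def)
    ultimately show "openin (top_of_set K) (O' k)" by simp
    have "inv k \<circ> k = cinv e s0" using isometry_facts(3)[OF k] by (auto simp: s0)
    then show "k \<in> O' k" using k N(2) by (auto simp: O'_def)
  qed
  obtain D where D: "D \<subseteq> O' ` K" "finite D" "K \<subseteq> \<Union>D"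
  proof -
    have "\<forall>S\<in>O' ` K. openin (top_of_set K) S" "K \<subseteq> \<Union>(O' ` K)" using O' by auto
    then show ?thesis using K that unfolding compact_eq_openin_cover by metis
  qed
  obtain H where H: "H \<subseteq> K" "finite H" "D = O' ` H" using finite_subset_image[OF D(2,1)] by metis
  have "Ck_on (Suc 0) (pdom c) ?F" using pdom(2) by (simp add: smooth_on_def del: Ck_on.simps)
  from immersion_left_inverse[OF pdom(1) t this pdom(3)[OF t]]
  obtain M :: "complex^'n \<Rightarrow> real^'n" and U' W \<psi> where M: "linear M" and U': "open U'" "U' \<subseteq> pdom c" "t \<in> U'" "open W"
    "homeomorphism U' W (\<lambda>x. M (?F x)) \<psi>" by metis
  have blM: "bounded_linear M" using M by (simp add: linear_conv_bounded_linear)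
  \<comment> \<open>\<open>\<zeta> k\<close> sends the null set through the orbit map, the isometry
    \<open>k\<close> and \<open>M\<close> into parameter space; \<open>Rk k\<close> is the part on
    which this stays in the chart \<open>c\<close>. Differentiable images of null sets are null
    there, since both sides have dimension \<open>CARD('n)\<close>.\<close>
  define Rk where "Rk k = {\<rho> \<in> R. \<eta> \<rho> \<in> rep_dom c c k}" for k
  define \<zeta> where "\<zeta> k \<rho> = M (rep c c k (\<eta> \<rho>))" for k \<rho>
  have neg: "negligible (\<zeta> k ` Rk k)" if k: "k \<in> H" for k
  proof (rule negligible_differentiable_image_negligible)
    show "negligible (Rk k)" by (rule negligible_subset[OF R(1)]) (auto simp: Rk_def)
    have sm: "smooth_on (rep_dom c c k) (rep c c k)"
      using smooth_map_chart(2)[OF atlas atlas isometry_facts(2) c c] k H(1) by blast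
    show "\<zeta> k differentiable_on Rk k"
      unfolding differentiable_on_def
    proof
      fix \<rho> assume \<rho>: "\<rho> \<in> Rk k"
      obtain \<eta>' where "(\<eta> has_derivative \<eta>') (at \<rho> within R)"
        using R(2) \<rho> by (auto simp: differentiable_on_def differentiable_def Rk_def)
      then have "(\<eta> has_derivative \<eta>') (at \<rho> within Rk k)"
        by (rule has_derivative_subset) (auto simp: Rk_def)
      from bounded_linear.has_derivative[OF blM has_derivative_compose[OF this differentiable_dd[OF smooth_onD[OF sm]]]]
      show "\<zeta> k differentiable (at \<rho> within Rk k)"
        unfolding \<zeta>_def[abs_def] using \<rho> by (auto simp: Rk_def intro: differentiableI)
    qed
  qed simp
  have "W \<subseteq> (\<Union>k\<in>H. \<zeta> k ` Rk k)"
  proof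
    fix y assume y: "y \<in> W"
    define u where "u = \<psi> y"
    have u: "u \<in> pdom c" "M (?F u) = y" using U'(2,5) y by (auto simp: u_def homeomorphism_def)
    have "openin (top_of_set (orbit K p)) (f ` U)" using param by (simp add: local_parametrization_def)
    then have "f ` U \<subseteq> orbit K p" by (rule openin_imp_subset)
    then have "f u \<in> orbit K p" "f t \<in> orbit K p" using u t by (auto simp: pdom_def)
    then have "f u \<in> orbit K (f t)" using orbit_eq[of "f t" p] by simp
    then obtain h where h: "h \<in> K" "f u = h (f t)" by (auto simp: orbit_def)
    then obtain k where k: "k \<in> H" "h \<in> O' k" using D(3) H(3) by blast
    then obtain s where s: "s \<in> N" "inv k \<circ> h = cinv e s" by (auto simp: O'_def)
    have kK: "k \<in> K" using k H by blast
    have "h (f t) = k ((inv k \<circ> h) (f t))" by (simp add: isometry_facts(4)[OF kK])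
    then have fu: "f u = k (cinv c (?\<Phi> s))" using h s \<Phi>(2)[of s] N(3) by auto
    have "?\<Phi> s \<in> \<eta> ` R" using R(4) s(1) by blast
    then obtain \<rho> where \<rho>': "?\<Phi> s = \<eta> \<rho>" "\<rho> \<in> R" by (rule imageE)
    note \<rho> = \<rho>'(2) \<rho>'(1)[symmetric]
    have "?\<Phi> s \<in> rep_dom c c k"
      using fu u(1) \<Phi>(1)[of s] s(1) N(3) by (auto simp: rep_dom_eq[OF atlas c] pdom_def)
    then have "\<rho> \<in> Rk k" using \<rho> by (simp add: Rk_def)
    moreover have "y = \<zeta> k \<rho>" by (simp add: \<zeta>_def \<rho> rep_apply u(2)[symmetric] fu)
    ultimately show "y \<in> (\<Union>k\<in>H. \<zeta> k ` Rk k)" using k(1) by blast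
  qed
  moreover have "negligible (\<Union>k\<in>H. \<zeta> k ` Rk k)" using neg H(2) by (intro negligible_Union) auto
  ultimately have "negligible W" using negligible_subset by blast
  moreover have "W \<noteq> {}" using U'(3,5) by (auto simp: homeomorphism_def)
  ultimately show False using open_not_negligible[OF U'(4)] by blast
qed

end

end

end

section \<open>Mean curvature of Lagrangian orbits\<close>

context hamiltonian_kaehler
begin

text \<open>The vectors \<open>e\<^sub>i\<close>, \<open>J e\<^sub>i\<close> form a basis of the ambient tangent space, whose dual basis is given by
  the inverse of the Gram matrix. Hence the trace of \<open>J \<nabla>X\<close> is twice the trace of its compression to
  the orbit, and the latter is the component along \<open>J X\<close> of the trace of the second fundamental form.\<close>

lemma mean_curvature_eq_0_iff:
  fixes p :: 'm and f :: "real^'n \<Rightarrow> 'm"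
  assumes K: "compact K" and param: "local_parametrization A (orbit K p) U f"
    and lagrangian: "lagrangian A g (orbit K p)"
    and c: "c \<in> A" and t: "t \<in> U \<inter> f -` cdom c"
  shows "mean_curvature (g c) (coord c \<circ> f) t = 0 \<longleftrightarrow> (\<forall>\<xi>. div_J_fund \<xi> (f t) = 0)"
proof -
  let ?F = "coord c \<circ> f"
  let ?x = "?F t"
  interpret kc: kaehler_chart "g c" "cran c" by (rule kaehler_chart[OF c])
  have tp: "t \<in> pdom U f c" using t by (simp add: pdom_def[OF param])
  note pd = pdom[OF param c]
  note x = pd(4,5)[OF tp]
  define h where "h = g c ?x"
  define L where "L = dd ?F t"
  have linL: "linear L" unfolding L_def by (rule linear_dd[OF diff_param[OF param c tp]])
  have h_simps: "h (u + u') v = h u v + h u' v" "h v (u + u') = h v u + h v u'"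
    "h (u - u') v = h u v - h u' v" "h v (u - u') = h v u - h v u'"
    "h (r *\<^sub>R u) v = r * h u v" "h v (r *\<^sub>R u) = r * h v u"
    "h (- u) v = - h u v" "h v (- u) = - h v u" "h 0 v = 0" "h v 0 = 0"
    "h (\<Sum>i\<in>I. X i) v = (\<Sum>i\<in>I. h (X i) v)" "h v (\<Sum>i\<in>I. X i) = (\<Sum>i\<in>I. h v (X i))"
    for u u' v r X and I :: "'n set"
    unfolding h_def using kc.h_simps[OF x(1)] kc.h_sum[OF x(1)] by auto
  have h_sym: "h u v = h v u" for u v unfolding h_def by (rule kc.sym[OF x(1)])
  have h_J: "h (J u) (J v) = h u v" "h (J u) v = - h u (J v)" for u v
    unfolding h_def by (rule kc.J_invariant[OF x(1)] kc.J_skew[OF x(1)])+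
  have h_pos: "h u u > 0" if "u \<noteq> 0" for u unfolding h_def by (rule kc.pos[OF x(1) that])
  have J_lin: "J (u + v) = J u + J v" "J (r *\<^sub>R u) = r *\<^sub>R J u" "J (\<Sum>i\<in>I. X i) = (\<Sum>i\<in>I. J (X i))"
    for u v r X and I :: "'n set"
    using linear_add[OF linear_J] linear_cmul[OF linear_J] linear_sum[OF linear_J] by auto
  have lag: "g c (?F s) (J (dd ?F s a)) (dd ?F s b) = 0" if "s \<in> pdom U f c" for s a b
    using lagrangian param c that unfolding lagrangian_def kaehler_form_def pdom_def[OF param] by simp
  have LJ: "h (J (L a)) (L b) = 0" "h (L b) (J (L a)) = 0" for a b
    using lag[OF tp] h_sym[of "L b"] by (auto simp: h_def L_def)
  define e where "e i = L (axis i 1)" for i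
  have L_e: "L a = (\<Sum>i\<in>UNIV. (a $ i) *\<^sub>R e i)" for a
  proof -
    have "a = (\<Sum>i\<in>UNIV. (a $ i) *\<^sub>R axis i 1)"
      using basis_expansion[of a] by (simp add: scalar_mult_eq_scaleR)
    then have "L a = L (\<Sum>i\<in>UNIV. (a $ i) *\<^sub>R axis i 1)" by simp
    then show ?thesis by (simp add: e_def linear_sum[OF linL] linear_cmul[OF linL])
  qed
  have injL: "L a = 0 \<Longrightarrow> a = 0" for a
    using pd(3)[OF tp] linear_injective_0[OF linL] by (simp add: L_def)
  define Gr where "Gr = induced_metric (g c) ?F t"
  have Gr: "Gr $ i $ j = h (e i) (e j)" for i j
    by (simp add: Gr_def induced_metric_def h_def e_def L_def)
  define Gi where "Gi = matrix_inv Gr"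
  have inv: "invertible Gr"
  proof -
    have "a = 0" if "Gr *v a = 0" for a
    proof -
      have "h (L a) (L a) = (\<Sum>i\<in>UNIV. (a $ i) * (Gr *v a) $ i)"
        by (simp add: L_e h_simps matrix_vector_mult_def Gr sum_distrib_left mult_ac) (simp add: h_sym)
      then have "L a = 0" using h_pos[of "L a"] that by force
      then show ?thesis by (rule injL)
    qed
    then show ?thesis
      by (metis invertible_left_inverse matrix_left_invertible_ker)
  qed
  have "Gi ** Gr = mat 1"
    using someI_ex[OF inv[unfolded invertible_def]] by (simp add: Gi_def matrix_inv_def)
  then have GiGr: "(\<Sum>j\<in>UNIV. Gi $ k $ j * Gr $ j $ i) = (if k = i then 1 else 0)" for k i
    by (simp add: matrix_matrix_mult_def mat_def vec_eq_iff)
  \<comment> \<open>\<open>E\<close> and \<open>EJ\<close> are the orthogonal projections onto the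
    tangent space and onto its rotation, written with the inverse Gram matrix.\<close>
  define E where "E v = (\<Sum>k\<in>UNIV. \<Sum>j\<in>UNIV. (Gi $ k $ j * h v (e j)) *\<^sub>R e k)" for v
  define EJ where "EJ v = (\<Sum>k\<in>UNIV. \<Sum>j\<in>UNIV. (Gi $ k $ j * h v (J (e j))) *\<^sub>R J (e k))" for v
  have E_L: "E (L a) = L a" for a
  proof -
    have "(\<Sum>j\<in>UNIV. Gi $ k $ j * h (L a) (e j)) = a $ k" for k
    proof -
      have "(\<Sum>j\<in>UNIV. Gi $ k $ j * h (L a) (e j)) = (\<Sum>j\<in>UNIV. \<Sum>i\<in>UNIV. a $ i * (Gi $ k $ j * Gr $ j $ i))"
        by (simp add: L_e h_simps Gr sum_distrib_left mult_ac h_sym[of "e _" "e _"])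
      also have "\<dots> = (\<Sum>i\<in>UNIV. a $ i * (\<Sum>j\<in>UNIV. Gi $ k $ j * Gr $ j $ i))"
        by (subst sum.swap) (simp add: sum_distrib_left)
      also have "\<dots> = a $ k" by (simp add: GiGr if_distrib cong: if_cong)
      finally show ?thesis .
    qed
    then show ?thesis unfolding E_def L_e[of a] by (simp flip: scaleR_sum_left)
  qed
  have EJ_L: "EJ (L a) = 0" and E_JL: "E (J (L a)) = 0" for a
    by (simp_all add: E_def EJ_def e_def LJ)
  have EJ_JL: "EJ (J (L a)) = J (L a)" for a
    using arg_cong[OF E_L, of J a] by (simp add: E_def EJ_def J_lin h_J(1))
  have E_add: "E (u + v) = E u + E v" "EJ (u + v) = EJ u + EJ v" for u v
    by (simp_all add: E_def EJ_def h_simps distrib_left scaleR_add_left sum.distrib)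
  \<comment> \<open>The Lagrangian condition makes the tangent space orthogonal to its rotation, so
    \<open>\<Lambda>\<close> is injective between spaces of the same real dimension
    \<open>2 * CARD('n)\<close>.\<close>
  have decomp: "\<exists>a b. v = L a + J (L b)" for v
  proof -
    define \<Lambda> where "\<Lambda> z = L (fst z) + J (L (snd z))" for z
    have lin: "linear \<Lambda>"
      by (rule linearI) (simp_all add: \<Lambda>_def linear_add[OF linL] linear_cmul[OF linL] J_lin algebra_simps)
    have "z = 0" if "\<Lambda> z = 0" for z
    proof -
      have "h (\<Lambda> z) (\<Lambda> z) = h (L (fst z)) (L (fst z)) + h (L (snd z)) (L (snd z))"
        by (simp add: \<Lambda>_def h_simps LJ h_J(1))
      then have "h (L (fst z)) (L (fst z)) + h (L (snd z)) (L (snd z)) = 0" using that by (simp add: h_simps)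
      then have "L (fst z) = 0" "L (snd z) = 0"
        using h_pos[of "L (fst z)"] h_pos[of "L (snd z)"] h_simps(9) by (smt (verit))+
      then show ?thesis using injL by (simp add: prod_eq_iff)
    qed
    then have "inj \<Lambda>" by (simp add: linear_injective_0[OF lin])
    then have "surj \<Lambda>" by (rule linear_injective_imp_surjective[OF lin]) simp
    then obtain z where "v = \<Lambda> z" by (metis surjD)
    then show ?thesis by (auto simp: \<Lambda>_def)
  qed
  have resolution: "v = E v + EJ v" for v
  proof -
    obtain a b where "v = L a + J (L b)" using decomp by blast
    then show ?thesis by (simp add: E_add E_L EJ_L E_JL EJ_JL)
  qed
  have E_range: "E v \<in> range L" for v
  proof -
    obtain a b where "v = L a + J (L b)" using decomp by blast
    then show ?thesis by (simp add: E_add E_L E_JL)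
  qed
  have EJ_range: "\<exists>b. EJ v = J (L b)" for v
  proof -
    obtain a b where "v = L a + J (L b)" using decomp by blast
    then show ?thesis by (auto simp: E_add EJ_L EJ_JL)
  qed
  have normal: "normal_part h (range L) w = EJ w" for w
    unfolding normal_part_def
  proof (rule the_equality)
    have "w - EJ w = E w" using resolution[of w] by (metis add_diff_cancel_right')
    then show 1: "w - EJ w \<in> range L \<and> (\<forall>u\<in>range L. h (EJ w) u = 0)"
      using E_range EJ_range[of w] LJ(1) by auto
    fix z assume z: "w - z \<in> range L \<and> (\<forall>u\<in>range L. h z u = 0)"
    then obtain a b where ab: "w - z = L a" "w - EJ w = L b" using 1 by auto
    have d: "EJ w - z = L (a - b)" by (simp add: linear_diff[OF linL] flip: ab)
    have "h (EJ w - z) (EJ w - z) = h (EJ w - z) (L (a - b))" by (simp only: d)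
    also have "\<dots> = h (EJ w) (L (a - b)) - h z (L (a - b))" by (rule h_simps(3))
    also have "\<dots> = 0" using z 1 by simp
    finally have "h (EJ w - z) (EJ w - z) = 0" .
    then show "z = EJ w" using h_pos[of "EJ w - z"] by force
  qed
  define S where "S i j = second_fundamental_form (g c) ?F t (axis i 1) (axis j 1)" for i j
  \<comment> \<open>The ambient covariant derivative of the coordinate field \<open>e i\<close>
    along \<open>e j\<close>; its tangential part is invisible to \<open>J X\<close>.\<close>
  define N where "N i j = dd (\<lambda>s. dd ?F s (axis i 1)) t (axis j 1) + christoffel (g c) ?x (e j) (e i)" for i j
  have S: "S i j = EJ (N i j)" for i j
    using normal by (simp add: S_def second_fundamental_form_def N_def e_def L_def h_def)
  define H where "H = (\<Sum>i\<in>UNIV. \<Sum>j\<in>UNIV. Gi $ i $ j *\<^sub>R S i j)"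
  have H_mean: "mean_curvature (g c) ?F t = 0 \<longleftrightarrow> H = 0"
    by (simp add: mean_curvature_def H_def S_def Gi_def Gr_def)
  have h_JX: "h (J (fund c \<xi> ?x)) H = - div_J_fund \<xi> (f t) / 2" for \<xi>
  proof -
    interpret kx: killing_chart "g c" "cran c" "fund c \<xi>" "ham c \<xi>" by (rule killing_chart[OF c])
    let ?X = "fund c \<xi> ?x"
    obtain b where b: "?X = L b" using fund_tangent[OF param c tp, of \<xi>] by (auto simp: L_def)
    define C where "C v = J (kx.nab ?x v)" for v
    \<comment> \<open>As \<open>X\<close> is tangent and the orbit Lagrangian, the product of
      \<open>J X\<close> with the coordinate field vanishes along the whole parametrized piece;
      differentiate it along \<open>e j\<close>.\<close>
    have hN: "h (J ?X) (N i j) = - h (C (e j)) (e i)" for i j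
    proof -
      have "((\<lambda>s. g c (?F s) (J (fund c \<xi> (?F s))) (dd ?F s (axis i 1))) has_derivative (\<lambda>k.
          dd (\<lambda>y. g c y (J ?X) (e i)) ?x (L k) + g c ?x (J (dd (fund c \<xi>) ?x (L k))) (e i) +
          g c ?x (J ?X) (dd (\<lambda>s. dd ?F s (axis i 1)) t k))) (at t)"
        unfolding e_def L_def
      proof (rule kc.has_derivative_h_path[OF pd(1) tp pd(4)])
        show dF: "(?F has_derivative dd ?F t) (at t)" by (rule differentiable_dd[OF diff_param[OF param c tp]])
        show "((\<lambda>s. J (fund c \<xi> (?F s))) has_derivative (\<lambda>k. J (dd (fund c \<xi>) ?x (dd ?F t k)))) (at t)"
          by (rule kx.has_derivative_J[OF has_derivative_compose[OF dF differentiable_dd[OF kx.diff_X[OF x(1)]]]])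
        show "((\<lambda>s. dd ?F s (axis i 1)) has_derivative dd (\<lambda>s. dd ?F s (axis i 1)) t) (at t)"
          by (rule differentiable_dd[OF smooth_onD[OF smooth_on_dd[OF pd(2)] tp]])
      qed
      moreover have "((\<lambda>s. g c (?F s) (J (fund c \<xi> (?F s))) (dd ?F s (axis i 1))) has_derivative (\<lambda>k. 0)) (at t)"
      proof (rule has_derivative_transform_within_open[OF has_derivative_const pd(1) tp])
        fix s assume s: "s \<in> pdom U f c"
        then obtain b where "fund c \<xi> (?F s) = dd ?F s b" using fund_tangent[OF param c s, of \<xi>] by auto
        then show "0 = g c (?F s) (J (fund c \<xi> (?F s))) (dd ?F s (axis i 1))" using lag[OF s] by simp
      qed
      ultimately have "dd (\<lambda>y. g c y (J ?X) (e i)) ?x (e j) + h (J (dd (fund c \<xi>) ?x (e j))) (e i) +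
          h (J ?X) (dd (\<lambda>s. dd ?F s (axis i 1)) t (axis j 1)) = 0"
        unfolding h_def e_def[of j] by (rule fun_cong[OF has_derivative_unique])
      moreover have "dd (\<lambda>y. g c y (J ?X) (e i)) ?x (e j) =
          h (J (christoffel (g c) ?x (e j) ?X)) (e i) + h (J ?X) (christoffel (g c) ?x (e j) (e i))"
        unfolding h_def kc.metric_compatible[OF x(1)] kc.christoffel_J[OF x(1)] by (rule refl)
      ultimately show ?thesis by (simp add: N_def C_def kx.nab_def J_lin h_simps)
    qed
    have hS: "h (J ?X) (S i j) = h (J ?X) (N i j)" for i j
    proof -
      obtain a where a: "E (N i j) = L a" using E_range by blast
      have "N i j = L a + S i j" unfolding S a[symmetric] by (rule resolution)
      then have "h (J ?X) (N i j) = h (J ?X) (L a) + h (J ?X) (S i j)" by (simp only: h_simps)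
      also have "h (J ?X) (L a) = 0" unfolding b by (rule LJ(1))
      finally show ?thesis by simp
    qed
    have linC: "linear C"
      unfolding C_def using linear_compose[OF kx.linear_nab[OF x(1)] linear_J] by (simp add: o_def)
    \<comment> \<open>\<open>\<nabla>X\<close> is skew and commutes with the skew \<open>J\<close>,
      so their product is symmetric; this lets the indices \<open>i\<close> and \<open>j\<close> be
      exchanged below.\<close>
    have C_sym: "h (C u) v = h (C v) u" for u v
    proof -
      have "h (C u) v = - h (kx.nab ?x u) (J v)" unfolding C_def by (rule h_J(2))
      also have "\<dots> = h u (kx.nab ?x (J v))" unfolding h_def kx.nab_skew[OF x(1), of u] by simp
      also have "\<dots> = h u (C v)" unfolding C_def kx.nab_J[OF x(1)] by (rule refl)
      also have "\<dots> = h (C v) u" by (rule h_sym)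
      finally show ?thesis .
    qed
    have C_J: "C (J v) = J (C v)" for v unfolding C_def kx.nab_J[OF x(1)] by (rule refl)
    \<comment> \<open>The resolution \<open>v = E v + EJ v\<close> is inserted, which turns the
      trace over the standard basis into Gram contractions over the vectors \<open>e k\<close> and
      \<open>J (e k)\<close>.\<close>
    have "tr C = (\<Sum>k\<in>UNIV. \<Sum>j\<in>UNIV. Gi $ k $ j * (h (C (e k)) (e j) + h (C (J (e k))) (J (e j))))"
    proof -
      have C_exp: "C v = (\<Sum>k\<in>UNIV. \<Sum>j\<in>UNIV. (Gi $ k $ j * h v (e j)) *\<^sub>R C (e k) + (Gi $ k $ j * h v (J (e j))) *\<^sub>R C (J (e k)))" for v
        by (subst resolution[of v])
          (simp add: E_def EJ_def linear_add[OF linC] linear_sum[OF linC] linear_cmul[OF linC] sum.distrib)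
      have hb: "(\<Sum>b\<in>Basis. h b u * (w \<bullet> b)) = h w u" for u w
      proof -
        have "linear (\<lambda>w. h w u)" unfolding h_def by (rule kc.lin1[OF x(1)])
        from linear_basis_sum[OF this, of w] show ?thesis by (simp add: mult.commute)
      qed
      have "tr C = (\<Sum>b\<in>Basis. \<Sum>k\<in>UNIV. \<Sum>j\<in>UNIV. Gi $ k $ j * (h b (e j) * (C (e k) \<bullet> b)) +
          Gi $ k $ j * (h b (J (e j)) * (C (J (e k)) \<bullet> b)))"
        unfolding tr_def by (subst C_exp) (simp add: inner_sum_left inner_add_left mult.assoc)
      also have "\<dots> = (\<Sum>k\<in>UNIV. \<Sum>j\<in>UNIV. \<Sum>b\<in>Basis. Gi $ k $ j * (h b (e j) * (C (e k) \<bullet> b)) +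
          Gi $ k $ j * (h b (J (e j)) * (C (J (e k)) \<bullet> b)))"
        by (subst sum.swap, rule sum.cong[OF refl], rule sum.swap)
      also have "\<dots> = (\<Sum>k\<in>UNIV. \<Sum>j\<in>UNIV. Gi $ k $ j * (h (C (e k)) (e j) + h (C (J (e k))) (J (e j))))"
        by (simp add: sum.distrib hb distrib_left flip: sum_distrib_left)
      finally show ?thesis .
    qed
    \<comment> \<open>The rotated half equals the tangential half because \<open>C\<close> commutes
      with \<open>J\<close>; hence the divisor 2 in \<open>h_JX\<close>.\<close>
    also have "\<dots> = 2 * (\<Sum>k\<in>UNIV. \<Sum>j\<in>UNIV. Gi $ k $ j * h (C (e k)) (e j))"
      by (simp add: C_J h_J(1) sum_distrib_left mult_ac)
    also have "(\<Sum>k\<in>UNIV. \<Sum>j\<in>UNIV. Gi $ k $ j * h (C (e k)) (e j)) = - h (J ?X) H"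
    proof -
      have "h (J ?X) (S i j) = - h (C (e i)) (e j)" for i j
        unfolding hS hN C_sym[of "e j" "e i"] by (rule refl)
      then have "h (J ?X) H = (\<Sum>k\<in>UNIV. \<Sum>j\<in>UNIV. Gi $ k $ j * - h (C (e k)) (e j))"
        unfolding H_def by (simp only: h_simps)
      then show ?thesis by (simp only: mult_minus_right sum_negf minus_minus)
    qed
    finally have "tr C = - 2 * h (J ?X) H" by simp
    moreover have "tr C = div_J_fund \<xi> (f t)"
      using div_J_fund[OF c x(1), of \<xi>] x(2) by (simp add: kx.div_J_def C_def[abs_def])
    ultimately show ?thesis by simp
  qed
  have H_range: "\<exists>b. H = J (L b)"
  proof -
    have "\<exists>b. S i j = J (L b)" for i j unfolding S by (rule EJ_range)
    then obtain \<beta> where "\<And>i j. S i j = J (L (\<beta> i j))" by metis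
    then have "H = J (L (\<Sum>i\<in>UNIV. \<Sum>j\<in>UNIV. Gi $ i $ j *\<^sub>R \<beta> i j))"
      by (simp add: H_def linear_sum[OF linL] linear_cmul[OF linL] J_lin)
    then show ?thesis by blast
  qed
  have "H = 0 \<longleftrightarrow> (\<forall>\<xi>. h (J (fund c \<xi> ?x)) H = 0)"
  proof
    assume "\<forall>\<xi>. h (J (fund c \<xi> ?x)) H = 0"
    moreover obtain b where b: "H = J (L b)" using H_range by blast
    \<comment> \<open>\<open>H\<close> is \<open>J\<close> of a tangent vector, and every tangent
      vector is a value of a fundamental field, so the vanishing products include that of
      \<open>H\<close> with itself.\<close>
    moreover have "L b \<in> range (\<lambda>\<xi>. fund c \<xi> ?x)"
      unfolding fund_spans_tangent[OF param c K tp, symmetric] L_def by blast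
    ultimately have "h H H = 0" by auto
    then show "H = 0" using h_pos[of H] by force
  qed (simp add: h_simps)
  also have "\<dots> \<longleftrightarrow> (\<forall>\<xi>. div_J_fund \<xi> (f t) = 0)" unfolding h_JX by simp
  finally show ?thesis unfolding H_mean .
qed

end

theorem proposition4:
  fixes A :: "('m::t2_space, complex^'n) chart set"
    and g :: "('m, complex^'n) chart \<Rightarrow> complex^'n \<Rightarrow> complex^'n \<Rightarrow> complex^'n \<Rightarrow> real"
    and K :: "('m \<Rightarrow> 'm) set"
    and B :: "('m \<Rightarrow> 'm, 'k::euclidean_space) chart set"
    and e :: "('m \<Rightarrow> 'm, 'k) chart"
    and \<mu> :: "'m \<Rightarrow> 'k \<Rightarrow>\<^sub>L real"
    and p :: 'm
  assumes "compact (UNIV :: 'm set)" and "connected (UNIV :: 'm set)"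
    and "kaehler A g" and "einstein A g"
    and "lie_group_of_isometries A g K B" and "compact K" and "connected K"
    and "identity_chart B e"
    and "hamiltonian_action A g K e"
    and "canonical_moment_map A g K e \<mu>"
    and "lagrangian A g (orbit K p)"
  shows "minimal_submanifold TYPE('n) A g (orbit K p) \<longleftrightarrow> \<mu> ` orbit K p = {0}"
proof -
  interpret hamiltonian_kaehler A g K B e \<mu>
    using assms by unfold_locales (auto simp: canonical_moment_map_def)
  obtain l where l: "\<And>c x u v. c \<in> A \<Longrightarrow> x \<in> cran c \<Longrightarrow> ricci (g c) x u v = l * g c x u v"
    using assms(4) unfolding einstein_def by blast
  have int: "has_omega_integral A g \<mu> 0" using assms(10) by (simp add: canonical_moment_map_def)
  have mean: "mean_curvature (g c) (coord c \<circ> f) t = 0 \<longleftrightarrow> \<mu> (f t) = 0"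
    if "local_parametrization A (orbit K p) U f" "c \<in> A" "t \<in> U \<inter> f -` cdom c"
    for U and f :: "real^'n \<Rightarrow> 'm" and c t
  proof -
    have "mean_curvature (g c) (coord c \<circ> f) t = 0 \<longleftrightarrow> (\<forall>\<xi>. div_J_fund \<xi> (f t) = 0)"
      by (rule mean_curvature_eq_0_iff[OF assms(6) that(1) assms(11) that(2,3)])
    also have "\<dots> \<longleftrightarrow> (\<forall>\<xi>. blinfun_apply (\<mu> (f t)) \<xi> = 0)"
      using einstein_div_J_fund[OF l int] by blast
    also have "\<dots> \<longleftrightarrow> \<mu> (f t) = 0" by (auto intro: blinfun_eqI)
    finally show ?thesis .
  qed
  have sub: "submanifold TYPE('n) A (orbit K p)" using assms(11) by (simp add: lagrangian_def)
  \<comment> \<open>\<open>K\<close> contains the identity, so the orbit is nonempty and the image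
    cannot be the empty set.\<close>
  have "\<mu> ` orbit K p = {0} \<longleftrightarrow> (\<forall>q\<in>orbit K p. \<mu> q = 0)"
    using group(1) by (auto simp: orbit_def)
  also have "\<dots> \<longleftrightarrow> minimal_submanifold TYPE('n) A g (orbit K p)"
  proof
    assume zero: "\<forall>q\<in>orbit K p. \<mu> q = 0"
    have "\<mu> (f t) = 0" if "local_parametrization A (orbit K p) U f" "t \<in> U" for U and f :: "real^'n \<Rightarrow> 'm" and t
    proof -
      have "openin (top_of_set (orbit K p)) (f ` U)" using that(1) by (simp add: local_parametrization_def)
      then have "f ` U \<subseteq> orbit K p" by (rule openin_imp_subset)
      then show ?thesis using zero that(2) by blast
    qed
    then show "minimal_submanifold TYPE('n) A g (orbit K p)"
      using sub mean unfolding minimal_submanifold_def by blast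
  next
    assume min: "minimal_submanifold TYPE('n) A g (orbit K p)"
    show "\<forall>q\<in>orbit K p. \<mu> q = 0"
    proof
      fix q assume "q \<in> orbit K p"
      then obtain U and f :: "real^'n \<Rightarrow> 'm" where f: "local_parametrization A (orbit K p) U f" "q \<in> f ` U"
        using sub unfolding submanifold_def by blast
      then obtain t where t: "t \<in> U" "q = f t" by blast
      obtain c where c: "c \<in> A" "f t \<in> cdom c" by (rule chart_exists)
      then have "mean_curvature (g c) (coord c \<circ> f) t = 0"
        using min f(1) t unfolding minimal_submanifold_def by blast
      then show "\<mu> q = 0" using mean[OF f(1) c(1)] t c(2) by simp
    qed
  qed
  finally show ?thesis by blast
qed

end
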